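(* Let $T\in\mathcal{BC}(X)$, $f\in N(\sigma_S(T))$ and $g\in SH_L(\sigma_S(T))$. Then $$(\Delta(fg))(T)=(\Delta f)(T)g(T)+f(T)(\Delta g)(T)-\tfrac14(\overline{\mathcal D}f)(T)(\overline{\mathcal D}g)(T)-\tfrac14(\overline{\mathcal D}f)(T)\,\underline T\,(\Delta g)(T)-\tfrac14(\Delta f)(T)\,\underline T\,(\overline{\mathcal D}g)(T)-\tfrac14(\Delta f)(T)\,\underline T^2(\Delta g)(T),$$ where $\underline T=T_1e_1+T_2e_2+T_3e_3$.
   Context: $\mathbb H$: quaternions with units $e_1,e_2,e_3$. $\mathbb S$: imaginary units ($J^2=-1$). $\mathbb C_J=\mathbb R+J\mathbb R$. $\overline{\mathcal D}=\partial_{q_0}-\sum_{i=1}^3e_i\partial_{q_i}$, $\Delta$ the Laplacian in $q_0,\dots,q_3$. A set $U\subseteq\mathbb H$ is axially symmetric if $u+Iv\in U$ implies $u+Jv\in U$ for all $J\in\mathbb S$. A slice Cauchy domain is an axially symmetric open $U$ such that for every $J\in\mathbb S$ the boundary of $U\cap\mathbb C_J$ is a finite union of nonintersecting piecewise $C^1$ Jordan curves. On an axially symmetric open $U$, $f$ is left slice hyperholomorphic if $f(u+Jv)=\alpha(u,v)+J\beta(u,v)$ with $\mathbb H$-valued differentiable $\alpha$ even in $v$, $\beta$ odd in $v$, and $\partial_u\alpha=\partial_v\beta$, $\partial_v\alpha=-\partial_u\beta$; it is intrinsic if $\alpha,\beta$ are real valued. $X=X_{\mathbb R}\otimes\mathbb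 H$ is a two-sided quaternionic Banach module, $X_{\mathbb R}$ a real Banach space; $\mathcal B(X)$ is the space of bounded right linear operators; $(aT)(x)=aT(x)$, $(Ta)(x)=T(ax)$ for $a\in\mathbb H$. $\mathcal{BC}(X)$: operators $T=T_0+T_1e_1+T_2e_2+T_3e_3$ with pairwise commuting $T_i\in\mathcal B(X_{\mathbb R})$; $\overline T=T_0-T_1e_1-T_2e_2-T_3e_3$. $\rho_S(T)=\{s\in\mathbb H:(T^2-2\mathrm{Re}(s)T+|s|^2\mathcal I)^{-1}\in\mathcal B(X)\}$, $\sigma_S(T)=\mathbb H\setminus\rho_S(T)$; for $T\in\mathcal{BC}(X)$, $\rho_S(T)$ is also the set of $s$ with $\mathcal Q_{c,s}(T):=s^2-s(T+\overline T)+T\overline T$ invertible in $\mathcal B(X)$. $SH_L(\sigma_S(T))$, $N(\sigma_S(T))$: left, resp. intrinsic, slice hyperholomorphic functions whose (axially symmetric open) domain contains $\sigma_S(T)$. For $s\in\rho_S(T)$: $S^{-1}_L(s,T)=(s\mathcal I-\overline T)\mathcal Q_{c,s}(T)^{-1}$, $F_L(s,T)=-4(s\mathcal I-\overline T)\mathcal Q_{c,s}(T)^{-2}$, $\mathcal P^L_2(s,T)=-F_L(s,T)s+T_0F_L(s,T)$. Functional calculi: let $J\in\mathbb S$, $ds_J=ds(-J)$, and $U$ a bounded slice Cauchy domain with $\sigma_S(T)\subset U$, $\overline U\subset\mathrm{dom}(h)$ (the integrals do not depend on $U,J$). For $h\in SH_L(\sigma_S(T))$: $h(T)=\frac1{2\pi}\int_{\partial(U\cap\mathbb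 C_J)}S_L^{-1}(s,T)ds_Jh(s)$, $(\overline{\mathcal D}h)(T)=\frac1{2\pi}\int_{\partial(U\cap\mathbb C_J)}\mathcal P^L_2(s,T)ds_Jh(s)$, $(\Delta h)(T)=\frac1{2\pi}\int_{\partial(U\cap\mathbb C_J)}F_L(s,T)ds_Jh(s)$. *)

theory Defs
  imports "HOL-Complex_Analysis.Complex_Analysis"
begin

section \<open>Quaternions\<close>

datatype quat = Quat (q0: real) (q1: real) (q2: real) (q3: real)

lemma quat_eq_iff: "p = q \<longleftrightarrow> q0 p = q0 q \<and> q1 p = q1 q \<and> q2 p = q2 q \<and> q3 p = q3 q"
  by (cases p; cases q) auto

instantiation quat :: real_vector
begin

definition "0 = Quat 0 0 0 0"
definition "p + q = Quat (q0 p + q0 q) (q1 p + q1 q) (q2 p + q2 q) (q3 p + q3 q)"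
definition "- p = Quat (- q0 p) (- q1 p) (- q2 p) (- q3 p)"
definition "p - q = Quat (q0 p - q0 q) (q1 p - q1 q) (q2 p - q2 q) (q3 p - q3 q)"
definition "r *\<^sub>R p = Quat (r * q0 p) (r * q1 p) (r * q2 p) (r * q3 p)"

instance
  by standard
    (simp_all add: quat_eq_iff zero_quat_def plus_quat_def uminus_quat_def minus_quat_def
      scaleR_quat_def algebra_simps)

end

lemma quat_vector_sel [simp]:
  "q0 0 = 0" "q1 0 = 0" "q2 0 = 0" "q3 0 = 0"
  "q0 (p + q) = q0 p + q0 q" "q1 (p + q) = q1 p + q1 q"
  "q2 (p + q) = q2 p + q2 q" "q3 (p + q) = q3 p + q3 q"
  "q0 (- p) = - q0 p" "q1 (- p) = - q1 p" "q2 (- p) = - q2 p" "q3 (- p) = - q3 p"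
  "q0 (p - q) = q0 p - q0 q" "q1 (p - q) = q1 p - q1 q"
  "q2 (p - q) = q2 p - q2 q" "q3 (p - q) = q3 p - q3 q"
  "q0 (r *\<^sub>R p) = r * q0 p" "q1 (r *\<^sub>R p) = r * q1 p"
  "q2 (r *\<^sub>R p) = r * q2 p" "q3 (r *\<^sub>R p) = r * q3 p"
  by (simp_all add: zero_quat_def plus_quat_def uminus_quat_def minus_quat_def scaleR_quat_def)

instantiation quat :: real_algebra_1
begin

definition "1 = Quat 1 0 0 0"
definition "p * q = Quat
  (q0 p * q0 q - q1 p * q1 q - q2 p * q2 q - q3 p * q3 q)
  (q0 p * q1 q + q1 p * q0 q + q2 p * q3 q - q3 p * q2 q)
  (q0 p * q2 q - q1 p * q3 q + q2 p * q0 q + q3 p * q1 q)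
  (q0 p * q3 q + q1 p * q2 q - q2 p * q1 q + q3 p * q0 q)"

instance
  by standard (simp_all add: quat_eq_iff one_quat_def times_quat_def algebra_simps)

end

lemma quat_algebra_sel [simp]:
  "q0 1 = 1" "q1 1 = 0" "q2 1 = 0" "q3 1 = 0"
  "q0 (p * q) = q0 p * q0 q - q1 p * q1 q - q2 p * q2 q - q3 p * q3 q"
  "q1 (p * q) = q0 p * q1 q + q1 p * q0 q + q2 p * q3 q - q3 p * q2 q"
  "q2 (p * q) = q0 p * q2 q - q1 p * q3 q + q2 p * q0 q + q3 p * q1 q"
  "q3 (p * q) = q0 p * q3 q + q1 p * q2 q - q2 p * q1 q + q3 p * q0 q"
  by (simp_all add: one_quat_def times_quat_def)

instantiation quat :: real_inner
begin

definition "inner p q = q0 p * q0 q + q1 p * q1 q + q2 p * q2 q + q3 p * q3 q"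
definition "norm (p::quat) = sqrt (inner p p)"
definition "sgn (p::quat) = p /\<^sub>R norm p"
definition "dist (p::quat) q = norm (p - q)"
definition "(uniformity :: (quat \<times> quat) filter) = (INF e\<in>{0<..}. principal {(x, y). dist x y < e})"
definition "open (U::quat set) \<longleftrightarrow> (\<forall>x\<in>U. \<forall>\<^sub>F (x', y) in uniformity. x' = x \<longrightarrow> y \<in> U)"

instance
proof
  fix p :: quat
  have "inner p p = 0 \<longleftrightarrow> (q0 p)\<^sup>2 + (q1 p)\<^sup>2 + (q2 p)\<^sup>2 + (q3 p)\<^sup>2 = 0"
    by (simp add: inner_quat_def power2_eq_square)
  also have "\<dots> \<longleftrightarrow> p = 0"
    by (auto simp: quat_eq_iff add_nonneg_eq_0_iff)
  finally show "inner p p = 0 \<longleftrightarrow> p = 0" .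
qed (auto simp: inner_quat_def norm_quat_def sgn_quat_def dist_quat_def uniformity_quat_def
    open_quat_def algebra_simps)

end

instantiation quat :: real_normed_div_algebra
begin

definition "inverse q = Quat (q0 q) (- q1 q) (- q2 q) (- q3 q) /\<^sub>R inner q q"
definition "p div q = p * inverse q" for p q :: quat

instance
proof
  fix p q :: quat
  show "q \<noteq> 0 \<Longrightarrow> inverse q * q = 1" and "q \<noteq> 0 \<Longrightarrow> q * inverse q = 1"
    using inner_eq_zero_iff [of q]
    by (simp_all add: quat_eq_iff inverse_quat_def inner_quat_def field_simps)
  show "p div q = p * inverse q"
    by (simp add: divide_quat_def)
  show "inverse (0::quat) = 0"
    by (simp add: inverse_quat_def inner_quat_def)
  have "inner (p * q) (p * q) = inner p p * inner q q"
    by (simp add: inner_quat_def algebra_simps)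
  then show "norm (p * q) = norm p * norm q"
    by (simp add: norm_quat_def real_sqrt_mult)
qed

end

definition e1 :: quat where "e1 = Quat 0 1 0 0"
definition e2 :: quat where "e2 = Quat 0 0 1 0"
definition e3 :: quat where "e3 = Quat 0 0 0 1"

instantiation quat :: euclidean_space
begin

definition "Basis = {1, e1, e2, e3}"

instance
proof
  fix u v x :: quat
  show "u \<in> Basis \<Longrightarrow> v \<in> Basis \<Longrightarrow> inner u v = (if u = v then 1 else 0)"
    unfolding Basis_quat_def insert_iff empty_iff
    by (elim disjE; simp add: e1_def e2_def e3_def inner_quat_def quat_eq_iff)
  show "(\<forall>u\<in>Basis. inner x u = 0) \<longleftrightarrow> x = 0"
    unfolding Basis_quat_def ball_simps
    by (simp add: quat_eq_iff [of x] e1_def e2_def e3_def inner_quat_def)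
qed (simp_all add: Basis_quat_def)

end

lemma quat_units: "e1 * e1 = -1" "e2 * e2 = -1" "e3 * e3 = -1"
  "e1 * e2 = e3" "e2 * e3 = e1" "e3 * e1 = e2"
  by (simp_all add: e1_def e2_def e3_def quat_eq_iff)


section \<open>Slice hyperholomorphic functions\<close>

definition imag_units :: "quat set" (\<open>\<S>\<close>) where
  "\<S> = {J. J * J = -1}"

text \<open>The slice \<open>\<real> + J\<real>\<close> is coordinatised by \<^typ>\<open>complex\<close>.\<close>

definition slice_pt :: "quat \<Rightarrow> complex \<Rightarrow> quat" where
  "slice_pt J z = of_real (Re z) + J * of_real (Im z)"

definition slice :: "quat set \<Rightarrow> quat \<Rightarrow> complex set" where
  "slice U J = {z. slice_pt J z \<in> U}"

definition axially_symmetric :: "quat set \<Rightarrow> bool" where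
  "axially_symmetric U \<longleftrightarrow>
     (\<forall>u v. \<forall>I\<in>\<S>. \<forall>J\<in>\<S>. of_real u + I * of_real v \<in> U \<longrightarrow> of_real u + J * of_real v \<in> U)"

definition slice_components ::
  "quat set \<Rightarrow> (quat \<Rightarrow> quat) \<Rightarrow> (real \<times> real \<Rightarrow> quat) \<Rightarrow> (real \<times> real \<Rightarrow> quat) \<Rightarrow> bool" where
  "slice_components D h \<alpha> \<beta> \<longleftrightarrow>
     (\<forall>u v. \<forall>J\<in>\<S>. of_real u + J * of_real v \<in> D \<longrightarrow>
        h (of_real u + J * of_real v) = \<alpha> (u, v) + J * \<beta> (u, v) \<and>
        \<alpha> (u, - v) = \<alpha> (u, v) \<and> \<beta> (u, - v) = - \<beta> (u, v) \<and>
        \<alpha> differentiable (at (u, v)) \<and> \<beta> differentiable (at (u, v)) \<and>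
        frechet_derivative \<alpha> (at (u, v)) (1, 0) = frechet_derivative \<beta> (at (u, v)) (0, 1) \<and>
        frechet_derivative \<alpha> (at (u, v)) (0, 1) = - frechet_derivative \<beta> (at (u, v)) (1, 0))"

definition left_slice_hyperholomorphic :: "quat set \<Rightarrow> (quat \<Rightarrow> quat) \<Rightarrow> bool" where
  "left_slice_hyperholomorphic D h \<longleftrightarrow>
     open D \<and> axially_symmetric D \<and> (\<exists>\<alpha> \<beta>. slice_components D h \<alpha> \<beta>)"

definition intrinsic_slice_hyperholomorphic :: "quat set \<Rightarrow> (quat \<Rightarrow> quat) \<Rightarrow> bool" where
  "intrinsic_slice_hyperholomorphic D h \<longleftrightarrow>
     open D \<and> axially_symmetric D \<and>
     (\<exists>\<alpha> \<beta>. slice_components D h \<alpha> \<beta> \<and>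
        (\<forall>u v. \<forall>J\<in>\<S>. of_real u + J * of_real v \<in> D \<longrightarrow> \<alpha> (u, v) \<in> \<real> \<and> \<beta> (u, v) \<in> \<real>))"

text \<open>A function is paired with its domain; its values off the domain are irrelevant.\<close>

definition SH_L :: "quat set \<Rightarrow> (quat set \<times> (quat \<Rightarrow> quat)) set" where
  "SH_L K = {(D, h). left_slice_hyperholomorphic D h \<and> K \<subseteq> D}"

definition SH_N :: "quat set \<Rightarrow> (quat set \<times> (quat \<Rightarrow> quat)) set" where
  "SH_N K = {(D, h). intrinsic_slice_hyperholomorphic D h \<and> K \<subseteq> D}"


section \<open>Slice Cauchy domains\<close>

text \<open>Piecewise \<open>C\<^sup>1\<close> in the classical sense: on each closed piece the derivative is continuous up to the
  end points. \<^const>\<open>valid_path\<close> is weaker, as it admits unbounded derivatives near the break points.\<close>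

definition piecewise_C1 :: "(real \<Rightarrow> complex) \<Rightarrow> bool" where
  "piecewise_C1 \<gamma> \<longleftrightarrow> continuous_on {0..1} \<gamma> \<and>
     (\<exists>B. finite B \<and> {0, 1} \<subseteq> B \<and> B \<subseteq> {0..1} \<and>
        (\<forall>a\<in>B. \<forall>b\<in>B. a < b \<and> B \<inter> {a<..<b} = {} \<longrightarrow>
           (\<exists>\<gamma>'. continuous_on {a..b} \<gamma>' \<and>
              (\<forall>t\<in>{a..b}. (\<gamma> has_vector_derivative \<gamma>' t) (at t within {a..b})))))"

definition piecewise_C1_Jordan_curves :: "(real \<Rightarrow> complex) set \<Rightarrow> bool" where
  "piecewise_C1_Jordan_curves \<Gamma> \<longleftrightarrow> finite \<Gamma> \<and>
     (\<forall>\<gamma>\<in>\<Gamma>. piecewise_C1 \<gamma> \<and> simple_path \<gamma> \<and> pathfinish \<gamma> = pathstart \<gamma>) \<and>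
     disjoint_family_on path_image \<Gamma>"

definition slice_Cauchy_domain :: "quat set \<Rightarrow> bool" where
  "slice_Cauchy_domain U \<longleftrightarrow> open U \<and> axially_symmetric U \<and>
     (\<forall>J\<in>\<S>. \<exists>\<Gamma>. piecewise_C1_Jordan_curves \<Gamma> \<and> frontier (slice U J) = (\<Union>\<gamma>\<in>\<Gamma>. path_image \<gamma>))"

text \<open>The positively oriented boundary of \<open>U \<inter> \<complex>\<^sub>J\<close>, as a family of parametrised curves. Positive
  orientation means that the boundary winds once around the points of \<open>U \<inter> \<complex>\<^sub>J\<close> and does not wind
  around the points outside its closure.\<close>

definition oriented_boundary :: "quat set \<Rightarrow> quat \<Rightarrow> (real \<Rightarrow> complex) set \<Rightarrow> bool" where
  "oriented_boundary U J \<Gamma> \<longleftrightarrow> piecewise_C1_Jordan_curves \<Gamma> \<and>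
     frontier (slice U J) = (\<Union>\<gamma>\<in>\<Gamma>. path_image \<gamma>) \<and>
     (\<forall>z\<in>slice U J. (\<Sum>\<gamma>\<in>\<Gamma>. winding_number \<gamma> z) = 1) \<and>
     (\<forall>z. z \<notin> closure (slice U J) \<longrightarrow> (\<Sum>\<gamma>\<in>\<Gamma>. winding_number \<gamma> z) = 0)"


section \<open>The module \<open>X = X\<^sub>\<real> \<otimes> \<H>\<close> and its operators\<close>

text \<open>The tuple \<open>(x0, x1, x2, x3)\<close> stands for \<open>x0 + x1 e1 + x2 e2 + x3 e3\<close>. The product norm is one
  of the equivalent norms that make \<open>X\<close> a Banach space.\<close>

type_synonym 'a quat_module = "'a \<times> 'a \<times> 'a \<times> 'a"
type_synonym 'a quat_op = "'a quat_module \<Rightarrow>\<^sub>L 'a quat_module"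

definition lmult :: "quat \<Rightarrow> 'a::real_vector quat_module \<Rightarrow> 'a quat_module" where
  "lmult q = (\<lambda>(x0, x1, x2, x3).
    (q0 q *\<^sub>R x0 - q1 q *\<^sub>R x1 - q2 q *\<^sub>R x2 - q3 q *\<^sub>R x3,
     q0 q *\<^sub>R x1 + q1 q *\<^sub>R x0 + q2 q *\<^sub>R x3 - q3 q *\<^sub>R x2,
     q0 q *\<^sub>R x2 - q1 q *\<^sub>R x3 + q2 q *\<^sub>R x0 + q3 q *\<^sub>R x1,
     q0 q *\<^sub>R x3 + q1 q *\<^sub>R x2 - q2 q *\<^sub>R x1 + q3 q *\<^sub>R x0))"

definition rmult :: "'a::real_vector quat_module \<Rightarrow> quat \<Rightarrow> 'a quat_module" where
  "rmult = (\<lambda>(x0, x1, x2, x3) q.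
    (q0 q *\<^sub>R x0 - q1 q *\<^sub>R x1 - q2 q *\<^sub>R x2 - q3 q *\<^sub>R x3,
     q1 q *\<^sub>R x0 + q0 q *\<^sub>R x1 + q3 q *\<^sub>R x2 - q2 q *\<^sub>R x3,
     q2 q *\<^sub>R x0 - q3 q *\<^sub>R x1 + q0 q *\<^sub>R x2 + q1 q *\<^sub>R x3,
     q3 q *\<^sub>R x0 + q2 q *\<^sub>R x1 - q1 q *\<^sub>R x2 + q0 q *\<^sub>R x3))"

lemma quat_bimodule:
  "lmult (p * q) x = lmult p (lmult q x)" "lmult 1 x = x" "lmult (p + q) x = lmult p x + lmult q x"
  "rmult x (p * q) = rmult (rmult x p) q" "rmult x 1 = x" "rmult x (p + q) = rmult x p + rmult x q"
  "rmult (lmult p x) q = lmult p (rmult x q)"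
  by (simp_all add: lmult_def rmult_def split_beta algebra_simps prod_eq_iff)

lemma mult_embed:
  "lmult e1 (x, 0, 0, 0) = (0, x, 0, 0)" "rmult (x, 0, 0, 0) e1 = (0, x, 0, 0)"
  "lmult e2 (x, 0, 0, 0) = (0, 0, x, 0)" "rmult (x, 0, 0, 0) e2 = (0, 0, x, 0)"
  "lmult e3 (x, 0, 0, 0) = (0, 0, 0, x)" "rmult (x, 0, 0, 0) e3 = (0, 0, 0, x)"
  by (simp_all add: lmult_def rmult_def e1_def e2_def e3_def)

lemma bounded_linear_lmult: "bounded_linear (lmult q)"
  unfolding lmult_def split_beta
  by (intro bounded_linear_Pair bounded_linear_add bounded_linear_sub
      bounded_linear_const_scaleR bounded_linear_fst_comp bounded_linear_snd_comp
      bounded_linear_ident)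

text \<open>\<open>lop a\<close> is \<open>a\<I>\<close>, so that \<open>aT\<close> is \<open>lop a \<odot> T\<close> and \<open>Ta\<close> is \<open>T \<odot> lop a\<close>.\<close>

notation blinfun_compose (infixl \<open>\<odot>\<close> 70)

lift_definition lop :: "quat \<Rightarrow> 'a::real_normed_vector quat_op" is lmult
  by (rule bounded_linear_lmult)

text \<open>An operator on \<open>X\<^sub>\<real>\<close> acts componentwise on \<open>X\<close>.\<close>

lemma bounded_linear_componentwise:
  assumes "bounded_linear f"
  shows "bounded_linear (\<lambda>(x0, x1, x2, x3). (f x0, f x1, f x2, f x3))"
  unfolding split_beta
  using bounded_linear_compose [OF assms bounded_linear_fst]
    bounded_linear_compose [OF assms bounded_linear_fst_comp [OF bounded_linear_snd]]
    bounded_linear_compose [OF assms bounded_linear_fst_comp [OF bounded_linear_snd_comp [OF bounded_linear_snd]]]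
    bounded_linear_compose [OF assms bounded_linear_snd_comp [OF bounded_linear_snd_comp [OF bounded_linear_snd]]]
  by (intro bounded_linear_Pair)

lift_definition real_op :: "('a::real_normed_vector \<Rightarrow>\<^sub>L 'a) \<Rightarrow> 'a quat_op" is
  "\<lambda>A (x0, x1, x2, x3). (A x0, A x1, A x2, A x3)"
  by (rule bounded_linear_componentwise)

definition quat_op ::
  "('a::real_normed_vector \<Rightarrow>\<^sub>L 'a) \<Rightarrow> ('a \<Rightarrow>\<^sub>L 'a) \<Rightarrow> ('a \<Rightarrow>\<^sub>L 'a) \<Rightarrow> ('a \<Rightarrow>\<^sub>L 'a) \<Rightarrow> 'a quat_op" where
  "quat_op T0 T1 T2 T3 =
     real_op T0 + real_op T1 \<odot> lop e1 + real_op T2 \<odot> lop e2 + real_op T3 \<odot> lop e3"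

text \<open>\<open>\<B>(X)\<close>: the bounded right linear operators.\<close>

definition BX :: "'a::real_normed_vector quat_op set" where
  "BX = {T :: 'a quat_op. \<forall>x q. T (rmult x q) = rmult (T x) q}"

text \<open>\<open>\<B>\<C>(X)\<close>\<close>

definition BCX :: "'a::real_normed_vector quat_op set" where
  "BCX = {quat_op T0 T1 T2 T3 | T0 T1 T2 T3.
     T0 o\<^sub>L T1 = T1 o\<^sub>L T0 \<and> T0 o\<^sub>L T2 = T2 o\<^sub>L T0 \<and> T0 o\<^sub>L T3 = T3 o\<^sub>L T0 \<and>
     T1 o\<^sub>L T2 = T2 o\<^sub>L T1 \<and> T1 o\<^sub>L T3 = T3 o\<^sub>L T1 \<and> T2 o\<^sub>L T3 = T3 o\<^sub>L T2}"

lemma bounded_linear_restrict: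
  assumes "bounded_linear f"
  shows "bounded_linear (\<lambda>x. f (x, 0, 0, 0))"
  by (intro bounded_linear_compose [OF assms] bounded_linear_Pair bounded_linear_ident bounded_linear_zero)

text \<open>The components of \<open>T\<close> are recovered from its restriction to \<open>X\<^sub>\<real>\<close>, since
  \<open>T x = T\<^sub>0 x + T\<^sub>1 x e1 + T\<^sub>2 x e2 + T\<^sub>3 x e3\<close> for \<open>x\<close> in \<open>X\<^sub>\<real>\<close>; see \<open>comp_quat_op\<close> below.\<close>

lift_definition comp0 :: "'a::real_normed_vector quat_op \<Rightarrow> 'a \<Rightarrow>\<^sub>L 'a" is
  "\<lambda>T x. fst (T (x, 0, 0, 0))"
  by (rule bounded_linear_fst_comp [OF bounded_linear_restrict])
lift_definition comp1 :: "'a::real_normed_vector quat_op \<Rightarrow> 'a \<Rightarrow>\<^sub>L 'a" is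
  "\<lambda>T x. fst (snd (T (x, 0, 0, 0)))"
  by (rule bounded_linear_fst_comp [OF bounded_linear_snd_comp [OF bounded_linear_restrict]])
lift_definition comp2 :: "'a::real_normed_vector quat_op \<Rightarrow> 'a \<Rightarrow>\<^sub>L 'a" is
  "\<lambda>T x. fst (snd (snd (T (x, 0, 0, 0))))"
  by (rule bounded_linear_fst_comp [OF bounded_linear_snd_comp [OF bounded_linear_snd_comp [OF bounded_linear_restrict]]])
lift_definition comp3 :: "'a::real_normed_vector quat_op \<Rightarrow> 'a \<Rightarrow>\<^sub>L 'a" is
  "\<lambda>T x. snd (snd (snd (T (x, 0, 0, 0))))"
  by (rule bounded_linear_snd_comp [OF bounded_linear_snd_comp [OF bounded_linear_snd_comp [OF bounded_linear_restrict]]])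

lemma comp_quat_op:
  "comp0 (quat_op T0 T1 T2 T3) = T0" "comp1 (quat_op T0 T1 T2 T3) = T1"
  "comp2 (quat_op T0 T1 T2 T3) = T2" "comp3 (quat_op T0 T1 T2 T3) = T3"
  by (rule blinfun_eqI, simp add: comp0.rep_eq comp1.rep_eq comp2.rep_eq comp3.rep_eq
      quat_op_def real_op.rep_eq lop.rep_eq mult_embed blinfun.add_left blinfun.zero_right)+

lemma rmult_add_left: "rmult (x + y) q = rmult x q + rmult y q"
  by (cases x; cases y) (simp add: rmult_def algebra_simps)

lemma lop_in_BX: "lop p \<in> BX"
  by (simp add: BX_def lop.rep_eq quat_bimodule)

lemma real_op_in_BX: "real_op A \<in> BX"
  by (simp add: BX_def real_op.rep_eq rmult_def split_beta blinfun.add_right blinfun.diff_right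
      blinfun.scaleR_right)

lemma BX_add: "S \<in> BX \<Longrightarrow> T \<in> BX \<Longrightarrow> S + T \<in> BX"
  by (simp add: BX_def blinfun.add_left rmult_add_left)

lemma BX_compose: "S \<in> BX \<Longrightarrow> T \<in> BX \<Longrightarrow> S \<odot> T \<in> BX"
  by (simp add: BX_def del: split_paired_All)

lemma quat_op_in_BX: "quat_op T0 T1 T2 T3 \<in> BX"
  unfolding quat_op_def by (intro BX_add BX_compose lop_in_BX real_op_in_BX)

definition real_part :: "'a::real_normed_vector quat_op \<Rightarrow> 'a quat_op" where
  "real_part T = real_op (comp0 T)"

definition vec_part :: "'a::real_normed_vector quat_op \<Rightarrow> 'a quat_op" where
  "vec_part T = real_op (comp1 T) \<odot> lop e1 + real_op (comp2 T) \<odot> lop e2 + real_op (comp3 T) \<odot> lop e3"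

definition conj_op :: "'a::real_normed_vector quat_op \<Rightarrow> 'a quat_op" where
  "conj_op T = real_part T - vec_part T"

definition inverse_in_BX :: "'a::real_normed_vector quat_op \<Rightarrow> 'a quat_op \<Rightarrow> bool" where
  "inverse_in_BX A B \<longleftrightarrow> B \<in> BX \<and> A \<odot> B = id_blinfun \<and> B \<odot> A = id_blinfun"

definition op_inv :: "'a::real_normed_vector quat_op \<Rightarrow> 'a quat_op" where
  "op_inv A = (THE B. inverse_in_BX A B)"


section \<open>The \<open>S\<close>-spectrum and the kernels\<close>

definition S_resolvent_set :: "'a::real_normed_vector quat_op \<Rightarrow> quat set" where
  "S_resolvent_set T =
     {s. \<exists>B. inverse_in_BX (T \<odot> T - (2 * q0 s) *\<^sub>R T + (norm s)\<^sup>2 *\<^sub>R id_blinfun) B}"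

definition S_spectrum :: "'a::real_normed_vector quat_op \<Rightarrow> quat set" where
  "S_spectrum T = - S_resolvent_set T"

definition Q_c :: "quat \<Rightarrow> 'a::real_normed_vector quat_op \<Rightarrow> 'a quat_op" where
  "Q_c s T = lop (s * s) - lop s \<odot> (T + conj_op T) + T \<odot> conj_op T"

definition S_kernel :: "quat \<Rightarrow> 'a::real_normed_vector quat_op \<Rightarrow> 'a quat_op" where
  "S_kernel s T = (lop s - conj_op T) \<odot> op_inv (Q_c s T)"

definition F_kernel :: "quat \<Rightarrow> 'a::real_normed_vector quat_op \<Rightarrow> 'a quat_op" where
  "F_kernel s T = - 4 *\<^sub>R ((lop s - conj_op T) \<odot> op_inv (Q_c s T) \<odot> op_inv (Q_c s T))"

definition P2_kernel :: "quat \<Rightarrow> 'a::real_normed_vector quat_op \<Rightarrow> 'a quat_op" where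
  "P2_kernel s T = - (F_kernel s T \<odot> lop s) + real_part T \<odot> F_kernel s T"


section \<open>The functional calculi\<close>

text \<open>The data \<open>(U, J, \<Gamma>)\<close> of an integral over \<open>\<partial>(U \<inter> \<complex>\<^sub>J)\<close>: the domain, the imaginary unit and a
  positively oriented parametrisation of the boundary.\<close>

type_synonym contour = "quat set \<times> quat \<times> (real \<Rightarrow> complex) set"

definition admissible :: "'a::real_normed_vector quat_op \<Rightarrow> quat set \<Rightarrow> contour \<Rightarrow> bool" where
  "admissible T D = (\<lambda>(U, J, \<Gamma>). J \<in> \<S> \<and> slice_Cauchy_domain U \<and> bounded U \<and>
     S_spectrum T \<subseteq> U \<and> closure U \<subseteq> D \<and> oriented_boundary U J \<Gamma>)"

text \<open>\<open>1/(2\<pi>) \<integral> K(s) ds\<^sub>J h(s)\<close> over \<open>\<partial>(U \<inter> \<complex>\<^sub>J)\<close>, with \<open>ds\<^sub>J = ds (-J)\<close>.\<close>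

definition calculus ::
  "(quat \<Rightarrow> 'a::banach quat_op) \<Rightarrow> contour \<Rightarrow> (quat \<Rightarrow> quat) \<Rightarrow> 'a quat_op" where
  "calculus K = (\<lambda>(U, J, \<Gamma>) h. (1 / (2 * pi)) *\<^sub>R (\<Sum>\<gamma>\<in>\<Gamma>. integral {0..1} (\<lambda>t.
     K (slice_pt J (\<gamma> t)) \<odot>
     lop (slice_pt J (vector_derivative \<gamma> (at t within {0..1})) * (- J)) \<odot>
     lop (h (slice_pt J (\<gamma> t))))))"

text \<open>\<open>h(T)\<close>, \<open>(\<D>h)(T)\<close> (for the conjugate Cauchy--Fueter operator \<open>\<D>\<close>) and \<open>(\<Delta>h)(T)\<close>. The differential
  operators are absorbed into the kernels: the argument is \<open>h\<close> itself. The values do not depend on the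
  contour as long as it is \<^const>\<open>admissible\<close> for \<open>T\<close> and the domain of \<open>h\<close>.\<close>

definition S_calculus :: "'a::banach quat_op \<Rightarrow> contour \<Rightarrow> (quat \<Rightarrow> quat) \<Rightarrow> 'a quat_op" where
  "S_calculus T = calculus (\<lambda>s. S_kernel s T)"

definition D_calculus :: "'a::banach quat_op \<Rightarrow> contour \<Rightarrow> (quat \<Rightarrow> quat) \<Rightarrow> 'a quat_op" where
  "D_calculus T = calculus (\<lambda>s. P2_kernel s T)"

definition Laplace_calculus :: "'a::banach quat_op \<Rightarrow> contour \<Rightarrow> (quat \<Rightarrow> quat) \<Rightarrow> 'a quat_op" where
  "Laplace_calculus T = calculus (\<lambda>s. F_kernel s T)"

end

theory Submission
  imports Defs
begin

text \<open>Write \<open>A = T\<^sub>0\<close>, \<open>Y\<close> for the vector part of \<open>T\<close> and \<open>W = - Y\<^sup>2 = T\<^sub>1\<^sup>2 + T\<^sub>2\<^sup>2 + T\<^sub>3\<^sup>2\<close>, which commutes with all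
  quaternions. With \<open>Z = s - A\<close> one has \<open>Q\<^sub>c = Z\<^sup>2 + W\<close>, and with \<open>R = Q\<^sub>c\<^sup>-\<^sup>1\<close> the three kernels are \<open>(Z + Y) R\<close>,
  \<open>-4 (Z + Y) R\<^sup>2\<close> and \<open>4 (Z + Y) R\<^sup>2 Z\<close>. A left slice hyperholomorphic \<open>g\<close> is a sum \<open>g\<^sub>0 + g\<^sub>1 e\<^sub>1 + g\<^sub>2 e\<^sub>2 + g\<^sub>3 e\<^sub>3\<close> with
  intrinsic \<open>g\<^sub>i\<close>, so that \<open>g\<close> may be assumed intrinsic. For intrinsic functions the integrals against
  \<open>R, Z R, R\<^sup>2, Z R\<^sup>2, Z\<^sup>2 R\<^sup>2\<close> are independent of the contour and of the imaginary unit and commute with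
  all quaternions. The product rule thus reduces to formulas for the integrals of \<open>f g\<close> against \<open>R\<^sup>2\<close>
  and \<open>Z R\<^sup>2\<close>. They follow from kernel identities
  \<open>(p - s) \<Sum> A\<^sub>i(s) B\<^sub>i(p) = H(s) - H(p)\<close>, as in the proof that the Riesz--Dunford calculus is multiplicative.
  Bounded functionals reduce operator-valued integrals to complex ones.\<close>

section \<open>A Hahn--Banach argument\<close>

text \<open>The four summands with the factor 1/4 expand one product (D f + Delta f Y)(D g + Y Delta
  g), D being the conjugate Cauchy-Fueter operator. Formally its first factor has the kernel 4 (Z +
  Y) R^2 (Z - Y), which would be 4 (Z^2 + W) R^2 = 4 R if Y commuted with Z. It does not, because Z
  contains s; but the integrals commute with all quaternions and with the components of T, hence
  with Y, so the cancellation takes place after integration. Until then Y is kept to the left of the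
  kernels: on a slice R and Z commute with J, while Y does not.

  Other obstacles shape the proof. The resolvent set is defined through T^2 - 2 Re(s) T + |s|^2,
  while the kernels invert Q_c; the passage conjugates the components of operators. The seven
  calculi use unrelated contours and units, and f and g have different domains, so all integrals are
  moved to the contour of the product. Orientation is given by winding numbers of finitely many
  curves in a possibly disconnected domain, so Cauchy's theorem is needed for cycles.\<close>

definition sublinear :: "('a::real_vector \<Rightarrow> real) \<Rightarrow> bool" where
  "sublinear q \<longleftrightarrow> (\<forall>x y. q (x + y) \<le> q x + q y) \<and> (\<forall>c x. 0 \<le> c \<longrightarrow> q (c *\<^sub>R x) = c * q x)"

lemma sublinear_ge: "sublinear q \<Longrightarrow> - q (- x) \<le> q x"
proof -
  assume q: "sublinear q"
  have "q (0 *\<^sub>R x) = 0 * q x" "q (x + - x) \<le> q x + q (- x)"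
    using q unfolding sublinear_def by blast+
  then show ?thesis by simp
qed

text \<open>The usual device in the sublinear form of Hahn-Banach: a sublinear minorant of
  \<open>q\<close> whose value at \<open>- y\<close> is at most \<open>- q y\<close>.\<close>

definition push_down :: "('a::real_vector \<Rightarrow> real) \<Rightarrow> 'a \<Rightarrow> 'a \<Rightarrow> real" where
  "push_down q y x = (INF t\<in>{0..}. q (x + t *\<^sub>R y) - t * q y)"

lemma push_down_le:
  assumes q: "sublinear q" and "0 \<le> t"
  shows "push_down q y x \<le> q (x + t *\<^sub>R y) - t * q y"
  unfolding push_down_def
proof (rule cINF_lower)
  show "bdd_below ((\<lambda>t. q (x + t *\<^sub>R y) - t * q y) ` {0..})"
  proof (rule bdd_belowI2)
    fix t :: real assume "t \<in> {0..}"
    then have "t * q y = q (t *\<^sub>R y)" using q by (simp add: sublinear_def)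
    also have "\<dots> = q ((x + t *\<^sub>R y) + - x)" by simp
    also have "\<dots> \<le> q (x + t *\<^sub>R y) + q (- x)" using q unfolding sublinear_def by blast
    finally show "- q (- x) \<le> q (x + t *\<^sub>R y) - t * q y" by simp
  qed
qed (use assms in auto)

lemma push_down_ge:
  assumes "\<And>t. 0 \<le> t \<Longrightarrow> b \<le> q (x + t *\<^sub>R y) - t * q y"
  shows "b \<le> push_down q y x"
  unfolding push_down_def by (rule cINF_greatest) (use assms in auto)

text \<open>Parameters \<open>t\<close> and \<open>t'\<close> for two summands add up to the
  parameter \<open>t + t'\<close> for their sum, and scaling by \<open>c > 0\<close> only
  reparametrises \<open>t\<close>.\<close>

lemma sublinear_push_down:
  assumes q: "sublinear q"
  shows "sublinear (push_down q y)"
proof -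
  have add: "push_down q y (x + x') \<le> push_down q y x + push_down q y x'" for x x'
  proof -
    have "push_down q y (x + x') - (q (x' + t' *\<^sub>R y) - t' * q y) \<le> q (x + t *\<^sub>R y) - t * q y"
      if "0 \<le> t" "0 \<le> t'" for t t'
    proof -
      have "push_down q y (x + x') \<le> q ((x + x') + (t + t') *\<^sub>R y) - (t + t') * q y"
        by (rule push_down_le [OF q]) (use that in simp)
      also have "(x + x') + (t + t') *\<^sub>R y = (x + t *\<^sub>R y) + (x' + t' *\<^sub>R y)"
        by (simp add: algebra_simps)
      also have "q \<dots> \<le> q (x + t *\<^sub>R y) + q (x' + t' *\<^sub>R y)"
        using q unfolding sublinear_def by blast
      finally show ?thesis by (simp add: algebra_simps)
    qed
    then have "push_down q y (x + x') - (q (x' + t' *\<^sub>R y) - t' * q y) \<le> push_down q y x"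
      if "0 \<le> t'" for t' using that by (intro push_down_ge) auto
    then have "push_down q y (x + x') - push_down q y x \<le> push_down q y x'"
      by (intro push_down_ge) (simp add: algebra_simps)
    then show ?thesis by simp
  qed
  have le: "push_down q y (c *\<^sub>R x) \<le> c * push_down q y x" if "0 < c" for c x
  proof -
    have "push_down q y (c *\<^sub>R x) / c \<le> q (x + t *\<^sub>R y) - t * q y" if "0 \<le> t" for t
    proof -
      have "push_down q y (c *\<^sub>R x) \<le> q (c *\<^sub>R x + (c * t) *\<^sub>R y) - (c * t) * q y"
        by (rule push_down_le [OF q]) (use that \<open>0 < c\<close> in simp)
      also have "c *\<^sub>R x + (c * t) *\<^sub>R y = c *\<^sub>R (x + t *\<^sub>R y)"
        by (simp add: algebra_simps)
      also have "q \<dots> = c * q (x + t *\<^sub>R y)"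
        using q \<open>0 < c\<close> by (simp add: sublinear_def)
      finally show ?thesis using \<open>0 < c\<close> by (simp add: field_simps)
    qed
    then have "push_down q y (c *\<^sub>R x) / c \<le> push_down q y x"
      by (rule push_down_ge)
    then show ?thesis using \<open>0 < c\<close> by (simp add: field_simps)
  qed
  have "push_down q y (c *\<^sub>R x) = c * push_down q y x" if "0 \<le> c" for c x
  proof (cases "c = 0")
    case True
    have "q (t *\<^sub>R y) = t * q y" if "0 \<le> t" for t
      using q that by (simp add: sublinear_def)
    then have "push_down q y 0 = (INF t\<in>{0::real..}. 0)"
      unfolding push_down_def by (intro arg_cong [where f = Inf] image_cong) simp_all
    then show ?thesis using True by simp
  next
    case False
    then have c: "0 < c" using that by simp
    \<comment> \<open>The reverse inequality is \<open>le\<close> for the factor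
      \<open>1 / c\<close>.\<close>
    have "push_down q y ((1 / c) *\<^sub>R c *\<^sub>R x) \<le> (1 / c) * push_down q y (c *\<^sub>R x)"
      by (rule le) (use c in simp)
    then have "c * push_down q y x \<le> push_down q y (c *\<^sub>R x)"
      using c by (simp add: field_simps)
    with le [OF c, of x] show ?thesis by simp
  qed
  with add show ?thesis by (simp add: sublinear_def)
qed

lemma push_down_le_self: "sublinear q \<Longrightarrow> push_down q y x \<le> q x"
  using push_down_le [of q 0 y x] by simp

lemma push_down_uminus: "sublinear q \<Longrightarrow> push_down q y (- y) \<le> - q y"
proof -
  assume q: "sublinear q"
  have "q (0 *\<^sub>R y) = 0" using q unfolding sublinear_def by (metis mult_zero_left order_refl)
  then show ?thesis using push_down_le [OF q, of 1 y "- y"] by simp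
qed

text \<open>Zorn's lemma is applied to the sublinear functionals below a given one, ordered downwards:
  a minimal one coincides with all its \<^const>\<open>push_down\<close>s, hence is linear.\<close>

lemma minimal_sublinear:
  assumes p: "sublinear p"
  obtains m where "sublinear m" "\<And>x. m x \<le> p x" "\<And>x. m (- x) = - m x"
proof -
  define A where "A = {q. sublinear q \<and> q \<le> p}"
  define P where "P = (\<lambda>q q' :: 'a \<Rightarrow> real. q' \<le> q)"
  have "\<exists>m\<in>A. \<forall>a\<in>A. P m a \<longrightarrow> a = m"
  proof (rule predicate_Zorn)
    show "partial_order_on A (relation_of P A)"
      by (rule partial_order_on_relation_ofI) (auto simp: P_def)
    fix C assume C: "C \<in> Chains (relation_of P A)"
    then have CA: "C \<subseteq> A"
      by (auto simp: Chains_def relation_of_def)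
    have tot: "q \<le> q' \<or> q' \<le> q" if "q \<in> C" "q' \<in> C" for q q'
      using C that by (auto simp: Chains_def relation_of_def P_def)
    show "\<exists>u\<in>A. \<forall>a\<in>C. P a u"
    proof (cases "C = {}")
      case True
      then show ?thesis using p by (auto simp: A_def)
    next
      case False
      define u where "u x = (INF q\<in>C. q x)" for x
      have bdd: "bdd_below ((\<lambda>q. q x) ` C)" for x
      proof (rule bdd_belowI2)
        fix q assume "q \<in> C"
        then have "sublinear q" "q \<le> p" using CA by (auto simp: A_def)
        then have "- p (- x) \<le> - q (- x)" "- q (- x) \<le> q x"
          by (auto simp: le_fun_def sublinear_ge)
        then show "- p (- x) \<le> q x" by simp
      qed
      have u_le: "u x \<le> q x" if "q \<in> C" for q x
        unfolding u_def by (rule cINF_lower [OF bdd that])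
      have u_ge: "b \<le> u x" if "\<And>q. q \<in> C \<Longrightarrow> b \<le> q x" for b x
        unfolding u_def by (rule cINF_greatest [OF False that])
      have u_add: "u (x + y) \<le> u x + u y" for x y
      proof -
        have "u (x + y) - q' y \<le> q x" if C: "q \<in> C" "q' \<in> C" for q q'
        proof -
          \<comment> \<open>The smaller of two members of a chain serves for both summands.\<close>
          obtain r where r: "r \<in> C" "r \<le> q" "r \<le> q'"
            using tot [OF C] C by blast
          have "r (x + y) \<le> r x + r y"
            using r(1) CA by (auto simp: A_def sublinear_def)
          then have "u (x + y) \<le> r x + r y"
            using u_le [OF r(1), of "x + y"] by linarith
          also have "\<dots> \<le> q x + q' y"
            using r by (auto simp: le_fun_def intro: add_mono)
          finally show ?thesis by simp
        qed
        then have "u (x + y) - q' y \<le> u x" if "q' \<in> C" for q'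
          using that by (intro u_ge) auto
        then have "u (x + y) - u x \<le> u y"
          by (intro u_ge) (simp add: algebra_simps)
        then show ?thesis by simp
      qed
      have u_scale: "u (c *\<^sub>R x) = c * u x" if "0 \<le> c" for c x
      proof (cases "c = 0")
        case True
        have "q 0 = 0" if "q \<in> C" for q
        proof -
          have "q (0 *\<^sub>R 0) = 0 * q 0"
            using that CA unfolding A_def sublinear_def by blast
          then show ?thesis by simp
        qed
        then have "(\<lambda>q. q 0) ` C = {0}" using False by force
        then show ?thesis using True by (simp add: u_def)
      next
        case False
        then have c: "0 < c" using that by simp
        have q: "q (c *\<^sub>R x) = c * q x" if "q \<in> C" for q
          using that CA c by (auto simp: A_def sublinear_def)
        show ?thesis
        proof (rule antisym)
          have "u (c *\<^sub>R x) / c \<le> u x"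
            using u_le [of _ "c *\<^sub>R x"] q c by (intro u_ge) (simp add: field_simps)
          then show "u (c *\<^sub>R x) \<le> c * u x" using c by (simp add: field_simps)
          show "c * u x \<le> u (c *\<^sub>R x)"
            using u_le [of _ x] c by (intro u_ge) (simp add: q)
        qed
      qed
      have "u \<le> p"
      proof (rule le_funI)
        fix x
        obtain q where "q \<in> C" using False by blast
        then show "u x \<le> p x" using u_le [of q x] CA by (auto simp: A_def le_fun_def intro: order_trans)
      qed
      then have "u \<in> A" using u_add u_scale by (auto simp: A_def sublinear_def)
      then show ?thesis using u_le by (auto simp: P_def le_fun_def)
    qed
  qed
  then obtain m where m: "m \<in> A" and min: "\<And>a. a \<in> A \<Longrightarrow> a \<le> m \<Longrightarrow> a = m"
    by (auto simp: P_def)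
  have sub: "sublinear m" and le: "m \<le> p" using m by (auto simp: A_def)
  have "m (- y) = - m y" for y
  proof -
    have "push_down m y \<le> m" using push_down_le_self [OF sub] by (simp add: le_fun_def)
    moreover have "push_down m y \<in> A"
      using calculation le sublinear_push_down [OF sub] by (auto simp: A_def)
    ultimately have "push_down m y = m" using min by blast
    then have "m (- y) \<le> - m y" using push_down_uminus [OF sub, of y] by simp
    moreover have "- m y \<le> m (- y)" using sublinear_ge [OF sub, of "- y"] by simp
    ultimately show ?thesis by simp
  qed
  then show thesis using that sub le by (auto simp: le_fun_def)
qed

text \<open>Minimality starts from \<open>push_down norm x\<close> instead of \<open>norm\<close>:
  its value at \<open>- x\<close> is at most \<open>- norm x\<close>, which forces the linear
  functional below it to be at least \<open>norm x\<close> at \<open>x\<close>.\<close>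

lemma functional_nonzero:
  fixes x :: "'a::real_normed_vector"
  assumes "x \<noteq> 0"
  obtains l :: "'a \<Rightarrow> real" where "bounded_linear l" "l x \<noteq> 0"
proof -
  have n: "sublinear (norm :: 'a \<Rightarrow> real)"
    by (simp add: sublinear_def norm_triangle_ineq)
  obtain m where m: "sublinear m" "\<And>y. m y \<le> push_down norm x y" "\<And>y. m (- y) = - m y"
    using minimal_sublinear [OF sublinear_push_down [OF n, of x]] by metis
  have le: "m y \<le> norm y" for y
    using m(2) [of y] push_down_le_self [OF n, of x y] by simp
  have "bounded_linear m"
  proof (rule bounded_linear_intro)
    fix y z
    have "m ((y + z) + - z) \<le> m (y + z) + m (- z)" "m (y + z) \<le> m y + m z"
      using m(1) unfolding sublinear_def by blast+
    then show "m (y + z) = m y + m z" using m(3) [of z] by simp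
  next
    fix c y
    have *: "m (c *\<^sub>R y) = c * m y" if "0 \<le> c" for c y
      using m(1) that by (simp add: sublinear_def)
    show "m (c *\<^sub>R y) = c *\<^sub>R m y"
    proof (cases "0 \<le> c")
      case False
      then have "m ((- c) *\<^sub>R y) = (- c) * m y" by (intro *) simp
      then show ?thesis using m(3) [of "c *\<^sub>R y"] by simp
    qed (simp add: *)
  next
    fix y
    show "norm (m y) \<le> norm y * 1"
      using le [of y] le [of "- y"] m(3) [of y] by (simp add: abs_le_iff)
  qed
  moreover have "m (- x) \<le> - norm x"
    using m(2) [of "- x"] push_down_uminus [OF n, of x] by simp
  then have "m x \<noteq> 0" using assms m(3) [of x] by auto
  ultimately show thesis using that by blast
qed

section \<open>Cauchy's theorem for cycles\<close>

text \<open>Reduces cycles to single closed paths, for which Cauchy's theorem is available: every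
  loop is reached from \<open>a\<close> by a detour inside \<open>S\<close> that is run back
  afterwards, so the detours cancel in the integral.\<close>

lemma join_loops:
  fixes \<gamma> :: "'i \<Rightarrow> real \<Rightarrow> complex"
  assumes "open S" "connected S" "a \<in> S" "finite I"
    and "\<And>i. i \<in> I \<Longrightarrow> valid_path (\<gamma> i)" "\<And>i. i \<in> I \<Longrightarrow> pathfinish (\<gamma> i) = pathstart (\<gamma> i)"
    and "\<And>i. i \<in> I \<Longrightarrow> path_image (\<gamma> i) \<subseteq> S"
  shows "\<exists>\<delta>. valid_path \<delta> \<and> pathstart \<delta> = a \<and> pathfinish \<delta> = a \<and> path_image \<delta> \<subseteq> S \<and>
    (\<forall>f. f holomorphic_on S \<longrightarrow> contour_integral \<delta> f = (\<Sum>i\<in>I. contour_integral (\<gamma> i) f))"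
  using assms(4-)
proof (induction I rule: finite_induct)
  case empty
  show ?case
  proof (intro exI conjI)
    show "valid_path (linepath a a)" by (rule valid_path_linepath)
    show "path_image (linepath a a) \<subseteq> S" using \<open>a \<in> S\<close> by (simp add: path_image_linepath)
    show "\<forall>f. f holomorphic_on S \<longrightarrow> contour_integral (linepath a a) f = (\<Sum>i\<in>{}. contour_integral (\<gamma> i) f)"
      unfolding contour_integral_trivial by simp
  qed (rule pathstart_linepath pathfinish_linepath)+
next
  case (insert i I)
  obtain \<delta> where \<delta>: "valid_path \<delta>" "pathstart \<delta> = a" "pathfinish \<delta> = a" "path_image \<delta> \<subseteq> S"
    and int: "\<And>f. f holomorphic_on S \<Longrightarrow> contour_integral \<delta> f = (\<Sum>i\<in>I. contour_integral (\<gamma> i) f)"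
    using insert by (metis insert_iff)
  have i: "valid_path (\<gamma> i)" "pathfinish (\<gamma> i) = pathstart (\<gamma> i)" "path_image (\<gamma> i) \<subseteq> S"
    using insert by auto
  then have "pathstart (\<gamma> i) \<in> S" by auto
  \<comment> \<open>A polynomial detour is smooth, so the composite path stays valid.\<close>
  then obtain p where p: "polynomial_function p" "path_image p \<subseteq> S" "pathstart p = a"
      "pathfinish p = pathstart (\<gamma> i)"
    using connected_open_polynomial_connected [OF assms(1,2) \<open>a \<in> S\<close>] by metis
  then have vp: "valid_path p" by (simp add: valid_path_polynomial_function)
  define \<delta>' where "\<delta>' = \<delta> +++ (p +++ (\<gamma> i +++ reversepath p))"
  have "contour_integral \<delta>' f = contour_integral \<delta> f + contour_integral (\<gamma> i) f"
    if f: "f holomorphic_on S" for f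
  proof -
    have "f contour_integrable_on \<delta>" "f contour_integrable_on \<gamma> i" "f contour_integrable_on p"
      "f contour_integrable_on reversepath p"
      using \<delta> i vp p by (auto intro!: contour_integrable_holomorphic_simple [OF f \<open>open S\<close>])
    then show ?thesis
      using \<delta> i vp p unfolding \<delta>'_def
      by (simp add: contour_integral_reversepath contour_integral_join)
  qed
  moreover have "valid_path \<delta>'" "pathstart \<delta>' = a" "pathfinish \<delta>' = a" "path_image \<delta>' \<subseteq> S"
    using \<delta> i vp p by (auto simp: \<delta>'_def path_image_join)
  ultimately show ?case
    using int insert(1,2) by (intro exI [of _ \<delta>']) simp
qed

text \<open>The pasting argument: on the two closed complements, the winding numbers of the part in
  \<open>A\<close> and the negated winding numbers of the part in \<open>B\<close> fit together to a continuous integer-valued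
  function on the plane, which vanishes at infinity.\<close>

lemma winding_number_sum_separated:
  fixes \<gamma> :: "'i \<Rightarrow> real \<Rightarrow> complex"
  assumes fin: "finite I" "finite K" and op: "open A" "open B" "A \<inter> B = {}"
    and \<gamma>: "\<And>i. i \<in> I \<union> K \<Longrightarrow> path (\<gamma> i)" "\<And>i. i \<in> I \<union> K \<Longrightarrow> pathfinish (\<gamma> i) = pathstart (\<gamma> i)"
    and IA: "\<And>i. i \<in> I \<Longrightarrow> path_image (\<gamma> i) \<subseteq> A" and KB: "\<And>i. i \<in> K \<Longrightarrow> path_image (\<gamma> i) \<subseteq> B"
    and zero: "\<And>w. w \<notin> A \<union> B \<Longrightarrow>
      (\<Sum>i\<in>I. winding_number (\<gamma> i) w) + (\<Sum>i\<in>K. winding_number (\<gamma> i) w) = 0"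
    and w: "w \<notin> A"
  shows "(\<Sum>i\<in>I. winding_number (\<gamma> i) w) = 0"
proof -
  define n where "n L z = (\<Sum>i\<in>L. winding_number (\<gamma> i) z)" for L z
  have cont: "continuous_on (- C) (n L)" and int: "\<And>z. z \<notin> C \<Longrightarrow> n L z \<in> \<int>"
    if "L \<subseteq> I \<union> K" "\<And>i. i \<in> L \<Longrightarrow> path_image (\<gamma> i) \<subseteq> C" for L C
  proof -
    show "continuous_on (- C) (n L)"
      unfolding n_def
      by (rule continuous_on_sum, rule continuous_on_subset [OF continuous_on_winding_number])
        (use that \<gamma> in auto)
    fix z assume "z \<notin> C"
    then show "n L z \<in> \<int>"
      unfolding n_def
      by (intro Ints_sum integer_winding_number) (use that \<gamma> in auto)
  qed
  define m where "m z = (if z \<in> - A then n I z else - n K z)" for z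
  have "continuous_on (- A \<union> - B) m"
    unfolding m_def
  proof (rule continuous_on_cases)
    show "\<forall>z. z \<in> - A \<and> z \<notin> - A \<or> z \<in> - B \<and> z \<in> - A \<longrightarrow> n I z = - n K z"
      using zero by (auto simp: n_def eq_neg_iff_add_eq_0)
  qed (use op cont [of I A] cont [of K B] IA KB in \<open>auto intro: continuous_on_minus\<close>)
  then have mc: "continuous_on UNIV m" using op(3) by (metis Compl_Int compl_bot_eq double_compl)
  have mint: "m z \<in> \<int>" for z
  proof (cases "z \<in> A")
    case True
    then have "z \<notin> B" using op(3) by blast
    then show ?thesis using True int [of K B z] KB by (auto simp: m_def)
  qed (use int [of I A z] IA in \<open>auto simp: m_def\<close>)
  have "m constant_on UNIV"
  proof (rule continuous_discrete_range_constant [OF connected_UNIV mc])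
    fix x :: complex
    have "1 \<le> norm (m y - m x)" if "m y \<noteq> m x" for y
    proof -
      obtain k where k: "m y - m x = of_int k" using mint Ints_diff Ints_cases by metis
      then have "k \<noteq> 0" using that by auto
      then show ?thesis by (simp add: k)
    qed
    then show "\<exists>e>0. \<forall>y. y \<in> UNIV \<and> m y \<noteq> m x \<longrightarrow> e \<le> norm (m y - m x)"
      by (intro exI [of _ 1]) auto
  qed
  moreover obtain b where "m b = 0"
  proof -
    have "\<exists>B. \<forall>i\<in>I \<union> K. \<forall>z. B \<le> norm z \<longrightarrow> winding_number (\<gamma> i) z = 0"
    proof -
      obtain B where B: "\<And>i z. i \<in> I \<union> K \<Longrightarrow> B i \<le> norm z \<Longrightarrow> winding_number (\<gamma> i) z = 0"
        using winding_number_zero_at_infinity [OF \<gamma>] by metis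
      have "B i \<le> (\<Sum>i\<in>I \<union> K. \<bar>B i\<bar>)" if "i \<in> I \<union> K" for i
        using member_le_sum [OF that, of "\<lambda>i. \<bar>B i\<bar>"] fin by force
      then show ?thesis using B by (meson order_trans)
    qed
    then obtain B where "\<And>i z. i \<in> I \<union> K \<Longrightarrow> B \<le> norm z \<Longrightarrow> winding_number (\<gamma> i) z = 0" by blast
    then have "m (of_real B) = 0" by (simp add: m_def n_def)
    then show thesis using that by blast
  qed
  ultimately have "m w = 0" by (metis UNIV_I constant_on_def)
  then show ?thesis using w by (simp add: m_def n_def)
qed

text \<open>Loops in different components of \<open>S\<close> cannot be joined inside
  \<open>S\<close>, so the cycle is split by components. The hypothesis concerns the whole cycle
  only; \<open>winding_number_sum_separated\<close> passes it on to the part in each component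
  \<open>C\<close>, at all points off \<open>C\<close>.\<close>

lemma Cauchy_theorem_cycle:
  fixes \<gamma> :: "'i \<Rightarrow> real \<Rightarrow> complex"
  assumes S: "open S" and f: "f holomorphic_on S" and "finite I"
    and \<gamma>: "\<And>i. i \<in> I \<Longrightarrow> valid_path (\<gamma> i)" "\<And>i. i \<in> I \<Longrightarrow> pathfinish (\<gamma> i) = pathstart (\<gamma> i)"
      "\<And>i. i \<in> I \<Longrightarrow> path_image (\<gamma> i) \<subseteq> S"
    and zero: "\<And>w. w \<notin> S \<Longrightarrow> (\<Sum>i\<in>I. winding_number (\<gamma> i) w) = 0"
  shows "(\<Sum>i\<in>I. contour_integral (\<gamma> i) f) = 0"
proof -
  define c where "c i = connected_component_set S (pathstart (\<gamma> i))" for i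
  have start: "pathstart (\<gamma> i) \<in> S" if "i \<in> I" for i using \<gamma>(3) [OF that] by auto
  have im: "path_image (\<gamma> i) \<subseteq> c i" if "i \<in> I" for i
    unfolding c_def using \<gamma> [OF that]
    by (intro connected_component_maximal) (auto intro: connected_valid_path_image)
  have "(\<Sum>i\<in>{i\<in>I. c i = C}. contour_integral (\<gamma> i) f) = 0" if C: "C \<in> c ` I" for C
  proof -
    define I' where "I' = {i\<in>I. c i = C}"
    obtain i0 where i0: "i0 \<in> I" "C = c i0" using C by blast
    let ?a = "pathstart (\<gamma> i0)"
    have C: "open C" "connected C" "?a \<in> C" "C \<subseteq> S"
      unfolding i0(2) c_def using S start [OF i0(1)]
      by (auto simp: open_connected_component connected_component_subset)
    have I': "finite I'" "\<And>i. i \<in> I' \<Longrightarrow> valid_path (\<gamma> i)" "\<And>i. i \<in> I' \<Longrightarrow> pathfinish (\<gamma> i) = pathstart (\<gamma> i)"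
      "\<And>i. i \<in> I' \<Longrightarrow> path_image (\<gamma> i) \<subseteq> C"
      using \<open>finite I\<close> \<gamma> im unfolding I'_def by force+
    define B where "B = \<Union> (components S - {C})"
    have Ccomp: "C \<in> components S" using i0 start by (auto simp: c_def components_def)
    have wn0: "(\<Sum>i\<in>I'. winding_number (\<gamma> i) w) = 0" if "w \<notin> C" for w
    proof (rule winding_number_sum_separated [of I' "I - I'" C B])
      show "open B" unfolding B_def using S by (auto simp: open_components)
      show "C \<inter> B = {}" unfolding B_def using Ccomp components_nonoverlap by fastforce
      show "path_image (\<gamma> i) \<subseteq> B" if "i \<in> I - I'" for i
      proof -
        have "c i \<in> components S - {C}" using that start by (auto simp: c_def components_def I'_def)
        then show ?thesis using im [of i] that by (auto simp: B_def)
      qed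
      fix w assume "w \<notin> C \<union> B"
      then have "w \<notin> S" unfolding B_def using Union_components [of S] by blast
      have "I' \<subseteq> I" by (auto simp: I'_def)
      then show "(\<Sum>i\<in>I'. winding_number (\<gamma> i) w) + (\<Sum>i\<in>I - I'. winding_number (\<gamma> i) w) = 0"
        using zero [OF \<open>w \<notin> S\<close>] \<open>finite I\<close> by (metis add.commute sum.subset_diff)
    qed (use that C I' \<gamma> \<open>finite I\<close> in \<open>auto simp: I'_def valid_path_imp_path\<close>)
    obtain \<delta> where \<delta>: "valid_path \<delta>" "pathstart \<delta> = ?a" "pathfinish \<delta> = ?a" "path_image \<delta> \<subseteq> C"
      and int: "\<And>f. f holomorphic_on C \<Longrightarrow> contour_integral \<delta> f = (\<Sum>i\<in>I'. contour_integral (\<gamma> i) f)"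
      using join_loops [where \<gamma> = \<gamma> and I = I', OF C(1-3) I'] by auto
    \<comment> \<open>A winding number is an integral of \<open>1 / (z - w)\<close>, which is
      holomorphic on \<open>C\<close>; hence the single loop inherits the total winding number of
      the cycle.\<close>
    have "winding_number \<delta> w = 0" if "w \<notin> C" for w
    proof -
      have "(\<lambda>z. 1 / (z - w)) holomorphic_on C" using that by (auto intro!: holomorphic_intros)
      moreover have "w \<notin> path_image \<delta>" using \<delta> that by blast
      moreover have "w \<notin> path_image (\<gamma> i)" if "i \<in> I'" for i using I'(4) [OF that] \<open>w \<notin> C\<close> by blast
      ultimately show ?thesis
        using int [of "\<lambda>z. 1 / (z - w)"] wn0 [OF that] \<delta> I'
        by (simp add: winding_number_valid_path flip: sum_divide_distrib)
    qed
    then have "(f has_contour_integral 0) \<delta>"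
      using C \<delta> f by (intro Cauchy_theorem_global [of C]) (auto intro: holomorphic_on_subset)
    then show ?thesis
      using int [of f] f C by (auto simp: I'_def holomorphic_on_subset dest: contour_integral_unique)
  qed
  then have "(\<Sum>C\<in>c ` I. \<Sum>i\<in>{i\<in>I. c i = C}. contour_integral (\<gamma> i) f) = 0" by simp
  then show ?thesis using sum.image_gen [OF \<open>finite I\<close>, of "\<lambda>i. contour_integral (\<gamma> i) f" c] by simp
qed

text \<open>Apply the cycle theorem to the difference quotient.\<close>

lemma Cauchy_integral_formula_cycle:
  fixes \<gamma> :: "'i \<Rightarrow> real \<Rightarrow> complex"
  assumes S: "open S" and f: "f holomorphic_on S" and "finite I"
    and \<gamma>: "\<And>i. i \<in> I \<Longrightarrow> valid_path (\<gamma> i)" "\<And>i. i \<in> I \<Longrightarrow> pathfinish (\<gamma> i) = pathstart (\<gamma> i)"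
      "\<And>i. i \<in> I \<Longrightarrow> path_image (\<gamma> i) \<subseteq> S - {z}"
    and zero: "\<And>w. w \<notin> S \<Longrightarrow> (\<Sum>i\<in>I. winding_number (\<gamma> i) w) = 0" and z: "z \<in> S"
  shows "(\<Sum>i\<in>I. contour_integral (\<gamma> i) (\<lambda>w. f w / (w - z))) =
    2 * pi * \<i> * (\<Sum>i\<in>I. winding_number (\<gamma> i) z) * f z"
proof -
  define q where "q w = (if w = z then deriv f z else (f w - f z) / (w - z))" for w
  have q: "q holomorphic_on S"
    unfolding q_def by (rule pole_lemma_open [OF f S])
  have "contour_integral (\<gamma> i) (\<lambda>w. f w / (w - z)) =
    contour_integral (\<gamma> i) q + f z * (2 * pi * \<i> * winding_number (\<gamma> i) z)" if "i \<in> I" for i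
  proof -
    note i = \<gamma> [OF that]
    have nz: "z \<notin> path_image (\<gamma> i)" using i by auto
    have "(q has_contour_integral contour_integral (\<gamma> i) q) (\<gamma> i)"
      using i by (intro has_contour_integral_integral contour_integrable_holomorphic_simple [OF q S]) auto
    moreover have "((\<lambda>w. f z * (1 / (w - z))) has_contour_integral f z * (2 * pi * \<i> * winding_number (\<gamma> i) z)) (\<gamma> i)"
      using has_contour_integral_winding_number [OF i(1) nz] by (rule has_contour_integral_lmul)
    ultimately have "((\<lambda>w. q w + f z * (1 / (w - z))) has_contour_integral
       contour_integral (\<gamma> i) q + f z * (2 * pi * \<i> * winding_number (\<gamma> i) z)) (\<gamma> i)"
      by (rule has_contour_integral_add)
    then have "((\<lambda>w. f w / (w - z)) has_contour_integral
       contour_integral (\<gamma> i) q + f z * (2 * pi * \<i> * winding_number (\<gamma> i) z)) (\<gamma> i)"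
      by (rule has_contour_integral_eq) (use nz in \<open>auto simp: q_def diff_divide_distrib\<close>)
    then show ?thesis by (rule contour_integral_unique)
  qed
  then have "(\<Sum>i\<in>I. contour_integral (\<gamma> i) (\<lambda>w. f w / (w - z))) =
     (\<Sum>i\<in>I. contour_integral (\<gamma> i) q) + f z * (2 * pi * \<i> * (\<Sum>i\<in>I. winding_number (\<gamma> i) z))"
    by (simp add: sum.distrib sum_distrib_left)
  moreover have "(\<Sum>i\<in>I. contour_integral (\<gamma> i) q) = 0"
    by (rule Cauchy_theorem_cycle [OF S q \<open>finite I\<close>]) (use \<gamma> zero in auto)
  ultimately show ?thesis by (simp add: mult.commute)
qed

section \<open>Integration along piecewise \<open>C\<^sup>1\<close> paths\<close>

text \<open>Adding a new largest point to the partition appends one gap, to which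
  \<open>combine\<close> is applied. The case of a single point is covered by
  \<open>point\<close>.\<close>

lemma partition_induct:
  fixes B :: "real set"
  assumes "finite B" "B \<noteq> {}"
    and gap: "\<And>a b. a \<in> B \<Longrightarrow> b \<in> B \<Longrightarrow> a < b \<Longrightarrow> B \<inter> {a<..<b} = {} \<Longrightarrow> P a b"
    and point: "\<And>a. P a a"
    and combine: "\<And>a c b. a \<le> c \<Longrightarrow> c \<le> b \<Longrightarrow> P a c \<Longrightarrow> P c b \<Longrightarrow> P a b"
  shows "P (Min B) (Max B)"
  using assms(1-3)
proof (induction B rule: finite_linorder_max_induct)
  case (insert b A)
  show ?case
  proof (cases "A = {}")
    case False
    have "P (Min A) (Max A)"
    proof (rule insert.IH [OF False])
      fix x y assume "x \<in> A" "y \<in> A" "x < y" "A \<inter> {x<..<y} = {}"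
      moreover have "b \<notin> {x<..<y}" using insert.hyps(2) \<open>y \<in> A\<close> by fastforce
      ultimately show "P x y" by (intro insert.prems(2)) auto
    qed
    moreover have "P (Max A) b"
      using False insert.hyps by (intro insert.prems(2)) (auto dest: Max_ge [OF insert.hyps(1)])
    moreover have "Min A \<le> Max A" "Max A < b" "Min A < b"
      using False insert.hyps by auto
    ultimately have "P (Min A) b" using combine [of "Min A" "Max A" b] by simp
    moreover have "Min (insert b A) = Min A" "Max (insert b A) = b"
      using False insert.hyps(1) \<open>Min A < b\<close> \<open>Max A < b\<close> by (simp_all add: Min_insert Max_insert min_absorb2 max_absorb1 del: Min_le_iff Max_ge_iff)
    ultimately show ?thesis by simp
  qed (simp add: point)
qed simp

text \<open>A piece keeps the continuity of \<open>\<gamma>'\<close> on the closed interval, the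
  source of bounds and integrability, but records derivatives only in its interior, where they are
  two-sided.\<close>

lemma piecewise_C1_induct:
  assumes \<gamma>: "piecewise_C1 \<gamma>"
    and piece: "\<And>a b \<gamma>'. \<lbrakk>0 \<le> a; a < b; b \<le> 1; continuous_on {a..b} \<gamma>';
      \<And>t. t \<in> {a<..<b} \<Longrightarrow> (\<gamma> has_vector_derivative \<gamma>' t) (at t)\<rbrakk> \<Longrightarrow> P a b"
    and point: "\<And>a. P a a"
    and combine: "\<And>a c b. a \<le> c \<Longrightarrow> c \<le> b \<Longrightarrow> P a c \<Longrightarrow> P c b \<Longrightarrow> P a b"
  shows "P (0::real) 1"
proof -
  obtain B where B: "finite B" "{0, 1} \<subseteq> B" "B \<subseteq> {0..1}"
    and gap: "\<forall>a\<in>B. \<forall>b\<in>B. a < b \<and> B \<inter> {a<..<b} = {} \<longrightarrow>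
      (\<exists>\<gamma>'. continuous_on {a..b} \<gamma>' \<and> (\<forall>t\<in>{a..b}. (\<gamma> has_vector_derivative \<gamma>' t) (at t within {a..b})))"
    using \<gamma> unfolding piecewise_C1_def by (elim conjE exE)
  have "P (Min B) (Max B)"
  proof (rule partition_induct)
    fix a b assume ab: "a \<in> B" "b \<in> B" "a < b" "B \<inter> {a<..<b} = {}"
    obtain \<gamma>' where \<gamma>': "continuous_on {a..b} \<gamma>'"
      "\<And>t. t \<in> {a..b} \<Longrightarrow> (\<gamma> has_vector_derivative \<gamma>' t) (at t within {a..b})"
      using gap ab by meson
    have "(\<gamma> has_vector_derivative \<gamma>' t) (at t)" if "t \<in> {a<..<b}" for t
      using \<gamma>'(2) [of t] that by (simp add: at_within_Icc_at)
    moreover have "0 \<le> a" "b \<le> 1" using ab B(3) by auto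
    ultimately show "P a b" using piece \<gamma>'(1) ab(3) by blast
  qed (use B point combine in auto)
  moreover have "Min B = 0" "Max B = 1"
    using B by (auto intro!: Min_eqI Max_eqI)
  ultimately show ?thesis by simp
qed

lemma piecewise_C1_imp_valid_path:
  assumes \<gamma>: "piecewise_C1 \<gamma>"
  shows "valid_path \<gamma>"
proof -
  have "\<exists>S. finite S \<and> \<gamma> C1_differentiable_on {0..1} - S"
  proof (rule piecewise_C1_induct [OF \<gamma>, where P = "\<lambda>a b. \<exists>S. finite S \<and> \<gamma> C1_differentiable_on {a..b} - S"])
    fix a b \<gamma>' assume *: "a < b" "continuous_on {a..b} \<gamma>'"
      "\<And>t. t \<in> {a<..<b} \<Longrightarrow> (\<gamma> has_vector_derivative \<gamma>' t) (at t)"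
    have "{a..b} - {a, b} = {a<..<b}" by auto
    then have "\<gamma> C1_differentiable_on {a..b} - {a, b}"
      unfolding C1_differentiable_on_def using * continuous_on_subset [of "{a..b}" \<gamma>' "{a<..<b}"]
      by (intro exI [of _ \<gamma>']) auto
    then show "\<exists>S. finite S \<and> \<gamma> C1_differentiable_on {a..b} - S" by (intro exI [of _ "{a, b}"]) simp
  next
    fix a c b assume "a \<le> c" "c \<le> b"
      and "\<exists>S. finite S \<and> \<gamma> C1_differentiable_on {a..c} - S" "\<exists>S. finite S \<and> \<gamma> C1_differentiable_on {c..b} - S"
    then obtain S S' where S: "finite S" "\<gamma> C1_differentiable_on {a..c} - S"
      "finite S'" "\<gamma> C1_differentiable_on {c..b} - S'" by blast
    \<comment> \<open>With \<open>a\<close>, \<open>c\<close> and \<open>b\<close> among the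
      exceptional points, the rest splits into two open sets, on which continuity of the derivative
      can be glued.\<close>
    define R where "R = insert a (insert b (insert c (S \<union> S')))"
    have S_cont: "continuous_on ({a..c} - S) (\<lambda>x. vector_derivative \<gamma> (at x))"
      "continuous_on ({c..b} - S') (\<lambda>x. vector_derivative \<gamma> (at x))"
      using S unfolding C1_differentiable_on_eq by blast+
    have cont: "continuous_on ({a<..<c} - R) (\<lambda>x. vector_derivative \<gamma> (at x))"
      by (rule continuous_on_subset [OF S_cont(1)]) (auto simp: R_def)
    have cont': "continuous_on ({c<..<b} - R) (\<lambda>x. vector_derivative \<gamma> (at x))"
      by (rule continuous_on_subset [OF S_cont(2)]) (auto simp: R_def)
    have "finite R" using S by (simp add: R_def)
    then have "closed R" by (rule finite_imp_closed)
    have "continuous_on (({a<..<c} - R) \<union> ({c<..<b} - R)) (\<lambda>x. vector_derivative \<gamma> (at x))"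
      by (rule continuous_on_open_Un) (use cont cont' \<open>closed R\<close> in auto)
    moreover have "{a..b} - R = ({a<..<c} - R) \<union> ({c<..<b} - R)"
      using \<open>a \<le> c\<close> \<open>c \<le> b\<close> by (auto simp: R_def)
    moreover have "\<gamma> differentiable at x" if "x \<in> {a..b} - R" for x
      using S that unfolding C1_differentiable_on_eq R_def by (cases "x \<le> c") auto
    ultimately have "\<gamma> C1_differentiable_on {a..b} - R"
      by (simp add: C1_differentiable_on_eq)
    then show "\<exists>S. finite S \<and> \<gamma> C1_differentiable_on {a..b} - S" using \<open>finite R\<close> by (intro exI [of _ R]) simp
  next
    show "\<exists>S. finite S \<and> \<gamma> C1_differentiable_on {a..a} - S" for a
      by (intro exI [of _ "{a}"]) (simp add: C1_differentiable_on_def)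
  qed
  moreover have "continuous_on {0..1} \<gamma>" using \<gamma> by (simp add: piecewise_C1_def)
  ultimately show ?thesis
    by (simp add: valid_path_def piecewise_C1_differentiable_on_def)
qed

text \<open>\<open>Cauchy_next_derivative\<close> asks for a bound on the derivative of the path,
  which a valid path need not have.\<close>

lemma piecewise_C1_bounded_derivative:
  assumes \<gamma>: "piecewise_C1 \<gamma>"
  obtains M where "\<And>t. t \<in> {0..1} \<Longrightarrow> norm (vector_derivative \<gamma> (at t)) \<le> M"
proof -
  have "\<exists>M. \<forall>t\<in>{0..1}. norm (vector_derivative \<gamma> (at t)) \<le> M"
  proof (rule piecewise_C1_induct [OF \<gamma>, where P = "\<lambda>a b. \<exists>M. \<forall>t\<in>{a..b}. norm (vector_derivative \<gamma> (at t)) \<le> M"])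
    fix a b \<gamma>' assume *: "a < b" "continuous_on {a..b} \<gamma>'"
      "\<And>t. t \<in> {a<..<b} \<Longrightarrow> (\<gamma> has_vector_derivative \<gamma>' t) (at t)"
    have "bounded (\<gamma>' ` {a..b})"
      using compact_continuous_image [OF *(2)] compact_imp_bounded by blast
    then obtain M where "\<And>t. t \<in> {a..b} \<Longrightarrow> norm (\<gamma>' t) \<le> M"
      unfolding bounded_iff by (metis imageI)
    moreover have "vector_derivative \<gamma> (at t) = \<gamma>' t" if "t \<in> {a<..<b}" for t
      using *(3) [OF that] by (rule vector_derivative_at)
    ultimately have "norm (vector_derivative \<gamma> (at t)) \<le> M" if "t \<in> {a<..<b}" for t
      using that by auto
    \<comment> \<open>At a break point \<open>vector_derivative\<close> may be an arbitrary value,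
      so the two end points enter the bound separately.\<close>
    then have "norm (vector_derivative \<gamma> (at t)) \<le>
        max M (max (norm (vector_derivative \<gamma> (at a))) (norm (vector_derivative \<gamma> (at b))))"
      if "t \<in> {a..b}" for t using that by (cases "t = a \<or> t = b") (auto simp: max.coboundedI1)
    then show "\<exists>M. \<forall>t\<in>{a..b}. norm (vector_derivative \<gamma> (at t)) \<le> M" by blast
  next
    fix a c b assume "\<exists>M. \<forall>t\<in>{a..c}. norm (vector_derivative \<gamma> (at t)) \<le> M"
      "\<exists>M. \<forall>t\<in>{c..b}. norm (vector_derivative \<gamma> (at t)) \<le> M"
    then obtain M M' where "\<forall>t\<in>{a..c}. norm (vector_derivative \<gamma> (at t)) \<le> M"
      "\<forall>t\<in>{c..b}. norm (vector_derivative \<gamma> (at t)) \<le> M'" by blast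
    then have "\<forall>t\<in>{a..b}. norm (vector_derivative \<gamma> (at t)) \<le> max M M'"
      by (metis atLeastAtMost_iff linear max.coboundedI1 max.coboundedI2)
    then show "\<exists>M. \<forall>t\<in>{a..b}. norm (vector_derivative \<gamma> (at t)) \<le> M" by blast
  qed auto
  then show thesis using that by blast
qed

text \<open>The bilinear map \<open>p\<close> is ordinary multiplication for complex contour
  integrals, and composition with the line element for operator-valued ones.\<close>

lemma piecewise_C1_integrable:
  fixes k :: "complex \<Rightarrow> 'b::real_normed_vector" and p :: "'b \<Rightarrow> complex \<Rightarrow> 'c::banach"
  assumes \<gamma>: "piecewise_C1 \<gamma>" and p: "bounded_bilinear p" and k: "continuous_on (path_image \<gamma>) k"
  shows "(\<lambda>t. p (k (\<gamma> t)) (vector_derivative \<gamma> (at t within {0..1}))) integrable_on {0..1}"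
proof (rule piecewise_C1_induct [OF \<gamma>,
    where P = "\<lambda>a b. (\<lambda>t. p (k (\<gamma> t)) (vector_derivative \<gamma> (at t within {0..1}))) integrable_on {a..b}"])
  fix a b \<gamma>' assume *: "0 \<le> a" "a < b" "b \<le> 1" "continuous_on {a..b} \<gamma>'"
    "\<And>t. t \<in> {a<..<b} \<Longrightarrow> (\<gamma> has_vector_derivative \<gamma>' t) (at t)"
  have "continuous_on {0..1} (\<lambda>t. k (\<gamma> t))"
    using \<gamma> k by (intro continuous_on_compose2 [OF k]) (auto simp: piecewise_C1_def path_image_def)
  then have "continuous_on {a..b} (\<lambda>t. k (\<gamma> t))"
    using * by (auto elim!: continuous_on_subset)
  then have "continuous_on {a..b} (\<lambda>t. p (k (\<gamma> t)) (\<gamma>' t))"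
    by (rule bounded_bilinear.continuous_on [OF p]) (rule *(4))
  then have "(\<lambda>t. p (k (\<gamma> t)) (\<gamma>' t)) integrable_on {a..b}"
    by (rule integrable_continuous_interval)
  then show "(\<lambda>t. p (k (\<gamma> t)) (vector_derivative \<gamma> (at t within {0..1}))) integrable_on {a..b}"
  proof (rule integrable_spike_finite [of "{a, b}", rotated 2])
    \<comment> \<open>Interior points of a piece are interior to the unit interval, so the
      derivative within it is the two-sided one.\<close>
    fix t assume t: "t \<in> {a..b} - {a, b}"
    then have "vector_derivative \<gamma> (at t within {0..1}) = vector_derivative \<gamma> (at t)"
      using * by (subst at_within_Icc_at) auto
    also have "\<dots> = \<gamma>' t" using t * by (intro vector_derivative_at) auto
    finally show "p (k (\<gamma> t)) (vector_derivative \<gamma> (at t within {0..1})) = p (k (\<gamma> t)) (\<gamma>' t)" by simp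
  qed simp
next
  show "(\<lambda>t. p (k (\<gamma> t)) (vector_derivative \<gamma> (at t within {0..1}))) integrable_on {a..a}" for a
    using integrable_on_refl [of _ a] by simp
next
  fix a c b :: real
  let ?h = "\<lambda>t. p (k (\<gamma> t)) (vector_derivative \<gamma> (at t within {0..1}))"
  assume "a \<le> c" "c \<le> b" "?h integrable_on {a..c}" "?h integrable_on {c..b}"
  then show "?h integrable_on {a..b}"
    by (rule Henstock_Kurzweil_Integration.integrable_combine)
qed

text \<open>Differentiation under the integral sign, the case of exponent 1 in
  \<open>Cauchy_next_derivative\<close>. It later supplies the analytic continuation across the
  spectrum.\<close>

lemma Cauchy_type_integral_holomorphic:
  assumes \<gamma>: "piecewise_C1 \<gamma>" and f: "continuous_on (path_image \<gamma>) f"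
  shows "(\<lambda>w. contour_integral \<gamma> (\<lambda>z. f z / (z - w))) holomorphic_on - path_image \<gamma>"
proof -
  have vp: "valid_path \<gamma>" by (rule piecewise_C1_imp_valid_path [OF \<gamma>])
  obtain M where M: "\<And>t. t \<in> {0..1} \<Longrightarrow> norm (vector_derivative \<gamma> (at t)) \<le> M"
    using piecewise_C1_bounded_derivative [OF \<gamma>] by blast
  have "((\<lambda>z. f z / (z - w) ^ 1) has_contour_integral contour_integral \<gamma> (\<lambda>z. f z / (z - w))) \<gamma>"
    if "w \<in> UNIV - path_image \<gamma>" for w
  proof -
    have "continuous_on (path_image \<gamma>) (\<lambda>z. f z / (z - w))"
      using f that by (intro continuous_intros) auto
    then have "(\<lambda>z. f z / (z - w)) contour_integrable_on \<gamma>"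
      using piecewise_C1_integrable [OF \<gamma> bounded_bilinear_mult, of "\<lambda>z. f z / (z - w)"]
      by (simp add: contour_integrable_on_def has_contour_integral_def integrable_on_def)
    then show ?thesis by (simp add: has_contour_integral_integral)
  qed
  from Cauchy_next_derivative(2) [OF f M this _ open_UNIV vp] show ?thesis
    by (auto simp: holomorphic_on_def field_differentiable_def intro: has_field_derivative_at_within)
qed

section \<open>Operators and slice integrals\<close>

lemma op_assoc: "(a \<odot> b) \<odot> c = a \<odot> (b \<odot> c)"
  by (rule blinfun_eqI) (simp add: blinfun_compose.rep_eq)

lemma op_id [simp]: "id_blinfun \<odot> a = a" "a \<odot> id_blinfun = a"
  by (rule blinfun_eqI, simp add: blinfun_compose.rep_eq)+

lemmas op_add_left = bounded_bilinear.add_left [OF bounded_bilinear_blinfun_compose]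
  and op_add_right = bounded_bilinear.add_right [OF bounded_bilinear_blinfun_compose]
  and op_diff_left = bounded_bilinear.diff_left [OF bounded_bilinear_blinfun_compose]
  and op_diff_right = bounded_bilinear.diff_right [OF bounded_bilinear_blinfun_compose]
  and op_minus_left = bounded_bilinear.minus_left [OF bounded_bilinear_blinfun_compose]
  and op_minus_right = bounded_bilinear.minus_right [OF bounded_bilinear_blinfun_compose]
  and op_scaleR_left = bounded_bilinear.scaleR_left [OF bounded_bilinear_blinfun_compose]
  and op_scaleR_right = bounded_bilinear.scaleR_right [OF bounded_bilinear_blinfun_compose]
  and op_sum_left = bounded_bilinear.sum_left [OF bounded_bilinear_blinfun_compose]
  and op_sum_right = bounded_bilinear.sum_right [OF bounded_bilinear_blinfun_compose]
  and bounded_linear_op_left = bounded_bilinear.bounded_linear_left [OF bounded_bilinear_blinfun_compose]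
  and bounded_linear_op_right = bounded_bilinear.bounded_linear_right [OF bounded_bilinear_blinfun_compose]
  and continuous_on_op = bounded_bilinear.continuous_on [OF bounded_bilinear_blinfun_compose]

lemmas op_distrib = op_add_left op_add_right op_diff_left op_diff_right op_minus_left op_minus_right
  op_scaleR_left op_scaleR_right

lemma lop_mult: "lop (p * q) = lop p \<odot> lop q"
  by (rule blinfun_eqI) (simp add: lop.rep_eq quat_bimodule del: split_paired_All)

lemma lop_add: "lop (p + q) = lop p + lop q"
  by (rule blinfun_eqI) (simp only: lop.rep_eq quat_bimodule plus_blinfun.rep_eq)

lemma lop_scaleR: "lop (r *\<^sub>R q) = r *\<^sub>R lop q"
  by (rule blinfun_eqI)
    (auto simp: lop.rep_eq scaleR_blinfun.rep_eq lmult_def scaleR_right_distrib scaleR_right_diff_distrib)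

lemma lop_one [simp]: "lop 1 = id_blinfun"
  by (rule blinfun_eqI) (simp only: lop.rep_eq quat_bimodule id_blinfun.rep_eq id_apply)

lemma lop_minus: "lop (- q) = - lop q"
  using lop_scaleR [of "-1" q] by simp

lemma lop_diff: "lop (p - q) = lop p - lop q"
  using lop_add [of p "- q"] by (simp add: lop_minus)

lemma bounded_linear_lop: "bounded_linear lop"
  unfolding linear_conv_bounded_linear [symmetric]
  by (rule linearI) (simp_all add: lop_add lop_scaleR)

lemma lop_inverse: "q \<noteq> 0 \<Longrightarrow> lop (inverse q) \<odot> lop q = id_blinfun" "q \<noteq> 0 \<Longrightarrow> lop q \<odot> lop (inverse q) = id_blinfun"
  by (simp_all flip: lop_mult)

definition op_commute :: "'a::real_normed_vector quat_op \<Rightarrow> 'a quat_op \<Rightarrow> bool" where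
  "op_commute a b \<longleftrightarrow> a \<odot> b = b \<odot> a"

lemma op_commute_simps [simp]:
  "op_commute a a" "op_commute 0 a" "op_commute a 0" "op_commute id_blinfun a" "op_commute a id_blinfun"
  by (simp_all add: op_commute_def)

lemma op_commute_sym: "op_commute a b \<Longrightarrow> op_commute b a"
  by (simp add: op_commute_def)

lemma op_commute_right:
  "op_commute a b \<Longrightarrow> op_commute a c \<Longrightarrow> op_commute a (b + c)"
  "op_commute a b \<Longrightarrow> op_commute a c \<Longrightarrow> op_commute a (b - c)"
  "op_commute a b \<Longrightarrow> op_commute a (r *\<^sub>R b)"
  "op_commute a b \<Longrightarrow> op_commute a (- b)"
  by (simp_all add: op_commute_def op_distrib)

lemma op_commute_compose: "op_commute a b \<Longrightarrow> op_commute a c \<Longrightarrow> op_commute a (b \<odot> c)"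
proof -
  assume "op_commute a b" "op_commute a c"
  then have ab: "a \<odot> b = b \<odot> a" and ac: "a \<odot> c = c \<odot> a" by (simp_all add: op_commute_def)
  have "a \<odot> (b \<odot> c) = (b \<odot> a) \<odot> c" by (simp only: ab flip: op_assoc)
  also have "\<dots> = (b \<odot> c) \<odot> a" by (simp only: ac op_assoc)
  finally show ?thesis by (simp add: op_commute_def)
qed

lemmas op_commute_intros = op_commute_right op_commute_compose

text \<open>Multiply the relation \<open>a \<odot> q = q' \<odot> a\<close> by \<open>r'\<close> on
  the left and \<open>r\<close> on the right. For \<open>q' = q\<close> this gives commutation with
  inverses; two different operators occur when \<open>a\<close> carries one slice to
  another.\<close>

lemma op_inverse_commute:
  assumes "q \<odot> r = id_blinfun" "r \<odot> q = id_blinfun" "a \<odot> q = q' \<odot> a" "q' \<odot> r' = id_blinfun" "r' \<odot> q' = id_blinfun"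
  shows "a \<odot> r = r' \<odot> a"
proof -
  have "a \<odot> r = r' \<odot> (q' \<odot> a) \<odot> r" using assms(5) by (simp flip: op_assoc)
  also have "\<dots> = r' \<odot> a" using assms(1) by (simp add: op_assoc flip: assms(3))
  finally show ?thesis .
qed

section \<open>Slices of the quaternions and complex-linear functionals\<close>

lemma slice_pt_eq: "slice_pt J z = Re z *\<^sub>R 1 + Im z *\<^sub>R J"
  by (simp add: slice_pt_def of_real_def)

lemma slice_pt_add: "slice_pt J (w + z) = slice_pt J w + slice_pt J z"
  and slice_pt_diff: "slice_pt J (w - z) = slice_pt J w - slice_pt J z"
  and slice_pt_one [simp]: "slice_pt J 1 = 1"
  and slice_pt_ii [simp]: "slice_pt J \<i> = J"
  and slice_pt_cnj: "slice_pt J (cnj z) = slice_pt (- J) z"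
  by (simp_all add: slice_pt_eq algebra_simps of_real_def)

lemma slice_pt_mult: "J \<in> \<S> \<Longrightarrow> slice_pt J (w * z) = slice_pt J w * slice_pt J z"
  by (simp add: slice_pt_eq imag_units_def algebra_simps)

lemma bounded_linear_slice_pt: "bounded_linear (slice_pt J)"
  unfolding linear_conv_bounded_linear [symmetric]
  by (rule linearI) (simp_all add: slice_pt_eq algebra_simps)

definition scal :: "quat \<Rightarrow> complex \<Rightarrow> 'a::real_normed_vector quat_op" where
  "scal J z = lop (slice_pt J z)"

lemma scal_add: "scal J (w + z) = scal J w + scal J z"
  and scal_diff: "scal J (w - z) = scal J w - scal J z"
  and scal_one [simp]: "scal J 1 = id_blinfun"
  and scal_ii [simp]: "scal J \<i> = lop J"
  by (simp_all add: scal_def slice_pt_add slice_pt_diff lop_add lop_diff)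

lemma scal_mult: "J \<in> \<S> \<Longrightarrow> scal J (w * z) = scal J w \<odot> scal J z"
  by (simp add: scal_def slice_pt_mult lop_mult)

lemma scal_eq: "scal J z = Re z *\<^sub>R id_blinfun + Im z *\<^sub>R lop J"
  by (simp add: scal_def slice_pt_eq lop_add lop_scaleR)

lemma bounded_linear_scal: "bounded_linear (scal J)"
  unfolding scal_def by (rule bounded_linear_compose [OF bounded_linear_lop bounded_linear_slice_pt])

lemma scal_commute: "J \<in> \<S> \<Longrightarrow> op_commute (scal J w) (scal J z)"
  by (simp add: op_commute_def mult.commute flip: scal_mult)

lemma op_commute_scal: "op_commute a (lop J) \<Longrightarrow> op_commute a (scal J z)"
  unfolding scal_eq by (intro op_commute_intros) auto

lemma imag_units_minus [simp]: "- J \<in> \<S> \<longleftrightarrow> J \<in> \<S>"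
  by (simp add: imag_units_def)

text \<open>The complex structure on \<open>\<B>(X)\<close> is right multiplication by \<open>J\<close>.\<close>

definition slice_functional :: "quat \<Rightarrow> ('a::real_normed_vector quat_op \<Rightarrow> complex) \<Rightarrow> bool" where
  "slice_functional J L \<longleftrightarrow> bounded_linear L \<and> (\<forall>S w. L (S \<odot> scal J w) = w * L S)"

text \<open>A real functional \<open>l\<close> becomes complex linear as
  \<open>l A - \<i> * l (A \<odot> lop J)\<close>, because \<open>J\<close> squares to -1; its real
  part is still \<open>l\<close>, so nothing is lost in separating points.\<close>

lemma slice_functional_separates:
  fixes S S' :: "'a::real_normed_vector quat_op"
  assumes J: "J \<in> \<S>" and eq: "\<And>L. slice_functional J L \<Longrightarrow> L S = L S'"
  shows "S = S'"
proof (rule ccontr)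
  assume "S \<noteq> S'"
  then obtain l :: "'a quat_op \<Rightarrow> real" where l: "bounded_linear l" "l (S - S') \<noteq> 0"
    using functional_nonzero [of "S - S'"] by auto
  interpret l: bounded_linear l by fact
  define L where "L A = complex_of_real (l A) - \<i> * complex_of_real (l (A \<odot> lop J))" for A
  have JJ: "lop J \<odot> lop J = - (id_blinfun :: 'a quat_op)"
    using J by (simp add: imag_units_def lop_minus flip: lop_mult)
  have "bounded_linear (\<lambda>A :: 'a quat_op. A \<odot> lop J)"
    by (rule bounded_linear_op_left)
  then have "bounded_linear L"
    unfolding L_def
    by (intro bounded_linear_sub bounded_linear_const_mult bounded_linear_compose [OF bounded_linear_of_real]
        l.bounded_linear_axioms bounded_linear_compose [OF l(1)])
  moreover have "L (A \<odot> scal J w) = w * L A" for A w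
    unfolding L_def scal_eq
    by (simp add: op_distrib op_assoc JJ l.add l.scaleR l.diff linear_neg [OF l.linear_axioms] complex_eq_iff)
  ultimately have "slice_functional J L" by (simp add: slice_functional_def)
  then have "L (S - S') = 0"
    using eq [of L] by (simp add: slice_functional_def linear_diff bounded_linear.linear)
  then have "Re (L (S - S')) = 0" by simp
  then show False using l(2) by (simp add: L_def)
qed

section \<open>Integrals of operator-valued functions along curves\<close>

definition line_element :: "quat \<Rightarrow> (real \<Rightarrow> complex) \<Rightarrow> real \<Rightarrow> 'a::real_normed_vector quat_op" where
  "line_element J \<gamma> t = lop (slice_pt J (vector_derivative \<gamma> (at t within {0..1})) * (- J))"

text \<open>\<open>calculus\<close> with the function absorbed into the kernel, in front of the line
  element. This loses nothing when the function takes values in the slice of \<open>J\<close>, since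
  these commute with the line element.\<close>

definition path_int :: "quat \<Rightarrow> (real \<Rightarrow> complex) set \<Rightarrow> (complex \<Rightarrow> 'a::banach quat_op) \<Rightarrow> 'a quat_op" where
  "path_int J \<Gamma> k = (1 / (2 * pi)) *\<^sub>R (\<Sum>\<gamma>\<in>\<Gamma>. integral {0..1} (\<lambda>t.
     k (\<gamma> t) \<odot> line_element J \<gamma> t))"

lemma line_element_eq:
  assumes "J \<in> \<S>"
  shows "line_element J \<gamma> t = scal J (vector_derivative \<gamma> (at t within {0..1}) * (- \<i>))"
proof -
  have "slice_pt J (- \<i>) = - J" by (simp add: slice_pt_eq)
  then show ?thesis using assms unfolding line_element_def scal_def by (simp only: slice_pt_mult)
qed

definition continuous_on_paths :: "(real \<Rightarrow> complex) set \<Rightarrow> (complex \<Rightarrow> 'b::topological_space) \<Rightarrow> bool" where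
  "continuous_on_paths \<Gamma> k \<longleftrightarrow> (\<forall>\<gamma>\<in>\<Gamma>. continuous_on (path_image \<gamma>) k)"

lemma path_int_integrable:
  fixes k :: "complex \<Rightarrow> 'a::banach quat_op"
  assumes "piecewise_C1 \<gamma>" "continuous_on (path_image \<gamma>) k"
  shows "(\<lambda>t. k (\<gamma> t) \<odot> line_element J \<gamma> t) integrable_on {0..1}"
proof -
  have "bounded_linear (\<lambda>z. lop (slice_pt J z * (- J)))"
    by (intro bounded_linear_compose [OF bounded_linear_lop] bounded_linear_compose [OF bounded_linear_mult_left]
        bounded_linear_slice_pt)
  then have "bounded_bilinear (\<lambda>(a :: 'a quat_op) z. a \<odot> lop (slice_pt J z * (- J)))"
    by (rule bounded_bilinear.comp [OF bounded_bilinear_blinfun_compose bounded_linear_ident])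
  from piecewise_C1_integrable [OF assms(1) this assms(2)] show ?thesis
    by (simp add: line_element_def)
qed

text \<open>The line element is right multiplication by a number of the slice, which
  \<open>L\<close> turns into the complex factor \<open>- \<i>\<close> times the derivative of the
  path.\<close>

lemma slice_functional_integral:
  fixes k :: "complex \<Rightarrow> 'a::banach quat_op"
  assumes L: "slice_functional J L" and J: "J \<in> \<S>"
    and \<gamma>: "piecewise_C1 \<gamma>" and k: "continuous_on (path_image \<gamma>) k"
  shows "L (integral {0..1} (\<lambda>t. k (\<gamma> t) \<odot> line_element J \<gamma> t)) =
    - \<i> * contour_integral \<gamma> (\<lambda>z. L (k z))"
proof -
  have bl: "bounded_linear L" and sc: "\<And>S w. L (S \<odot> scal J w) = w * L S"
    using L by (auto simp: slice_functional_def)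
  have "L (integral {0..1} (\<lambda>t. k (\<gamma> t) \<odot> line_element J \<gamma> t)) =
    integral {0..1} (\<lambda>t. L (k (\<gamma> t) \<odot> line_element J \<gamma> t))"
    using integral_linear [OF path_int_integrable [OF \<gamma> k] bl] by (simp add: o_def)
  also have "\<dots> = integral {0..1} (\<lambda>t. (- \<i>) * (L (k (\<gamma> t)) * vector_derivative \<gamma> (at t within {0..1})))"
    using J by (simp add: line_element_eq sc mult_ac)
  also have "\<dots> = - \<i> * integral {0..1} (\<lambda>t. L (k (\<gamma> t)) * vector_derivative \<gamma> (at t within {0..1}))"
    by (rule integral_mult_right)
  also have "integral {0..1} (\<lambda>t. L (k (\<gamma> t)) * vector_derivative \<gamma> (at t within {0..1})) = contour_integral \<gamma> (\<lambda>z. L (k z))"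
    by (simp add: contour_integral_def has_contour_integral_def integral_def contour_integrable_on_def integrable_on_def)
  finally show ?thesis .
qed

lemma slice_functional_path_int:
  fixes k :: "complex \<Rightarrow> 'a::banach quat_op"
  assumes L: "slice_functional J L" and J: "J \<in> \<S>"
    and \<Gamma>: "finite \<Gamma>" "\<And>\<gamma>. \<gamma> \<in> \<Gamma> \<Longrightarrow> piecewise_C1 \<gamma>" "continuous_on_paths \<Gamma> k"
  shows "L (path_int J \<Gamma> k) = - \<i> / (2 * pi) * (\<Sum>\<gamma>\<in>\<Gamma>. contour_integral \<gamma> (\<lambda>z. L (k z)))"
proof -
  have "linear L" using L by (simp add: slice_functional_def bounded_linear.linear)
  then have "L (path_int J \<Gamma> k) = (1 / (2 * pi)) *\<^sub>R (\<Sum>\<gamma>\<in>\<Gamma>. - \<i> * contour_integral \<gamma> (\<lambda>z. L (k z)))"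
    unfolding path_int_def linear_scale [OF \<open>linear L\<close>] linear_sum [OF \<open>linear L\<close>]
    using \<Gamma> by (simp add: slice_functional_integral [OF L J] continuous_on_paths_def)
  also have "(\<Sum>\<gamma>\<in>\<Gamma>. - \<i> * contour_integral \<gamma> (\<lambda>z. L (k z))) = - \<i> * (\<Sum>\<gamma>\<in>\<Gamma>. contour_integral \<gamma> (\<lambda>z. L (k z)))"
    by (rule sum_distrib_left [symmetric])
  finally show ?thesis by (simp add: scaleR_conv_of_real)
qed

text \<open>A left factor leaves the integral freely. A right factor has to pass the line element,
  hence the condition that it commute with \<open>J\<close>.\<close>

lemma
  fixes k :: "complex \<Rightarrow> 'a::banach quat_op"
  assumes \<Gamma>: "\<And>\<gamma>. \<gamma> \<in> \<Gamma> \<Longrightarrow> piecewise_C1 \<gamma>" "continuous_on_paths \<Gamma> k"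
  shows path_int_add: "continuous_on_paths \<Gamma> k' \<Longrightarrow> path_int J \<Gamma> (\<lambda>z. k z + k' z) = path_int J \<Gamma> k + path_int J \<Gamma> k'"
    and path_int_left: "path_int J \<Gamma> (\<lambda>z. a \<odot> k z) = a \<odot> path_int J \<Gamma> k"
    and path_int_right: "op_commute a (lop J) \<Longrightarrow> path_int J \<Gamma> (\<lambda>z. k z \<odot> a) = path_int J \<Gamma> k \<odot> a"
proof -
  note int = path_int_integrable [OF \<Gamma>(1)]
  have k: "continuous_on (path_image \<gamma>) k" if "\<gamma> \<in> \<Gamma>" for \<gamma> using \<Gamma>(2) that by (simp add: continuous_on_paths_def)
  show "path_int J \<Gamma> (\<lambda>z. k z + k' z) = path_int J \<Gamma> k + path_int J \<Gamma> k'" if "continuous_on_paths \<Gamma> k'"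
  proof -
    have k': "continuous_on (path_image \<gamma>) k'" if "\<gamma> \<in> \<Gamma>" for \<gamma>
      using \<open>continuous_on_paths \<Gamma> k'\<close> that by (simp add: continuous_on_paths_def)
    show ?thesis
      unfolding path_int_def 
      by (simp add: op_distrib Henstock_Kurzweil_Integration.integral_add int k k' sum.distrib scaleR_right_distrib)
  qed
  show "path_int J \<Gamma> (\<lambda>z. a \<odot> k z) = a \<odot> path_int J \<Gamma> k"
  proof -
    have bl: "bounded_linear (\<lambda>b. a \<odot> b)"
      by (rule bounded_linear_op_right)
    have "integral {0..1} (\<lambda>t. (a \<odot> k (\<gamma> t)) \<odot> line_element J \<gamma> t)
      = a \<odot> integral {0..1} (\<lambda>t. k (\<gamma> t) \<odot> line_element J \<gamma> t)"
      if "\<gamma> \<in> \<Gamma>" for \<gamma>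
      using integral_linear [OF int bl] k that by (simp add: o_def op_assoc cong: integral_cong)
    then show ?thesis
      unfolding path_int_def
      by (simp add: linear_sum [OF bounded_linear.linear [OF bl]] op_scaleR_right)
  qed
  show "path_int J \<Gamma> (\<lambda>z. k z \<odot> a) = path_int J \<Gamma> k \<odot> a" if a: "op_commute a (lop J)"
  proof -
    have bl: "bounded_linear (\<lambda>b. b \<odot> a)"
      by (rule bounded_linear_op_left)
    have "op_commute a (line_element J \<gamma> t)" for \<gamma> t
      unfolding line_element_def lop_mult lop_minus scal_def [symmetric]
      by (intro op_commute_intros op_commute_scal a)
    then have ac: "a \<odot> line_element J \<gamma> t = line_element J \<gamma> t \<odot> a" for \<gamma> t
      by (simp add: op_commute_def)
    have "integral {0..1} (\<lambda>t. (k (\<gamma> t) \<odot> a) \<odot> line_element J \<gamma> t)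
      = integral {0..1} (\<lambda>t. k (\<gamma> t) \<odot> line_element J \<gamma> t) \<odot> a"
      if "\<gamma> \<in> \<Gamma>" for \<gamma>
      using integral_linear [OF int bl] k that by (simp add: o_def op_assoc ac)
    then show ?thesis
      unfolding path_int_def
      by (simp add: linear_sum [OF bounded_linear.linear [OF bl]] op_scaleR_left)
  qed
qed

section \<open>Operator-valued holomorphic functions\<close>

text \<open>Caratheodory's form of differentiability, with right multiplication by \<open>J\<close>
  as complex structure; products and inverses become algebra. Commutation with \<open>J\<close> is
  what keeps products holomorphic: the increment \<open>scal J (x - z)\<close> coming from the left
  factor must move past the right one.\<close>

definition op_holo :: "quat \<Rightarrow> complex set \<Rightarrow> (complex \<Rightarrow> 'a::real_normed_vector quat_op) \<Rightarrow> bool" where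
  "op_holo J S k \<longleftrightarrow> (\<forall>z\<in>S. op_commute (k z) (lop J)) \<and>
     (\<forall>z\<in>S. \<exists>g. isCont g z \<and> (\<forall>x\<in>S. k x = k z + g x \<odot> scal J (x - z)))"

lemma op_holo_commute: "op_holo J S k \<Longrightarrow> z \<in> S \<Longrightarrow> op_commute (k z) (lop J)"
  by (simp add: op_holo_def)

lemma op_holo_quotient:
  assumes "op_holo J S k" "z \<in> S"
  obtains g where "isCont g z" "\<And>x. x \<in> S \<Longrightarrow> k x = k z + g x \<odot> scal J (x - z)"
  using assms unfolding op_holo_def by blast

lemma isCont_scal [continuous_intros]: "isCont f z \<Longrightarrow> isCont (\<lambda>x. scal J (f x)) z"
  by (rule bounded_linear.isCont [OF bounded_linear_scal])

lemma isCont_op_compose [continuous_intros]: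
  "isCont f z \<Longrightarrow> isCont g z \<Longrightarrow> isCont (\<lambda>x. f x \<odot> g x) z"
  by (rule bounded_bilinear.isCont [OF bounded_bilinear_blinfun_compose])

lemma isCont_on_open:
  "open S \<Longrightarrow> z \<in> S \<Longrightarrow> (\<And>x. x \<in> S \<Longrightarrow> f x = g x) \<Longrightarrow> isCont g z \<Longrightarrow> isCont f z"
  by (subst isCont_cong [of f g]) (auto elim!: eventually_mono dest: eventually_nhds_in_open)

lemma op_holo_isCont:
  assumes "op_holo J S k" "open S" "z \<in> S"
  shows "isCont k z"
proof -
  obtain g where g: "isCont g z" "\<And>x. x \<in> S \<Longrightarrow> k x = k z + g x \<odot> scal J (x - z)"
    using op_holo_quotient [OF assms(1,3)] by blast
  show ?thesis
  proof (rule isCont_on_open [OF assms(2,3)])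
    show "isCont (\<lambda>x. k z + g x \<odot> scal J (x - z)) z"
      by (intro continuous_intros g(1))
  qed (rule g(2))
qed

lemma op_holo_continuous_on: "op_holo J S k \<Longrightarrow> open S \<Longrightarrow> continuous_on S k"
  by (simp add: continuous_at_imp_continuous_on op_holo_isCont)

lemma op_holo_slice_functional:
  assumes k: "op_holo J S k" and S: "open S" and L: "slice_functional J L"
  shows "(\<lambda>z. L (k z)) holomorphic_on S"
proof (rule holomorphic_onI)
  fix z assume z: "z \<in> S"
  obtain g where g: "isCont g z" "\<And>x. x \<in> S \<Longrightarrow> k x = k z + g x \<odot> scal J (x - z)"
    using op_holo_quotient [OF k z] by blast
  have L: "bounded_linear L" "\<And>A w. L (A \<odot> scal J w) = w * L A"
    using L by (auto simp: slice_functional_def)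
  \<comment> \<open>\<open>CARAT_DERIV\<close> needs a factorisation on the whole plane, whereas
    \<open>g\<close> factors \<open>k\<close> only on \<open>S\<close>. The difference quotient is
    defined everywhere and agrees with \<open>L (g x)\<close> on \<open>S\<close>.\<close>
  define G where "G x = (if x = z then L (g z) else (L (k x) - L (k z)) / (x - z))" for x
  have eq: "L (k x) - L (k z) = G x * (x - z)" for x by (simp add: G_def)
  have "isCont G z"
  proof (rule isCont_on_open [OF S z])
    show "G x = L (g x)" if "x \<in> S" for x
      using g(2) [OF that] by (simp add: G_def L(2) linear_add [OF bounded_linear.linear [OF L(1)]])
    show "isCont (\<lambda>x. L (g x)) z" by (rule bounded_linear.isCont [OF L(1) g(1)])
  qed
  then have "((\<lambda>z. L (k z)) has_field_derivative G z) (at z)"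
    using eq unfolding CARAT_DERIV by blast
  then show "(\<lambda>z. L (k z)) field_differentiable at z within S"
    using field_differentiable_at_within field_differentiable_def by blast
qed

lemma op_holo_subset: "op_holo J S k \<Longrightarrow> S' \<subseteq> S \<Longrightarrow> op_holo J S' k"
  unfolding op_holo_def by (meson subset_iff)

lemma op_holo_cong: "(\<And>z. z \<in> S \<Longrightarrow> k z = k' z) \<Longrightarrow> op_holo J S k = op_holo J S k'"
  unfolding op_holo_def by (simp cong: ball_cong)

lemma op_holo_const: "op_commute a (lop J) \<Longrightarrow> op_holo J S (\<lambda>z. a)"
  unfolding op_holo_def by (auto intro: exI [of _ "\<lambda>_. 0"])

lemma op_holo_scal:
  assumes J: "J \<in> \<S>" and S: "open S" and F: "F holomorphic_on S"
  shows "op_holo J S (\<lambda>z. scal J (F z))"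
  unfolding op_holo_def
proof (intro conjI ballI)
  fix z assume z: "z \<in> S"
  show "op_commute (scal J (F z)) (lop J)" using scal_commute [OF J, of "F z" \<i>] by simp
  obtain D where "(F has_field_derivative D) (at z)"
    using F S z by (metis at_within_open field_differentiable_def holomorphic_on_def)
  then obtain g where g: "\<And>x. F x - F z = g x * (x - z)" "isCont g z"
    unfolding CARAT_DERIV by blast
  have "scal J (F x) = scal J (F z) + scal J (g x) \<odot> scal J (x - z)" for x
  proof -
    have "F x = F z + g x * (x - z)" using g(1) [of x] by (simp add: algebra_simps)
    then show ?thesis by (simp only: scal_add scal_mult [OF J])
  qed
  then show "\<exists>g. isCont g z \<and> (\<forall>x\<in>S. scal J (F x) = scal J (F z) + g x \<odot> scal J (x - z))"
    using g(2) by (intro exI [of _ "\<lambda>x. scal J (g x)"]) (auto intro: isCont_scal)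
qed

lemma op_holo_add:
  assumes k: "op_holo J S k" and k': "op_holo J S k'"
  shows "op_holo J S (\<lambda>z. k z + k' z)"
  unfolding op_holo_def
proof (intro conjI ballI)
  fix z assume z: "z \<in> S"
  show "op_commute (k z + k' z) (lop J)"
    using assms z by (auto intro!: op_commute_sym [OF op_commute_right(1)] dest: op_holo_commute op_commute_sym)
  obtain g where g: "isCont g z" "\<And>x. x \<in> S \<Longrightarrow> k x = k z + g x \<odot> scal J (x - z)"
    using op_holo_quotient [OF k z] by blast
  obtain g' where g': "isCont g' z" "\<And>x. x \<in> S \<Longrightarrow> k' x = k' z + g' x \<odot> scal J (x - z)"
    using op_holo_quotient [OF k' z] by blast
  have "k x + k' x = k z + k' z + (g x + g' x) \<odot> scal J (x - z)" if "x \<in> S" for x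
    unfolding op_distrib g(2) [OF that] g'(2) [OF that] by simp
  then show "\<exists>h. isCont h z \<and> (\<forall>x\<in>S. k x + k' x = k z + k' z + h x \<odot> scal J (x - z))"
    using g(1) g'(1) by (intro exI [of _ "\<lambda>x. g x + g' x"]) auto
qed

lemma op_holo_compose:
  assumes J: "J \<in> \<S>" and S: "open S" and k: "op_holo J S k" and k': "op_holo J S k'"
  shows "op_holo J S (\<lambda>z. k z \<odot> k' z)"
  unfolding op_holo_def
proof (intro conjI ballI)
  fix z assume z: "z \<in> S"
  show "op_commute (k z \<odot> k' z) (lop J)"
    using assms z by (auto intro!: op_commute_sym [OF op_commute_compose] dest: op_holo_commute op_commute_sym)
  obtain g where g: "isCont g z" "\<And>x. x \<in> S \<Longrightarrow> k x = k z + g x \<odot> scal J (x - z)"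
    using op_holo_quotient [OF k z] by blast
  obtain g' where g': "isCont g' z" "\<And>x. x \<in> S \<Longrightarrow> k' x = k' z + g' x \<odot> scal J (x - z)"
    using op_holo_quotient [OF k' z] by blast
  have c: "scal J w \<odot> k' z = k' z \<odot> scal J w" for w
    using op_commute_scal [OF op_holo_commute [OF k' z]] by (simp add: op_commute_def)
  have "k x \<odot> k' x = k z \<odot> k' z + (k x \<odot> g' x + g x \<odot> k' z) \<odot> scal J (x - z)" if "x \<in> S" for x
  proof -
    have "k x \<odot> k' x = k x \<odot> k' z + k x \<odot> g' x \<odot> scal J (x - z)"
      by (subst g'(2) [OF that]) (simp add: op_distrib op_assoc)
    also have "k x \<odot> k' z = k z \<odot> k' z + g x \<odot> k' z \<odot> scal J (x - z)"
      by (subst g(2) [OF that]) (simp add: op_distrib op_assoc c)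
    finally show ?thesis by (simp add: op_distrib)
  qed
  moreover have "isCont (\<lambda>x. k x \<odot> g' x + g x \<odot> k' z) z"
    by (intro continuous_intros g(1) g'(1) op_holo_isCont [OF k S z])
  ultimately show "\<exists>h. isCont h z \<and> (\<forall>x\<in>S. k x \<odot> k' x = k z \<odot> k' z + h x \<odot> scal J (x - z))"
    by blast
qed

text \<open>Everything follows from the resolvent identity
  \<open>r x - r z = r x \<odot> (q z - q x) \<odot> r z\<close>: first continuity of
  \<open>r\<close>, then the Caratheodory quotient
  \<open>- (r x \<odot> g x \<odot> r z)\<close>.\<close>

lemma op_holo_inverse:
  assumes J: "J \<in> \<S>" and S: "open S" and q: "op_holo J S q"
    and qr: "\<And>z. z \<in> S \<Longrightarrow> q z \<odot> r z = id_blinfun" "\<And>z. z \<in> S \<Longrightarrow> r z \<odot> q z = id_blinfun"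
  shows "op_holo J S r"
  unfolding op_holo_def
proof (intro conjI ballI)
  fix z assume z: "z \<in> S"
  have comm: "op_commute (r z) (lop J)"
    using op_inverse_commute [OF qr(1) [OF z] qr(2) [OF z] _ qr(1) [OF z] qr(2) [OF z], of "lop J"]
      op_holo_commute [OF q z] by (simp add: op_commute_def)
  then show "op_commute (r z) (lop J)" .
  have c: "scal J w \<odot> r z = r z \<odot> scal J w" for w
    using op_commute_scal [OF comm] by (simp add: op_commute_def)
  have diff: "r x - r z = r x \<odot> (q z - q x) \<odot> r z" if "x \<in> S" for x
    using qr(1) [OF z] qr(2) [OF that] by (simp add: op_distrib op_assoc)
  have cont_q: "isCont q z" by (rule op_holo_isCont [OF q S z])
  text \<open>Near \<open>z\<close> the factor \<open>r x\<close> is at most twice as large as \<open>r z\<close>.\<close>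
  have "isCont r z"
  proof -
    have "((\<lambda>x. norm (q z - q x) * norm (r z)) \<longlongrightarrow> norm (q z - q z) * norm (r z)) (at z)"
      using cont_q by (intro tendsto_intros) (simp add: isCont_def)
    then have small: "\<forall>\<^sub>F x in at z. norm (q z - q x) * norm (r z) < 1 / 2"
      by (rule order_tendstoD) simp
    have "\<forall>\<^sub>F x in at z. x \<in> S" using S z by (rule eventually_at_in_open')
    with small have "\<forall>\<^sub>F x in at z. norm (r x - r z) \<le> 2 * norm (r z) * (norm (q z - q x) * norm (r z))"
    proof eventually_elim
      case (elim x)
      have le: "norm (r x - r z) \<le> norm (r x) * (norm (q z - q x) * norm (r z))"
        unfolding diff [OF elim(2)] op_assoc
        by (meson norm_blinfun_compose order_trans mult_left_mono norm_ge_zero)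
      also have "\<dots> \<le> norm (r x) * (1 / 2)"
        using elim by (intro mult_left_mono) auto
      finally have "norm (r x) \<le> 2 * norm (r z)"
        using norm_triangle_sub [of "r x" "r z"] by simp
      then show ?case using le by (meson mult_right_mono order_trans mult_nonneg_nonneg norm_ge_zero)
    qed
    moreover have "((\<lambda>x. 2 * norm (r z) * (norm (q z - q x) * norm (r z))) \<longlongrightarrow>
        2 * norm (r z) * (norm (q z - q z) * norm (r z))) (at z)"
      using cont_q by (intro tendsto_intros) (simp add: isCont_def)
    ultimately have "((\<lambda>x. r x - r z) \<longlongrightarrow> 0) (at z)"
      by (intro Lim_null_comparison [of "\<lambda>x. r x - r z"]) simp_all
    then show ?thesis by (simp add: isCont_def LIM_zero_iff)
  qed
  obtain g where g: "isCont g z" "\<And>x. x \<in> S \<Longrightarrow> q x = q z + g x \<odot> scal J (x - z)"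
    using op_holo_quotient [OF q z] by blast
  have "r x = r z + (- (r x \<odot> g x \<odot> r z)) \<odot> scal J (x - z)" if "x \<in> S" for x
  proof -
    have "r x - r z = r x \<odot> (- (g x \<odot> scal J (x - z))) \<odot> r z"
      using diff [OF that] g(2) [OF that] by simp
    also have "\<dots> = (- (r x \<odot> g x \<odot> r z)) \<odot> scal J (x - z)"
      by (simp add: op_distrib op_assoc c)
    finally show ?thesis by (simp add: algebra_simps)
  qed
  moreover have "isCont (\<lambda>x. - (r x \<odot> g x \<odot> r z)) z"
    by (intro continuous_intros \<open>isCont r z\<close> g(1))
  ultimately show "\<exists>h. isCont h z \<and> (\<forall>x\<in>S. r x = r z + h x \<odot> scal J (x - z))"
    by blast
qed

text \<open>A Neumann series argument in the guise of Banach's fixed point theorem: \<open>S = 1 + K S\<close>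
  and \<open>S = 1 + S K\<close> are solvable for small \<open>K\<close>.\<close>

lemma op_invertible_near_id:
  fixes K :: "'a::banach quat_op"
  assumes "norm K < 1"
  obtains S where "(id_blinfun - K) \<odot> S = id_blinfun" "S \<odot> (id_blinfun - K) = id_blinfun"
proof -
  have "\<exists>!S. id_blinfun + K \<odot> S = S"
  proof (rule banach_fix_type [of "norm K"])
    show "\<forall>x y. dist (id_blinfun + K \<odot> x) (id_blinfun + K \<odot> y) \<le> norm K * dist x y"
      by (simp add: dist_norm norm_blinfun_compose flip: op_distrib)
  qed (use assms in auto)
  then obtain S where S: "id_blinfun + K \<odot> S = S" by blast
  have "\<exists>!S. id_blinfun + S \<odot> K = S"
  proof (rule banach_fix_type [of "norm K"])
    show "\<forall>x y. dist (id_blinfun + x \<odot> K) (id_blinfun + y \<odot> K) \<le> norm K * dist x y"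
      by (simp add: dist_norm norm_blinfun_compose mult.commute [of "norm K"] flip: op_distrib)
  qed (use assms in auto)
  then obtain S' where S': "id_blinfun + S' \<odot> K = S'" by blast
  have 1: "(id_blinfun - K) \<odot> S = id_blinfun"
    using S by (simp add: op_distrib algebra_simps)
  have 2: "S' \<odot> (id_blinfun - K) = id_blinfun"
    using S' by (simp add: op_distrib algebra_simps)
  have "S' = S' \<odot> ((id_blinfun - K) \<odot> S)" using 1 by simp
  also have "\<dots> = S" using 2 by (simp flip: op_assoc)
  finally show thesis using that 1 2 by simp
qed

text \<open>\<open>A' \<odot> B\<close> differs from the identity by
  \<open>(A - A') \<odot> B\<close>, of norm below 1. This will make the resolvent set open.\<close>

lemma op_invertible_perturb:
  fixes A :: "'a::banach quat_op"
  assumes A: "A \<odot> B = id_blinfun" "B \<odot> A = id_blinfun" and "norm (A - A') * norm B < 1"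
  obtains B' where "A' \<odot> B' = id_blinfun" "B' \<odot> A' = id_blinfun"
proof -
  define K where "K = (A - A') \<odot> B"
  have "norm K < 1" unfolding K_def using norm_blinfun_compose [of "A - A'" B] assms(3) by simp
  then obtain S where S: "(id_blinfun - K) \<odot> S = id_blinfun" "S \<odot> (id_blinfun - K) = id_blinfun"
    using op_invertible_near_id by blast
  have K: "id_blinfun - K = A' \<odot> B" by (simp add: K_def op_distrib A)
  have "A' \<odot> (B \<odot> S) = id_blinfun" using S(1) by (simp add: K op_assoc)
  moreover have "(B \<odot> S) \<odot> A' = id_blinfun"
  proof -
    have "B \<odot> S \<odot> A' = B \<odot> (S \<odot> (A' \<odot> B)) \<odot> A" by (simp add: op_assoc A)
    also have "\<dots> = id_blinfun" using S(2) by (simp add: K A)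
    finally show ?thesis .
  qed
  ultimately show thesis using that by blast
qed

section \<open>Contours and slice regular kernels\<close>

text \<open>All the homology that is used about a contour: \<open>U\<close> is a region encircled
  once, \<open>S\<close> the region outside of which nothing is encircled. Both are planar sets, so
  the unit \<open>J\<close> has disappeared.\<close>

definition encloses :: "complex set \<Rightarrow> complex set \<Rightarrow> (real \<Rightarrow> complex) set \<Rightarrow> bool" where
  "encloses U S \<Gamma> \<longleftrightarrow> piecewise_C1_Jordan_curves \<Gamma> \<and> (\<forall>\<gamma>\<in>\<Gamma>. path_image \<gamma> \<subseteq> S - U) \<and>
     (\<forall>z\<in>U. (\<Sum>\<gamma>\<in>\<Gamma>. winding_number \<gamma> z) = 1) \<and> (\<forall>z. z \<notin> S \<longrightarrow> (\<Sum>\<gamma>\<in>\<Gamma>. winding_number \<gamma> z) = 0)"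

lemma encloses_curves:
  assumes "encloses U S \<Gamma>"
  shows "finite \<Gamma>" "\<And>\<gamma>. \<gamma> \<in> \<Gamma> \<Longrightarrow> piecewise_C1 \<gamma>" "\<And>\<gamma>. \<gamma> \<in> \<Gamma> \<Longrightarrow> valid_path \<gamma>"
    "\<And>\<gamma>. \<gamma> \<in> \<Gamma> \<Longrightarrow> pathfinish \<gamma> = pathstart \<gamma>" "\<And>\<gamma>. \<gamma> \<in> \<Gamma> \<Longrightarrow> path_image \<gamma> \<subseteq> S - U"
  using assms piecewise_C1_imp_valid_path unfolding encloses_def piecewise_C1_Jordan_curves_def by blast+

lemma encloses_winding:
  assumes "encloses U S \<Gamma>"
  shows "z \<in> U \<Longrightarrow> (\<Sum>\<gamma>\<in>\<Gamma>. winding_number \<gamma> z) = 1" "z \<notin> S \<Longrightarrow> (\<Sum>\<gamma>\<in>\<Gamma>. winding_number \<gamma> z) = 0"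
  using assms unfolding encloses_def by blast+

lemma path_image_cnj_compose: "path_image (cnj \<circ> \<gamma>) = cnj ` path_image \<gamma>"
  by (simp add: path_image_def image_comp)

text \<open>Conjugation changes the sign of the normalising factor \<open>2 * pi * \<i>\<close>,
  hence the minus sign.\<close>

lemma winding_number_cnj_compose:
  assumes "valid_path \<gamma>" "w \<notin> path_image (cnj \<circ> \<gamma>)"
  shows "winding_number (cnj \<circ> \<gamma>) w = - cnj (winding_number \<gamma> (cnj w))"
proof -
  have "cnj w \<notin> path_image \<gamma>" using assms(2) by (metis complex_cnj_cnj imageI path_image_cnj_compose)
  moreover have "contour_integral (cnj \<circ> \<gamma>) (\<lambda>z. 1 / (z - w)) = cnj (contour_integral \<gamma> (\<lambda>z. 1 / (z - cnj w)))"
    unfolding contour_integral_cnj [OF assms(1)] by (simp add: o_def)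
  ultimately show ?thesis
    using assms by (simp add: winding_number_valid_path valid_path_cnj)
qed

text \<open>The difference of the two cycles is null-homologous in \<open>S - K\<close>: on
  \<open>K\<close> the winding numbers 1 and 1 cancel, and off \<open>S\<close> both vanish.\<close>

lemma encloses_contour_integral_eq:
  assumes "encloses U S \<Gamma>" "encloses U' S \<Gamma>'" "K \<subseteq> U" "K \<subseteq> U'"
    and op: "open (S - K)" and h: "h holomorphic_on S - K"
  shows "(\<Sum>\<gamma>\<in>\<Gamma>. contour_integral \<gamma> h) = (\<Sum>\<gamma>\<in>\<Gamma>'. contour_integral \<gamma> h)"
proof -
  note E = encloses_curves [OF assms(1)] and E' = encloses_curves [OF assms(2)]
  \<comment> \<open>A disjoint sum of index sets, because a curve may belong to both
    families.\<close>
  define d where "d = case_sum (\<lambda>\<gamma>. \<gamma>) (reversepath :: (real \<Rightarrow> complex) \<Rightarrow> _)"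
  have d: "d (Inl \<gamma>) = \<gamma>" "d (Inr \<gamma>) = reversepath \<gamma>" for \<gamma> by (simp_all add: d_def)
  have "(\<Sum>i\<in>\<Gamma> <+> \<Gamma>'. contour_integral (d i) h) = 0"
  proof (rule Cauchy_theorem_cycle [OF op h])
    show "finite (\<Gamma> <+> \<Gamma>')" using E(1) E'(1) by simp
    fix i assume "i \<in> \<Gamma> <+> \<Gamma>'"
    then show "valid_path (d i)" "pathfinish (d i) = pathstart (d i)" "path_image (d i) \<subseteq> S - K"
      using E(3-5) E'(3-5) assms(3,4) by (auto simp: d) blast+
  next
    fix w assume w: "w \<notin> S - K"
    have "(\<Sum>i\<in>\<Gamma> <+> \<Gamma>'. winding_number (d i) w) =
      (\<Sum>\<gamma>\<in>\<Gamma>. winding_number \<gamma> w) + (\<Sum>\<gamma>\<in>\<Gamma>'. winding_number (reversepath \<gamma>) w)"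
      using E(1) E'(1) by (simp add: sum.Plus d)
    also have "(\<Sum>\<gamma>\<in>\<Gamma>'. winding_number (reversepath \<gamma>) w) = (\<Sum>\<gamma>\<in>\<Gamma>'. - winding_number \<gamma> w)"
    proof (rule sum.cong [OF refl])
      fix \<gamma> assume g: "\<gamma> \<in> \<Gamma>'"
      have "w \<notin> path_image \<gamma>" using E'(5) [OF g] w assms(4) by blast
      then show "winding_number (reversepath \<gamma>) w = - winding_number \<gamma> w"
        using E'(3) [OF g] by (intro winding_number_reversepath) (auto simp: valid_path_imp_path)
    qed
    also have "(\<Sum>\<gamma>\<in>\<Gamma>. winding_number \<gamma> w) + (\<Sum>\<gamma>\<in>\<Gamma>'. - winding_number \<gamma> w) = 0"
    proof (cases "w \<in> S")
      case True
      then have "w \<in> U" "w \<in> U'" using w assms(3,4) by auto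
      then show ?thesis by (simp add: sum_negf encloses_winding(1) [OF assms(1)] encloses_winding(1) [OF assms(2)])
    next
      case False
      then show ?thesis by (simp add: sum_negf encloses_winding(2) [OF assms(1)] encloses_winding(2) [OF assms(2)])
    qed
    finally show "(\<Sum>i\<in>\<Gamma> <+> \<Gamma>'. winding_number (d i) w) = 0" .
  qed
  then show ?thesis
    using E(1) E'(1,3) by (simp add: sum.Plus d contour_integral_reversepath sum_negf cong: sum.cong)
qed

text \<open>Reflection reverses orientation, so the cycle together with its reflection winds 1 - 1 =
  0 times around the points of the symmetric set \<open>K\<close>.\<close>

lemma encloses_contour_integral_cnj:
  assumes "encloses U S \<Gamma>" "K \<subseteq> U"
    and op: "open (S - K)" and h: "h holomorphic_on S - K"
    and sym: "\<And>z. z \<in> S \<longleftrightarrow> cnj z \<in> S" "\<And>z. z \<in> K \<longleftrightarrow> cnj z \<in> K"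
  shows "(\<Sum>\<gamma>\<in>\<Gamma>. contour_integral (cnj \<circ> \<gamma>) h) = - (\<Sum>\<gamma>\<in>\<Gamma>. contour_integral \<gamma> h)"
proof -
  note E = encloses_curves [OF assms(1)]
  define d where "d = case_sum (\<lambda>\<gamma>. \<gamma>) (\<lambda>\<gamma> :: real \<Rightarrow> complex. cnj \<circ> \<gamma>)"
  have d: "d (Inl \<gamma>) = \<gamma>" "d (Inr \<gamma>) = cnj \<circ> \<gamma>" for \<gamma> by (simp_all add: d_def)
  have im: "path_image \<gamma> \<subseteq> S - K" if "\<gamma> \<in> \<Gamma>" for \<gamma> using E(5) [OF that] assms(2) by blast
  have im': "path_image (cnj \<circ> \<gamma>) \<subseteq> S - K" if "\<gamma> \<in> \<Gamma>" for \<gamma>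
    using im [OF that] sym unfolding path_image_cnj_compose by blast
  have "(\<Sum>i\<in>\<Gamma> <+> \<Gamma>. contour_integral (d i) h) = 0"
  proof (rule Cauchy_theorem_cycle [OF op h])
    show "finite (\<Gamma> <+> \<Gamma>)" using E(1) by simp
    fix i assume "i \<in> \<Gamma> <+> \<Gamma>"
    then consider \<gamma> where "\<gamma> \<in> \<Gamma>" "i = Inl \<gamma>" | \<gamma> where "\<gamma> \<in> \<Gamma>" "i = Inr \<gamma>" by blast
    then show "valid_path (d i)" "pathfinish (d i) = pathstart (d i)" "path_image (d i) \<subseteq> S - K"
      using E(3,4) im im' by (cases; simp add: d valid_path_cnj pathfinish_compose pathstart_compose)+
  next
    fix w assume w: "w \<notin> S - K"
    have "(\<Sum>i\<in>\<Gamma> <+> \<Gamma>. winding_number (d i) w) =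
      (\<Sum>\<gamma>\<in>\<Gamma>. winding_number \<gamma> w) + (\<Sum>\<gamma>\<in>\<Gamma>. winding_number (cnj \<circ> \<gamma>) w)"
      using E(1) by (simp add: sum.Plus d)
    also have "(\<Sum>\<gamma>\<in>\<Gamma>. winding_number (cnj \<circ> \<gamma>) w) = (\<Sum>\<gamma>\<in>\<Gamma>. - cnj (winding_number \<gamma> (cnj w)))"
      using E(3) im' w by (intro sum.cong refl winding_number_cnj_compose) auto
    also have "\<dots> = - cnj (\<Sum>\<gamma>\<in>\<Gamma>. winding_number \<gamma> (cnj w))"
      by (simp add: sum_negf)
    also have "(\<Sum>\<gamma>\<in>\<Gamma>. winding_number \<gamma> w) + - cnj (\<Sum>\<gamma>\<in>\<Gamma>. winding_number \<gamma> (cnj w)) = 0"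
    proof (cases "w \<in> S")
      case True
      then have "w \<in> U" "cnj w \<in> U" using w assms(2) sym by auto
      then show ?thesis by (simp del: cnj_sum add: encloses_winding(1) [OF assms(1)])
    next
      case False
      then have "cnj w \<notin> S" using sym by auto
      then show ?thesis
        using False by (simp del: cnj_sum add: encloses_winding(2) [OF assms(1)])
    qed
    finally show "(\<Sum>i\<in>\<Gamma> <+> \<Gamma>. winding_number (d i) w) = 0" .
  qed
  then show ?thesis
    using E(1) by (simp add: sum.Plus d eq_neg_iff_add_eq_0 add.commute)
qed

section \<open>Slices of axially symmetric sets and admissible contours\<close>

lemma slice_iff: "z \<in> slice D J \<longleftrightarrow> slice_pt J z \<in> D"
  by (simp add: slice_def)

lemma slice_diff: "slice (D - K) J = slice D J - slice K J"
  by (auto simp: slice_def)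

lemma open_slice: "open D \<Longrightarrow> open (slice D J)"
  using continuous_open_vimage [of D "slice_pt J"] bounded_linear.isCont [OF bounded_linear_slice_pt continuous_ident]
  by (simp add: slice_def vimage_def)

lemma slice_axially_symmetric:
  assumes "axially_symmetric D" "J \<in> \<S>" "J' \<in> \<S>"
  shows "slice D J = slice D J'"
  using assms unfolding axially_symmetric_def slice_def slice_pt_def by blast

lemma slice_cnj:
  assumes "axially_symmetric D" "J \<in> \<S>"
  shows "z \<in> slice D J \<longleftrightarrow> cnj z \<in> slice D J"
proof -
  have "cnj z \<in> slice D J \<longleftrightarrow> z \<in> slice D (- J)" by (simp add: slice_iff slice_pt_cnj)
  then show ?thesis using slice_axially_symmetric [OF assms, of "- J"] assms by simp
qed

lemma closure_slice_subset: "closure (slice U J) \<subseteq> slice (closure U) J"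
proof (rule closure_minimal)
  have "continuous_on UNIV (slice_pt J)"
    by (rule bounded_linear.continuous_on [OF bounded_linear_slice_pt]) simp
  then show "closed (slice (closure U) J)"
    using continuous_closed_vimage [of "closure U" "slice_pt J"]
    by (simp add: slice_def vimage_def continuous_on_eq_continuous_at)
  show "slice U J \<subseteq> slice (closure U) J"
    using closure_subset by (auto simp: slice_def)
qed

text \<open>The curves run through the boundary of an open slice, hence avoid it, and the closure of
  \<open>U\<close> still lies in \<open>D\<close>.\<close>

lemma admissible_encloses:
  assumes "admissible T D (U, J, \<Gamma>)"
  shows "encloses (slice U J) (slice D J) \<Gamma>" "J \<in> \<S>" "open (slice U J)"
    "slice (S_spectrum T) J \<subseteq> slice U J" "slice U J \<subseteq> slice D J"
proof -
  have J: "J \<in> \<S>" and U: "slice_Cauchy_domain U" "S_spectrum T \<subseteq> U" "closure U \<subseteq> D"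
    and \<Gamma>: "piecewise_C1_Jordan_curves \<Gamma>" "frontier (slice U J) = (\<Union>\<gamma>\<in>\<Gamma>. path_image \<gamma>)"
      "\<And>z. z \<in> slice U J \<Longrightarrow> (\<Sum>\<gamma>\<in>\<Gamma>. winding_number \<gamma> z) = 1"
      "\<And>z. z \<notin> closure (slice U J) \<Longrightarrow> (\<Sum>\<gamma>\<in>\<Gamma>. winding_number \<gamma> z) = 0"
    using assms unfolding admissible_def oriented_boundary_def by auto
  show "J \<in> \<S>" by fact
  show op: "open (slice U J)" using U by (intro open_slice) (simp add: slice_Cauchy_domain_def)
  have cl: "closure (slice U J) \<subseteq> slice D J"
    using closure_slice_subset [of U J] U(3) by (auto simp: slice_def)
  show "slice (S_spectrum T) J \<subseteq> slice U J" using U(2) by (auto simp: slice_def)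
  show "slice U J \<subseteq> slice D J" using cl closure_subset by blast
  have "frontier (slice U J) \<subseteq> slice D J - slice U J"
    using cl op by (auto simp: frontier_def interior_open)
  then show "encloses (slice U J) (slice D J) \<Gamma>"
    unfolding encloses_def using \<Gamma> cl by (metis SUP_le_iff subsetD)
qed

text \<open>The operator analogue of an intrinsic function. For nonzero \<open>q\<close> the unit
  \<open>J'\<close> is the rotated \<open>J\<close>, so the first clause is equivariance under the
  rotations \<open>s \<mapsto> q * s * inverse q\<close>, written without inverses. The case
  \<open>J' = - J\<close> relates the two halves of one slice.\<close>

definition slice_regular_op :: "quat set \<Rightarrow> (quat \<Rightarrow> 'a::real_normed_vector quat_op) \<Rightarrow> bool" where
  "slice_regular_op D k \<longleftrightarrow>
     (\<forall>q J J' z. J \<in> \<S> \<and> J' \<in> \<S> \<and> q * J = J' * q \<and> slice_pt J z \<in> D \<longrightarrow>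
       lop q \<odot> k (slice_pt J z) = k (slice_pt J' z) \<odot> lop q) \<and>
     (\<forall>J\<in>\<S>. op_holo J (slice D J) (\<lambda>z. k (slice_pt J z)))"

lemma slice_regular_opI:
  assumes "\<And>q J J' z. \<lbrakk>J \<in> \<S>; J' \<in> \<S>; q * J = J' * q; slice_pt J z \<in> D\<rbrakk> \<Longrightarrow>
       lop q \<odot> k (slice_pt J z) = k (slice_pt J' z) \<odot> lop q"
    and "\<And>J. J \<in> \<S> \<Longrightarrow> op_holo J (slice D J) (\<lambda>z. k (slice_pt J z))"
  shows "slice_regular_op D k"
  using assms by (simp add: slice_regular_op_def)

lemma slice_regular_opD:
  assumes "slice_regular_op D k" "J \<in> \<S>"
  shows "\<lbrakk>J' \<in> \<S>; q * J = J' * q; slice_pt J z \<in> D\<rbrakk> \<Longrightarrow>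
       lop q \<odot> k (slice_pt J z) = k (slice_pt J' z) \<odot> lop q"
    and "op_holo J (slice D J) (\<lambda>z. k (slice_pt J z))"
  using assms by (simp_all add: slice_regular_op_def)

lemma slice_pt_intertwine: "q * J = J' * q \<Longrightarrow> q * slice_pt J z = slice_pt J' z * q"
  by (simp add: slice_pt_eq distrib_left distrib_right)

lemma slice_regular_op_add:
  "slice_regular_op D k \<Longrightarrow> slice_regular_op D k' \<Longrightarrow> slice_regular_op D (\<lambda>s. k s + k' s)"
  by (rule slice_regular_opI) (auto simp: op_distrib slice_regular_opD intro!: op_holo_add)

lemma slice_regular_op_compose:
  assumes D: "open D" and k: "slice_regular_op D k" and k': "slice_regular_op D k'"
  shows "slice_regular_op D (\<lambda>s. k s \<odot> k' s)"
proof (rule slice_regular_opI)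
  fix q J J' z assume *: "J \<in> \<S>" "J' \<in> \<S>" "q * J = J' * q" "slice_pt J z \<in> D"
  have "lop q \<odot> (k (slice_pt J z) \<odot> k' (slice_pt J z)) = k (slice_pt J' z) \<odot> (lop q \<odot> k' (slice_pt J z))"
    using slice_regular_opD(1) [OF k *] by (simp flip: op_assoc)
  then show "lop q \<odot> (k (slice_pt J z) \<odot> k' (slice_pt J z)) = (k (slice_pt J' z) \<odot> k' (slice_pt J' z)) \<odot> lop q"
    by (simp add: slice_regular_opD(1) [OF k' *] op_assoc)
qed (use assms in \<open>auto intro!: op_holo_compose open_slice simp: slice_regular_opD\<close>)

lemma slice_regular_op_const:
  assumes "\<And>q. op_commute (lop q) a"
  shows "slice_regular_op D (\<lambda>s. a)"
  by (rule slice_regular_opI)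
    (use assms in \<open>auto intro!: op_holo_const simp: op_commute_def\<close>)

lemma slice_regular_op_ident:
  assumes "open D"
  shows "slice_regular_op D (lop :: quat \<Rightarrow> 'a::real_normed_vector quat_op)"
proof (rule slice_regular_opI)
  show "op_holo J (slice D J) (\<lambda>z. lop (slice_pt J z) :: 'a quat_op)" if "J \<in> \<S>" for J
    using op_holo_scal [OF that open_slice [OF assms] holomorphic_on_ident] by (simp add: scal_def)
next
  fix q J J' :: quat and z assume "q * J = J' * q"
  then show "lop q \<odot> lop (slice_pt J z) = (lop (slice_pt J' z) \<odot> lop q :: 'a quat_op)"
    by (metis lop_mult slice_pt_intertwine)
qed

lemma slice_regular_op_subset:
  assumes "slice_regular_op D k" "D' \<subseteq> D"
  shows "slice_regular_op D' k"
proof (rule slice_regular_opI)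
  fix J assume J: "J \<in> \<S>"
  have "slice D' J \<subseteq> slice D J" using assms(2) by (auto simp: slice_def)
  then show "op_holo J (slice D' J) (\<lambda>z. k (slice_pt J z))"
    by (rule op_holo_subset [OF slice_regular_opD(2) [OF assms(1) J]])
qed (use assms in \<open>auto simp: slice_regular_opD\<close>)

lemma slice_regular_op_inverse:
  assumes D: "open D" "axially_symmetric D" and k: "slice_regular_op D k"
    and inv: "\<And>s. s \<in> D \<Longrightarrow> k s \<odot> r s = id_blinfun" "\<And>s. s \<in> D \<Longrightarrow> r s \<odot> k s = id_blinfun"
  shows "slice_regular_op D r"
proof (rule slice_regular_opI)
  fix q J J' z assume *: "J \<in> \<S>" "J' \<in> \<S>" "q * J = J' * q" "slice_pt J z \<in> D"
  have "slice_pt J' z \<in> D" using slice_axially_symmetric [OF D(2) *(1,2)] *(4) by (auto simp: slice_def)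
  then show "lop q \<odot> r (slice_pt J z) = r (slice_pt J' z) \<odot> lop q"
    using inv *(4) by (intro op_inverse_commute [OF _ _ slice_regular_opD(1) [OF k *]]) auto
next
  fix J assume J: "J \<in> \<S>"
  show "op_holo J (slice D J) (\<lambda>z. r (slice_pt J z))"
    by (rule op_holo_inverse [OF J open_slice [OF D(1)] slice_regular_opD(2) [OF k J]])
      (use inv in \<open>auto simp: slice_def\<close>)
qed

section \<open>Independence of the contour\<close>

lemma path_int_cong:
  assumes "\<And>\<gamma> z. \<gamma> \<in> \<Gamma> \<Longrightarrow> z \<in> path_image \<gamma> \<Longrightarrow> k z = k' z"
  shows "path_int J \<Gamma> k = path_int J \<Gamma> k'"
  unfolding path_int_def
proof (intro arg_cong [where f = "scaleR _"] sum.cong refl integral_cong)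
  fix \<gamma> t assume "\<gamma> \<in> \<Gamma>" "t \<in> {0..1::real}"
  then have "\<gamma> t \<in> path_image \<gamma>" by (simp add: path_image_def)
  with assms \<open>\<gamma> \<in> \<Gamma>\<close> show "k (\<gamma> t) \<odot> line_element J \<gamma> t = k' (\<gamma> t) \<odot> line_element J \<gamma> t" by simp
qed

definition slice_int :: "quat \<Rightarrow> (real \<Rightarrow> complex) set \<Rightarrow> (quat \<Rightarrow> 'a::banach quat_op) \<Rightarrow> 'a quat_op" where
  "slice_int J \<Gamma> k = path_int J \<Gamma> (\<lambda>z. k (slice_pt J z))"

text \<open>Applied with the S-spectrum as \<open>K\<close>, and with the domain of f, the domain of
  g and their intersection as \<open>D\<close>.\<close>

locale spectral_domain =
  fixes D K :: "quat set"
  assumes open_D: "open D" and axial_D: "axially_symmetric D"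
    and axial_K: "axially_symmetric K" and open_DK: "open (D - K)"
begin

definition surrounds :: "quat \<Rightarrow> (real \<Rightarrow> complex) set \<Rightarrow> bool" where
  "surrounds J \<Gamma> \<longleftrightarrow> J \<in> \<S> \<and> (\<exists>U. open U \<and> slice K J \<subseteq> U \<and> U \<subseteq> slice D J \<and> encloses U (slice D J) \<Gamma>)"

lemma surroundsE:
  assumes "surrounds J \<Gamma>"
  obtains U where "open U" "slice K J \<subseteq> U" "U \<subseteq> slice D J" "encloses U (slice D J) \<Gamma>"
  using assms unfolding surrounds_def by blast

lemma surrounds_unit: "surrounds J \<Gamma> \<Longrightarrow> J \<in> \<S>"
  by (simp add: surrounds_def)

lemma surrounds_curves:
  assumes "surrounds J \<Gamma>"
  shows "finite \<Gamma>" "\<And>\<gamma>. \<gamma> \<in> \<Gamma> \<Longrightarrow> piecewise_C1 \<gamma>" "\<And>\<gamma>. \<gamma> \<in> \<Gamma> \<Longrightarrow> valid_path \<gamma>"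
    "\<And>\<gamma>. \<gamma> \<in> \<Gamma> \<Longrightarrow> path_image \<gamma> \<subseteq> slice (D - K) J"
proof -
  obtain U where U: "slice K J \<subseteq> U" "encloses U (slice D J) \<Gamma>" using assms by (rule surroundsE)
  show "finite \<Gamma>" "\<And>\<gamma>. \<gamma> \<in> \<Gamma> \<Longrightarrow> piecewise_C1 \<gamma>" "\<And>\<gamma>. \<gamma> \<in> \<Gamma> \<Longrightarrow> valid_path \<gamma>"
    using encloses_curves [OF U(2)] by auto
  show "path_image \<gamma> \<subseteq> slice (D - K) J" if "\<gamma> \<in> \<Gamma>" for \<gamma>
    using encloses_curves(5) [OF U(2) that] U(1) by (auto simp: slice_diff)
qed

lemma slice_unit: "J \<in> \<S> \<Longrightarrow> J' \<in> \<S> \<Longrightarrow> slice D J = slice D J'" "J \<in> \<S> \<Longrightarrow> J' \<in> \<S> \<Longrightarrow> slice K J = slice K J'"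
  using axial_D axial_K slice_axially_symmetric by blast+

text \<open>All slices of an axially symmetric set coincide as subsets of the complex plane, so one
  family of planar curves serves every unit.\<close>

lemma surrounds_change_unit:
  assumes "surrounds J \<Gamma>" "J' \<in> \<S>"
  shows "surrounds J' \<Gamma>"
proof -
  have J: "J \<in> \<S>" using assms(1) by (rule surrounds_unit)
  from assms show ?thesis unfolding surrounds_def slice_unit [OF J assms(2)] by blast
qed

lemma open_slice_DK: "open (slice (D - K) J)"
  by (rule open_slice [OF open_DK])

lemma surrounds_continuous:
  assumes "surrounds J \<Gamma>" "continuous_on (slice (D - K) J) k"
  shows "continuous_on_paths \<Gamma> k"
  unfolding continuous_on_paths_def
  using surrounds_curves(4) [OF assms(1)] continuous_on_subset [OF assms(2)] by blast

lemma surrounds_op_holo_continuous: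
  "surrounds J \<Gamma> \<Longrightarrow> op_holo J (slice (D - K) J) k \<Longrightarrow> continuous_on_paths \<Gamma> k"
  by (rule surrounds_continuous) (auto intro: op_holo_continuous_on open_slice_DK)

lemma slice_functional_path_int':
  assumes \<Gamma>: "surrounds J \<Gamma>" and k: "op_holo J (slice (D - K) J) k" and L: "slice_functional J L"
  shows "L (path_int J \<Gamma> k) = - \<i> / (2 * pi) * (\<Sum>\<gamma>\<in>\<Gamma>. contour_integral \<gamma> (\<lambda>z. L (k z)))"
  by (rule slice_functional_path_int [OF L surrounds_unit [OF \<Gamma>] surrounds_curves(1,2) [OF \<Gamma>]
        surrounds_op_holo_continuous [OF \<Gamma> k]])

lemma path_int_indep:
  fixes k :: "complex \<Rightarrow> 'a::banach quat_op"
  assumes \<Gamma>: "surrounds J \<Gamma>" and \<Gamma>': "surrounds J \<Gamma>'" and k: "op_holo J (slice (D - K) J) k"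
  shows "path_int J \<Gamma> k = path_int J \<Gamma>' k"
proof (rule slice_functional_separates [OF surrounds_unit [OF \<Gamma>]])
  fix L :: "'a quat_op \<Rightarrow> complex" assume L: "slice_functional J L"
  obtain U U' where U: "slice K J \<subseteq> U" "encloses U (slice D J) \<Gamma>" "slice K J \<subseteq> U'" "encloses U' (slice D J) \<Gamma>'"
    using \<Gamma> \<Gamma>' by (elim surroundsE)
  have "(\<lambda>z. L (k z)) holomorphic_on slice (D - K) J"
    by (rule op_holo_slice_functional [OF k open_slice_DK L])
  then have "(\<Sum>\<gamma>\<in>\<Gamma>. contour_integral \<gamma> (\<lambda>z. L (k z))) = (\<Sum>\<gamma>\<in>\<Gamma>'. contour_integral \<gamma> (\<lambda>z. L (k z)))"
    by (intro encloses_contour_integral_eq [OF U(2,4,1,3)]) (use open_slice_DK in \<open>auto simp flip: slice_diff\<close>)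
  then show "L (path_int J \<Gamma> k) = L (path_int J \<Gamma>' k)"
    by (simp add: slice_functional_path_int' [OF _ k L] \<Gamma> \<Gamma>')
qed

lemma path_int_commute_unit:
  assumes \<Gamma>: "surrounds J \<Gamma>" and k: "op_holo J (slice (D - K) J) k"
  shows "op_commute (path_int J \<Gamma> k) (lop J)"
proof -
  note c = surrounds_curves(2) [OF \<Gamma>] surrounds_op_holo_continuous [OF \<Gamma> k]
  have "lop J \<odot> path_int J \<Gamma> k = path_int J \<Gamma> (\<lambda>z. lop J \<odot> k z)"
    by (rule path_int_left [OF c, symmetric])
  also have "\<dots> = path_int J \<Gamma> (\<lambda>z. k z \<odot> lop J)"
  proof (rule path_int_cong)
    fix \<gamma> z assume "\<gamma> \<in> \<Gamma>" "z \<in> path_image \<gamma>"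
    then have "z \<in> slice (D - K) J" using surrounds_curves(4) [OF \<Gamma>] by blast
    then show "lop J \<odot> k z = k z \<odot> lop J" using op_holo_commute [OF k] by (simp add: op_commute_def)
  qed
  also have "\<dots> = path_int J \<Gamma> k \<odot> lop J"
    by (rule path_int_right [OF c]) auto
  finally show ?thesis by (simp add: op_commute_def)
qed

text \<open>Reflecting the contour in the real axis reverses its orientation, and so does replacing \<open>J\<close>
  by \<open>- J\<close>.\<close>

lemma slice_int_minus_unit:
  fixes k :: "quat \<Rightarrow> 'a::banach quat_op"
  assumes \<Gamma>: "surrounds J \<Gamma>" and k: "slice_regular_op (D - K) k"
  shows "slice_int (- J) \<Gamma> k = slice_int J \<Gamma> k"
proof -
  have J: "J \<in> \<S>" "- J \<in> \<S>" using \<Gamma> by (simp_all add: surrounds_unit)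
  show ?thesis
  proof (rule slice_functional_separates [OF J(1)])
    fix L :: "'a quat_op \<Rightarrow> complex" assume L: "slice_functional J L"
    have bl: "bounded_linear L" and sc: "\<And>S w. L (S \<odot> scal J w) = w * L S"
      using L by (auto simp: slice_functional_def)
    define h where "h z = L (k (slice_pt J z))" for z
    have kJ: "op_holo J (slice (D - K) J) (\<lambda>z. k (slice_pt J z))"
      and kJ': "op_holo (- J) (slice (D - K) (- J)) (\<lambda>z. k (slice_pt (- J) z))"
      using slice_regular_opD(2) [OF k] J by auto
    have h: "h holomorphic_on slice (D - K) J"
      unfolding h_def by (rule op_holo_slice_functional [OF kJ open_slice_DK L])
    \<comment> \<open>For the unit \<open>- J\<close> the point and the derivative are the
      conjugates of those for \<open>J\<close>, and the factor \<open>J\<close> in the line element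
      changes sign. The result is an integral over the reflected curve with \<open>\<i>\<close>
      instead of \<open>- \<i>\<close>.\<close>
    have "L (integral {0..1} (\<lambda>t. k (slice_pt (- J) (\<gamma> t)) \<odot> line_element (- J) \<gamma> t)) = \<i> * contour_integral (cnj \<circ> \<gamma>) h"
      if "\<gamma> \<in> \<Gamma>" for \<gamma>
    proof -
      note \<gamma> = surrounds_curves(2,3) [OF \<Gamma> that]
      have "continuous_on (path_image \<gamma>) (\<lambda>z. k (slice_pt (- J) z))"
        using surrounds_op_holo_continuous [OF surrounds_change_unit [OF \<Gamma> J(2)] kJ'] that
        by (simp add: continuous_on_paths_def)
      then have "L (integral {0..1} (\<lambda>t. k (slice_pt (- J) (\<gamma> t)) \<odot> line_element (- J) \<gamma> t)) =
        integral {0..1} (\<lambda>t. L (k (slice_pt (- J) (\<gamma> t)) \<odot> line_element (- J) \<gamma> t))"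
        using integral_linear [OF path_int_integrable [OF \<gamma>(1)] bl, of "\<lambda>z. k (slice_pt (- J) z)" "- J"] by (simp add: o_def)
      also have "\<dots> = integral {0..1} (\<lambda>t. \<i> * cnj (cnj (h (cnj (\<gamma> t))) * vector_derivative \<gamma> (at t within {0..1})))"
      proof (rule integral_cong)
        fix t
        have "(line_element (- J) \<gamma> t :: 'a quat_op) = scal J (cnj (vector_derivative \<gamma> (at t within {0..1})) * \<i>)"
          unfolding line_element_eq [OF J(2)] by (simp add: scal_def flip: slice_pt_cnj)
        then show "L (k (slice_pt (- J) (\<gamma> t)) \<odot> line_element (- J) \<gamma> t) =
          \<i> * cnj (cnj (h (cnj (\<gamma> t))) * vector_derivative \<gamma> (at t within {0..1}))"
          by (simp add: sc h_def mult_ac flip: slice_pt_cnj)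
      qed
      also have "\<dots> = \<i> * cnj (contour_integral \<gamma> (cnj \<circ> h \<circ> cnj))"
      proof -
        have "contour_integral \<gamma> (cnj \<circ> h \<circ> cnj) =
          integral {0..1} (\<lambda>t. cnj (h (cnj (\<gamma> t))) * vector_derivative \<gamma> (at t within {0..1}))"
          by (simp add: contour_integral_def has_contour_integral_def integral_def contour_integrable_on_def integrable_on_def)
        then show ?thesis by (simp only: integral_mult_right integral_cnj)
      qed
      finally show ?thesis by (simp only: contour_integral_cnj [OF \<gamma>(2)])
    qed
    then have "L (slice_int (- J) \<Gamma> k) = (1 / (2 * pi)) *\<^sub>R (\<Sum>\<gamma>\<in>\<Gamma>. \<i> * contour_integral (cnj \<circ> \<gamma>) h)"
      unfolding slice_int_def path_int_def linear_scale [OF bounded_linear.linear [OF bl]]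
        linear_sum [OF bounded_linear.linear [OF bl]] by simp
    also have "\<dots> = \<i> / (2 * pi) * (\<Sum>\<gamma>\<in>\<Gamma>. contour_integral (cnj \<circ> \<gamma>) h)"
      unfolding sum_distrib_left [symmetric] by (simp add: scaleR_conv_of_real)
    also have "(\<Sum>\<gamma>\<in>\<Gamma>. contour_integral (cnj \<circ> \<gamma>) h) = - (\<Sum>\<gamma>\<in>\<Gamma>. contour_integral \<gamma> h)"
    proof -
      obtain U where U: "slice K J \<subseteq> U" "encloses U (slice D J) \<Gamma>" using \<Gamma> by (rule surroundsE)
      show ?thesis
        by (rule encloses_contour_integral_cnj [OF U(2,1)])
          (use open_slice_DK h slice_cnj [OF axial_D J(1)] slice_cnj [OF axial_K J(1)] in \<open>auto simp flip: slice_diff\<close>)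
    qed
    finally show "L (slice_int (- J) \<Gamma> k) = L (slice_int J \<Gamma> k)"
      using slice_functional_path_int' [OF \<Gamma> kJ L] by (simp add: slice_int_def h_def [abs_def])
  qed
qed

text \<open>The line element obeys the same intertwining rule as the kernel, so \<open>q\<close> can
  be carried through the integrand pointwise.\<close>

lemma slice_int_intertwine:
  fixes k :: "quat \<Rightarrow> 'a::banach quat_op"
  assumes \<Gamma>: "surrounds J \<Gamma>" and k: "slice_regular_op (D - K) k" and J': "J' \<in> \<S>" and q: "q * J = J' * q"
  shows "lop q \<odot> slice_int J \<Gamma> k = slice_int J' \<Gamma> k \<odot> lop q"
proof -
  have J: "J \<in> \<S>" using \<Gamma> by (rule surrounds_unit)
  have \<Gamma>': "surrounds J' \<Gamma>" by (rule surrounds_change_unit [OF \<Gamma> J'])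
  note c = surrounds_op_holo_continuous [OF \<Gamma> slice_regular_opD(2) [OF k J]]
    and c' = surrounds_op_holo_continuous [OF \<Gamma>' slice_regular_opD(2) [OF k J']]
  have bl: "bounded_linear (\<lambda>b :: 'a quat_op. lop q \<odot> b)" "bounded_linear (\<lambda>b :: 'a quat_op. b \<odot> lop q)"
    by (rule bounded_linear_op_right
        bounded_linear_op_left)+
  have "lop q \<odot> integral {0..1} (\<lambda>t. k (slice_pt J (\<gamma> t)) \<odot> line_element J \<gamma> t) =
    integral {0..1} (\<lambda>t. k (slice_pt J' (\<gamma> t)) \<odot> line_element J' \<gamma> t) \<odot> lop q" if "\<gamma> \<in> \<Gamma>" for \<gamma>
  proof -
    note \<gamma> = surrounds_curves(2,4) [OF \<Gamma> that]
    have int: "(\<lambda>t. k (slice_pt J (\<gamma> t)) \<odot> line_element J \<gamma> t) integrable_on {0..1}"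
      "(\<lambda>t. k (slice_pt J' (\<gamma> t)) \<odot> line_element J' \<gamma> t) integrable_on {0..1}"
      using path_int_integrable [OF \<gamma>(1), of "\<lambda>z. k (slice_pt J z)" J]
        path_int_integrable [OF \<gamma>(1), of "\<lambda>z. k (slice_pt J' z)" J'] c c' that
      by (auto simp: continuous_on_paths_def)
    have "lop q \<odot> integral {0..1} (\<lambda>t. k (slice_pt J (\<gamma> t)) \<odot> line_element J \<gamma> t) =
      integral {0..1} (\<lambda>t. lop q \<odot> (k (slice_pt J (\<gamma> t)) \<odot> line_element J \<gamma> t))"
      using integral_linear [OF int(1) bl(1)] by (simp add: o_def)
    also have "\<dots> = integral {0..1} (\<lambda>t. (k (slice_pt J' (\<gamma> t)) \<odot> line_element J' \<gamma> t) \<odot> lop q)"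
    proof (rule integral_cong)
      fix t :: real assume "t \<in> {0..1}"
      then have "\<gamma> t \<in> path_image \<gamma>" by (simp add: path_image_def)
      then have "slice_pt J (\<gamma> t) \<in> D - K" using \<gamma>(2) slice_iff by blast
      then have 1: "lop q \<odot> k (slice_pt J (\<gamma> t)) = k (slice_pt J' (\<gamma> t)) \<odot> lop q"
        by (rule slice_regular_opD(1) [OF k J J' q])
      have 2: "lop q \<odot> line_element J \<gamma> t = line_element J' \<gamma> t \<odot> (lop q :: 'a quat_op)"
      proof -
        have "q * (slice_pt J w * - J) = slice_pt J' w * - J' * q" for w
          using q slice_pt_intertwine [OF q, of w] by (metis mult.assoc mult_minus_left mult_minus_right)
        then show ?thesis by (simp only: line_element_def flip: lop_mult)
      qed
      have "lop q \<odot> (k (slice_pt J (\<gamma> t)) \<odot> line_element J \<gamma> t) = k (slice_pt J' (\<gamma> t)) \<odot> (lop q \<odot> line_element J \<gamma> t)"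
        by (simp only: 1 flip: op_assoc)
      then show "lop q \<odot> (k (slice_pt J (\<gamma> t)) \<odot> line_element J \<gamma> t) = (k (slice_pt J' (\<gamma> t)) \<odot> line_element J' \<gamma> t) \<odot> lop q"
        by (simp only: 2 op_assoc)
    qed
    also have "\<dots> = integral {0..1} (\<lambda>t. k (slice_pt J' (\<gamma> t)) \<odot> line_element J' \<gamma> t) \<odot> lop q"
      using integral_linear [OF int(2) bl(2)] by (simp add: o_def)
    finally show ?thesis .
  qed
  then show ?thesis
    unfolding slice_int_def path_int_def
    by (simp add: linear_sum [OF bounded_linear.linear [OF bl(1)]] linear_sum [OF bounded_linear.linear [OF bl(2)]]
       op_scaleR_left
       op_scaleR_right)
qed

text \<open>Every quaternion splits into a part commuting and a part anticommuting with \<open>J\<close>.\<close>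

lemma slice_int_real:
  fixes k :: "quat \<Rightarrow> 'a::banach quat_op"
  assumes \<Gamma>: "surrounds J \<Gamma>" and k: "slice_regular_op (D - K) k"
  shows "op_commute (lop q) (slice_int J \<Gamma> k)"
proof -
  have J: "J \<in> \<S>" using \<Gamma> by (rule surrounds_unit)
  then have JJ: "J * J = - 1" by (simp add: imag_units_def)
  have JJ': "J * (J * x) = - x" for x using JJ by (simp flip: mult.assoc)
  define a where "a = q - J * q * J"
  define b where "b = q + J * q * J"
  have "a * J = J * a" by (simp add: a_def algebra_simps JJ JJ')
  then have a: "lop a \<odot> slice_int J \<Gamma> k = slice_int J \<Gamma> k \<odot> lop a"
    by (rule slice_int_intertwine [OF \<Gamma> k J])
  have "b * J = (- J) * b" by (simp add: b_def algebra_simps JJ JJ')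
  then have b: "lop b \<odot> slice_int J \<Gamma> k = slice_int J \<Gamma> k \<odot> lop b"
    using slice_int_intertwine [OF \<Gamma> k, of "- J" b] J slice_int_minus_unit [OF \<Gamma> k] by simp
  have "a + b = 2 *\<^sub>R q" by (simp add: a_def b_def scaleR_2)
  then have "q = (1/2) *\<^sub>R (a + b)" by simp
  then have q: "lop q = (1/2) *\<^sub>R (lop a + lop b :: 'a quat_op)" by (metis lop_scaleR lop_add)
  then show ?thesis by (simp only: op_commute_def op_distrib a b q)
qed

text \<open>\<open>J + J'\<close> intertwines \<open>J\<close> with \<open>J'\<close>, and by
  \<open>slice_int_real\<close> it also commutes with the integral for \<open>J\<close>. Being
  nonzero unless \<open>J' = - J\<close>, it can be cancelled; the exceptional unit is covered by
  \<open>slice_int_minus_unit\<close>. The change of curves then happens within one slice.\<close>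

theorem slice_int_indep:
  fixes k :: "quat \<Rightarrow> 'a::banach quat_op"
  assumes \<Gamma>: "surrounds J \<Gamma>" and \<Gamma>': "surrounds J' \<Gamma>'" and k: "slice_regular_op (D - K) k"
  shows "slice_int J \<Gamma> k = slice_int J' \<Gamma>' k"
proof -
  have J: "J \<in> \<S>" and J': "J' \<in> \<S>" using \<Gamma> \<Gamma>' by (auto intro: surrounds_unit)
  then have JJ: "J * J = - 1" "J' * J' = - 1" by (simp_all add: imag_units_def)
  have "slice_int J \<Gamma> k = slice_int J' \<Gamma> k"
  proof (cases "J' = - J")
    case True
    then show ?thesis using slice_int_minus_unit [OF \<Gamma> k] by simp
  next
    case False
    define q where "q = J + J'"
    have "q \<noteq> 0" using False by (auto simp: q_def add_eq_0_iff)
    have "q * J = J' * q" by (simp add: q_def algebra_simps JJ)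
    then have "slice_int J \<Gamma> k \<odot> lop q = slice_int J' \<Gamma> k \<odot> lop q"
      using slice_int_intertwine [OF \<Gamma> k J'] slice_int_real [OF \<Gamma> k, of q] by (simp add: op_commute_def)
    then have "slice_int J \<Gamma> k \<odot> (lop q \<odot> lop (inverse q)) = slice_int J' \<Gamma> k \<odot> (lop q \<odot> lop (inverse q))"
      by (simp flip: op_assoc)
    then show ?thesis by (simp add: lop_inverse(2) [OF \<open>q \<noteq> 0\<close>])
  qed
  also have "\<dots> = slice_int J' \<Gamma>' k"
    unfolding slice_int_def
    by (rule path_int_indep [OF surrounds_change_unit [OF \<Gamma> J'] \<Gamma>' slice_regular_opD(2) [OF k J']])
  finally show ?thesis .
qed

end

section \<open>Products of slice integrals\<close>

lemma continuous_on_paths_sum: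
  fixes k :: "'i \<Rightarrow> complex \<Rightarrow> 'b::topological_comm_monoid_add"
  shows "(\<And>i. i \<in> I \<Longrightarrow> continuous_on_paths \<Gamma> (k i)) \<Longrightarrow> continuous_on_paths \<Gamma> (\<lambda>z. \<Sum>i\<in>I. k i z)"
  unfolding continuous_on_paths_def by (intro ballI continuous_on_sum) blast

lemma path_int_sum:
  fixes k :: "'i \<Rightarrow> complex \<Rightarrow> 'a::banach quat_op"
  assumes \<Gamma>: "\<And>\<gamma>. \<gamma> \<in> \<Gamma> \<Longrightarrow> piecewise_C1 \<gamma>" and I: "finite I" "\<And>i. i \<in> I \<Longrightarrow> continuous_on_paths \<Gamma> (k i)"
  shows "path_int J \<Gamma> (\<lambda>z. \<Sum>i\<in>I. k i z) = (\<Sum>i\<in>I. path_int J \<Gamma> (k i))"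
  using I
proof (induction I rule: finite_induct)
  case (insert i I)
  have "path_int J \<Gamma> (\<lambda>z. k i z + (\<Sum>j\<in>I. k j z)) = path_int J \<Gamma> (k i) + path_int J \<Gamma> (\<lambda>z. \<Sum>j\<in>I. k j z)"
    by (rule path_int_add [OF \<Gamma>]) (use insert in \<open>auto intro: continuous_on_paths_sum\<close>)
  then show ?case using insert by simp
qed (simp add: path_int_def)

lemma op_holo_sum:
  "finite I \<Longrightarrow> (\<And>i. i \<in> I \<Longrightarrow> op_holo J S (k i)) \<Longrightarrow> op_holo J S (\<lambda>z. \<Sum>i\<in>I. k i z)"
  by (induction I rule: finite_induct) (auto intro: op_holo_const op_holo_add)

context spectral_domain
begin

text \<open>The multiplicativity argument uses a single contour and no double integral. The left factors are
  integrated with \<open>\<eta>\<close> as a parameter. Off the contour, the kernel identity turns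
  the result minus \<open>H \<eta> F \<eta>\<close> into a Cauchy type integral, which continues analytically across the
  spectrum; so its product with \<open>G\<close> integrates to zero.\<close>

lemma path_int_product:
  fixes H :: "complex \<Rightarrow> 'a::banach quat_op" and A B :: "'i \<Rightarrow> complex \<Rightarrow> 'a quat_op"
  assumes \<Gamma>: "surrounds J \<Gamma>" and I: "finite I"
    and H: "op_holo J (slice (D - K) J) H"
    and A: "\<And>i. i \<in> I \<Longrightarrow> op_holo J (slice (D - K) J) (A i)"
    and B: "\<And>i. i \<in> I \<Longrightarrow> op_holo J (slice (D - K) J) (B i)"
    and F: "F holomorphic_on slice D J" and G: "G holomorphic_on slice D J"
    and kernel: "\<And>\<zeta> \<eta>. \<zeta> \<in> slice (D - K) J \<Longrightarrow> \<eta> \<in> slice (D - K) J \<Longrightarrow>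
      (\<Sum>i\<in>I. A i \<zeta> \<odot> B i \<eta>) \<odot> scal J (\<eta> - \<zeta>) = H \<zeta> - H \<eta>"
  shows "(\<Sum>i\<in>I. path_int J \<Gamma> (\<lambda>z. A i z \<odot> scal J (F z)) \<odot> path_int J \<Gamma> (\<lambda>z. B i z \<odot> scal J (G z))) =
    path_int J \<Gamma> (\<lambda>z. H z \<odot> scal J (F z * G z))"
proof (rule slice_functional_separates [OF surrounds_unit [OF \<Gamma>]])
  fix L :: "'a quat_op \<Rightarrow> complex" assume L: "slice_functional J L"
  have J: "J \<in> \<S>" using \<Gamma> by (rule surrounds_unit)
  have bl: "bounded_linear L" and sc: "\<And>S w. L (S \<odot> scal J w) = w * L S"
    using L by (auto simp: slice_functional_def)
  note lin = bounded_linear.linear [OF bl]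
  define R where "R = slice (D - K) J"
  define S where "S = slice D J"
  have op: "open R" "open S" by (simp_all add: R_def S_def open_slice_DK open_slice open_D)
  have RS: "R \<subseteq> S" by (auto simp: R_def S_def slice_def)
  have H: "op_holo J R H" and F: "F holomorphic_on S" and G: "G holomorphic_on S"
    and A: "\<And>i. i \<in> I \<Longrightarrow> op_holo J R (A i)" and B: "\<And>i. i \<in> I \<Longrightarrow> op_holo J R (B i)"
    using assms by (auto simp: R_def S_def)
  have FR: "F holomorphic_on R" and GR: "G holomorphic_on R" using F G RS by (auto intro: holomorphic_on_subset)
  have curves: "finite \<Gamma>" "\<And>\<gamma>. \<gamma> \<in> \<Gamma> \<Longrightarrow> piecewise_C1 \<gamma>" "\<And>\<gamma>. \<gamma> \<in> \<Gamma> \<Longrightarrow> valid_path \<gamma>"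
    "\<And>\<gamma>. \<gamma> \<in> \<Gamma> \<Longrightarrow> path_image \<gamma> \<subseteq> R"
    using surrounds_curves [OF \<Gamma>] by (auto simp: R_def)
  obtain U where U: "open U" "slice K J \<subseteq> U" "U \<subseteq> S" "encloses U S \<Gamma>"
    using \<Gamma> by (rule surroundsE) (simp add: S_def)
  have SU: "U \<union> R = S" using U(2,3) RS by (auto simp: R_def S_def slice_diff)
  have off: "path_image \<gamma> \<inter> U = {}" if "\<gamma> \<in> \<Gamma>" for \<gamma>
    using encloses_curves(5) [OF U(4) that] by blast
  have loop: "pathfinish \<gamma> = pathstart \<gamma>" if "\<gamma> \<in> \<Gamma>" for \<gamma>
    by (rule encloses_curves(4) [OF U(4) that])
  note cont = surrounds_op_holo_continuous [OF \<Gamma>, folded R_def]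
    and Lint = slice_functional_path_int' [OF \<Gamma> _ L, folded R_def]
  have AF: "op_holo J R (\<lambda>z. A i z \<odot> scal J (F z))" if "i \<in> I" for i
    by (rule op_holo_compose [OF J op(1) A [OF that] op_holo_scal [OF J op(1) FR]])
  have BG: "op_holo J R (\<lambda>z. B i z \<odot> scal J (G z))" if "i \<in> I" for i
    by (rule op_holo_compose [OF J op(1) B [OF that] op_holo_scal [OF J op(1) GR]])
  have HF: "op_holo J R (\<lambda>z. H z \<odot> scal J (F z * G z))"
    by (rule op_holo_compose [OF J op(1) H op_holo_scal [OF J op(1)]]) (intro holomorphic_intros FR GR)
  define P where "P i = path_int J \<Gamma> (\<lambda>z. A i z \<odot> scal J (F z))" for i
  have P: "op_commute (P i) (lop J)" if "i \<in> I" for i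
    unfolding P_def by (rule path_int_commute_unit [OF \<Gamma>]) (use AF [OF that] in \<open>simp add: R_def\<close>)
  define \<Psi> where "\<Psi> \<eta> = (\<Sum>i\<in>I. P i \<odot> B i \<eta>)" for \<eta>
  have \<Psi>: "op_holo J R \<Psi>"
    unfolding \<Psi>_def by (intro op_holo_sum I op_holo_compose J op op_holo_const P B)
  have \<Psi>G: "op_holo J R (\<lambda>z. \<Psi> z \<odot> scal J (G z))"
    by (rule op_holo_compose [OF J op(1) \<Psi> op_holo_scal [OF J op(1) GR]])
  have hol: "(\<lambda>z. L (\<Psi> z)) holomorphic_on R" "(\<lambda>z. L (H z)) holomorphic_on R"
    by (rule op_holo_slice_functional [OF _ op(1) L], fact)+
  define c where "c = - \<i> / (2 * pi)"
  have c: "c * (2 * pi * \<i>) = 1" by (simp add: c_def)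
  \<comment> \<open>On \<open>R\<close> the function \<open>\<phi>\<close> is the integrated left
    side minus the expected term \<open>H F\<close>. Its candidate continuation
    \<open>\<theta>\<close> evaluates \<open>H\<close> on the contour only, hence is defined on the
    spectrum too.\<close>
  define \<phi> where "\<phi> \<eta> = L (\<Psi> \<eta>) - L (H \<eta>) * F \<eta>" for \<eta>
  define \<theta> where "\<theta> \<eta> = - c * (\<Sum>\<gamma>\<in>\<Gamma>. contour_integral \<gamma> (\<lambda>\<zeta>. L (H \<zeta>) * F \<zeta> / (\<zeta> - \<eta>)))" for \<eta>
  have \<phi>: "\<phi> holomorphic_on R" unfolding \<phi>_def by (intro holomorphic_intros hol FR)
  have \<theta>: "\<theta> holomorphic_on U"
    unfolding \<theta>_def
  proof (intro holomorphic_intros)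
    fix \<gamma> assume \<gamma>: "\<gamma> \<in> \<Gamma>"
    have "continuous_on (path_image \<gamma>) (\<lambda>\<zeta>. L (H \<zeta>) * F \<zeta>)"
      by (rule holomorphic_on_imp_continuous_on, rule holomorphic_on_subset [OF _ curves(4) [OF \<gamma>]])
        (intro holomorphic_intros hol FR)
    from Cauchy_type_integral_holomorphic [OF curves(2) [OF \<gamma>] this]
    show "(\<lambda>\<eta>. contour_integral \<gamma> (\<lambda>\<zeta>. L (H \<zeta>) * F \<zeta> / (\<zeta> - \<eta>))) holomorphic_on U"
      by (rule holomorphic_on_subset) (use off [OF \<gamma>] in blast)
  qed
  \<comment> \<open>Dividing the kernel identity by \<open>\<zeta> - \<eta>\<close> leaves two
    Cauchy integrals. The one with the constant \<open>L (H \<eta>)\<close> is evaluated by Cauchy's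
    formula for \<open>F\<close>, as the contour winds once around \<open>\<eta>\<close>; the other
    one is \<open>\<theta>\<close>.\<close>
  have agree: "\<phi> \<eta> = \<theta> \<eta>" if "\<eta> \<in> U" "\<eta> \<in> R" for \<eta>
  proof -
    have off': "\<eta> \<notin> path_image \<gamma>" if "\<gamma> \<in> \<Gamma>" for \<gamma> using off [OF that] \<open>\<eta> \<in> U\<close> by blast
    have eq: "A i \<zeta> \<odot> scal J (F \<zeta>) \<odot> B i \<eta> = A i \<zeta> \<odot> B i \<eta> \<odot> scal J (F \<zeta>)" if "i \<in> I" for i \<zeta>
      using op_commute_scal [OF op_holo_commute [OF B [OF that] \<open>\<eta> \<in> R\<close>], of "F \<zeta>"]
      by (simp add: op_assoc op_commute_def)
    have AB: "op_holo J R (\<lambda>\<zeta>. A i \<zeta> \<odot> B i \<eta> \<odot> scal J (F \<zeta>))" if "i \<in> I" for i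
      by (intro op_holo_compose J op A [OF that] op_holo_const op_holo_scal FR op_holo_commute [OF B [OF that] \<open>\<eta> \<in> R\<close>])
    have "\<Psi> \<eta> = (\<Sum>i\<in>I. path_int J \<Gamma> (\<lambda>\<zeta>. A i \<zeta> \<odot> B i \<eta> \<odot> scal J (F \<zeta>)))"
      unfolding \<Psi>_def P_def
    proof (rule sum.cong [OF refl])
      fix i assume i: "i \<in> I"
      show "path_int J \<Gamma> (\<lambda>z. A i z \<odot> scal J (F z)) \<odot> B i \<eta> = path_int J \<Gamma> (\<lambda>\<zeta>. A i \<zeta> \<odot> B i \<eta> \<odot> scal J (F \<zeta>))"
        using path_int_right [OF curves(2) cont [OF AF [OF i]] op_holo_commute [OF B [OF i] \<open>\<eta> \<in> R\<close>]]
        by (simp add: eq [OF i])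
    qed
    also have "\<dots> = path_int J \<Gamma> (\<lambda>\<zeta>. \<Sum>i\<in>I. A i \<zeta> \<odot> B i \<eta> \<odot> scal J (F \<zeta>))"
      by (rule path_int_sum [symmetric]) (use curves(2) I cont [OF AB] in auto)
    finally have "L (\<Psi> \<eta>) = c * (\<Sum>\<gamma>\<in>\<Gamma>. contour_integral \<gamma> (\<lambda>\<zeta>. L (\<Sum>i\<in>I. A i \<zeta> \<odot> B i \<eta> \<odot> scal J (F \<zeta>))))"
      using Lint [OF op_holo_sum [OF I AB]] by (simp add: c_def)
    also have "(\<Sum>\<gamma>\<in>\<Gamma>. contour_integral \<gamma> (\<lambda>\<zeta>. L (\<Sum>i\<in>I. A i \<zeta> \<odot> B i \<eta> \<odot> scal J (F \<zeta>)))) =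
      (\<Sum>\<gamma>\<in>\<Gamma>. L (H \<eta>) * contour_integral \<gamma> (\<lambda>\<zeta>. F \<zeta> / (\<zeta> - \<eta>)) - contour_integral \<gamma> (\<lambda>\<zeta>. L (H \<zeta>) * F \<zeta> / (\<zeta> - \<eta>)))"
    proof (rule sum.cong [OF refl])
      fix \<gamma> assume \<gamma>: "\<gamma> \<in> \<Gamma>"
      have \<gamma>R: "path_image \<gamma> \<subseteq> R - {\<eta>}" using curves(4) [OF \<gamma>] off' [OF \<gamma>] by blast
      have oR: "open (R - {\<eta>})" using op by (simp add: open_delete)
      have "(\<lambda>\<zeta>. F \<zeta> / (\<zeta> - \<eta>)) holomorphic_on R - {\<eta>}"
        "(\<lambda>\<zeta>. L (H \<zeta>) * F \<zeta> / (\<zeta> - \<eta>)) holomorphic_on R - {\<eta>}"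
        by (auto intro!: holomorphic_intros holomorphic_on_subset [OF FR] holomorphic_on_subset [OF hol(2)])
      then have int: "(\<lambda>\<zeta>. F \<zeta> / (\<zeta> - \<eta>)) contour_integrable_on \<gamma>"
        "(\<lambda>\<zeta>. L (H \<zeta>) * F \<zeta> / (\<zeta> - \<eta>)) contour_integrable_on \<gamma>"
        using contour_integrable_holomorphic_simple [OF _ oR curves(3) [OF \<gamma>] \<gamma>R] by blast+
      have "contour_integral \<gamma> (\<lambda>\<zeta>. L (\<Sum>i\<in>I. A i \<zeta> \<odot> B i \<eta> \<odot> scal J (F \<zeta>))) =
        contour_integral \<gamma> (\<lambda>\<zeta>. L (H \<eta>) * (F \<zeta> / (\<zeta> - \<eta>)) - L (H \<zeta>) * F \<zeta> / (\<zeta> - \<eta>))"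
      proof (rule contour_integral_eq)
        fix \<zeta> assume "\<zeta> \<in> path_image \<gamma>"
        then have \<zeta>: "\<zeta> \<in> R" "\<zeta> \<noteq> \<eta>" using \<gamma>R by auto
        have "(\<eta> - \<zeta>) * L (\<Sum>i\<in>I. A i \<zeta> \<odot> B i \<eta>) = L (H \<zeta>) - L (H \<eta>)"
          using kernel [of \<zeta> \<eta>] \<zeta> \<open>\<eta> \<in> R\<close> by (simp add: R_def linear_diff [OF lin] flip: sc)
        then have "L (\<Sum>i\<in>I. A i \<zeta> \<odot> B i \<eta>) = (L (H \<eta>) - L (H \<zeta>)) / (\<zeta> - \<eta>)"
          using \<zeta>(2) by (simp add: field_simps)
        moreover have "L (\<Sum>i\<in>I. A i \<zeta> \<odot> B i \<eta> \<odot> scal J (F \<zeta>)) = F \<zeta> * L (\<Sum>i\<in>I. A i \<zeta> \<odot> B i \<eta>)"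
          by (simp add: linear_sum [OF lin] sum_distrib_left sc flip: op_assoc)
        ultimately have "L (\<Sum>i\<in>I. A i \<zeta> \<odot> B i \<eta> \<odot> scal J (F \<zeta>)) = F \<zeta> * ((L (H \<eta>) - L (H \<zeta>)) / (\<zeta> - \<eta>))"
          by simp
        also have "\<dots> = L (H \<eta>) * (F \<zeta> / (\<zeta> - \<eta>)) - L (H \<zeta>) * F \<zeta> / (\<zeta> - \<eta>)"
          by (simp add: diff_divide_distrib right_diff_distrib mult.commute)
        finally show "L (\<Sum>i\<in>I. A i \<zeta> \<odot> B i \<eta> \<odot> scal J (F \<zeta>)) =
           L (H \<eta>) * (F \<zeta> / (\<zeta> - \<eta>)) - L (H \<zeta>) * F \<zeta> / (\<zeta> - \<eta>)" .
      qed
      also have "\<dots> = L (H \<eta>) * contour_integral \<gamma> (\<lambda>\<zeta>. F \<zeta> / (\<zeta> - \<eta>)) - contour_integral \<gamma> (\<lambda>\<zeta>. L (H \<zeta>) * F \<zeta> / (\<zeta> - \<eta>))"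
        using int by (simp add: contour_integral_diff contour_integrable_lmul contour_integral_lmul del: times_divide_eq_right)
      finally show "contour_integral \<gamma> (\<lambda>\<zeta>. L (\<Sum>i\<in>I. A i \<zeta> \<odot> B i \<eta> \<odot> scal J (F \<zeta>))) = \<dots>" .
    qed
    also have "c * \<dots> = L (H \<eta>) * (c * (\<Sum>\<gamma>\<in>\<Gamma>. contour_integral \<gamma> (\<lambda>\<zeta>. F \<zeta> / (\<zeta> - \<eta>)))) + \<theta> \<eta>"
      by (simp add: \<theta>_def sum_subtractf algebra_simps flip: sum_distrib_left)
    also have "c * (\<Sum>\<gamma>\<in>\<Gamma>. contour_integral \<gamma> (\<lambda>\<zeta>. F \<zeta> / (\<zeta> - \<eta>))) = F \<eta>"
    proof -
      have "(\<Sum>\<gamma>\<in>\<Gamma>. contour_integral \<gamma> (\<lambda>\<zeta>. F \<zeta> / (\<zeta> - \<eta>))) =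
        2 * pi * \<i> * (\<Sum>\<gamma>\<in>\<Gamma>. winding_number \<gamma> \<eta>) * F \<eta>"
      proof (rule Cauchy_integral_formula_cycle [OF op(2) F curves(1)])
        show "path_image \<gamma> \<subseteq> S - {\<eta>}" if "\<gamma> \<in> \<Gamma>" for \<gamma>
          using curves(4) [OF that] RS off' [OF that] by blast
      qed (use curves loop encloses_winding(2) [OF U(4)] U(3) \<open>\<eta> \<in> U\<close> in auto)
      then show ?thesis
        using encloses_winding(1) [OF U(4) \<open>\<eta> \<in> U\<close>] c by (metis mult.assoc mult_1 mult_1_right)
    qed
    finally show ?thesis by (simp add: \<phi>_def)
  qed
  \<comment> \<open>The spectrum lies in \<open>U\<close>, so \<open>U\<close> and \<open>R\<close>
    cover \<open>S\<close> and the glued function is holomorphic on all of it. The curves avoid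
    \<open>U\<close>, hence meet only the branch \<open>\<phi>\<close>.\<close>
  define \<psi> where "\<psi> \<eta> = (if \<eta> \<in> U then \<theta> \<eta> else \<phi> \<eta>)" for \<eta>
  have "\<psi> holomorphic_on U \<union> R"
    unfolding \<psi>_def by (rule holomorphic_on_If_Un) (use \<theta> \<phi> U(1) op agree in auto)
  then have \<psi>: "(\<lambda>z. \<psi> z * G z) holomorphic_on S" unfolding SU by (intro holomorphic_intros G)
  have "(\<Sum>\<gamma>\<in>\<Gamma>. contour_integral \<gamma> (\<lambda>z. \<psi> z * G z)) = 0"
    by (rule Cauchy_theorem_cycle [OF op(2) \<psi> curves(1)])
      (use curves RS loop encloses_winding(2) [OF U(4)] in blast)+
  moreover have "contour_integral \<gamma> (\<lambda>z. \<psi> z * G z) =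
      contour_integral \<gamma> (\<lambda>z. L (\<Psi> z \<odot> scal J (G z))) - contour_integral \<gamma> (\<lambda>z. L (H z \<odot> scal J (F z * G z)))"
    if \<gamma>: "\<gamma> \<in> \<Gamma>" for \<gamma>
  proof -
    have "contour_integral \<gamma> (\<lambda>z. \<psi> z * G z) =
      contour_integral \<gamma> (\<lambda>z. L (\<Psi> z \<odot> scal J (G z)) - L (H z \<odot> scal J (F z * G z)))"
      by (rule contour_integral_eq) (use off [OF \<gamma>] in \<open>auto simp: \<psi>_def \<phi>_def sc algebra_simps\<close>)
    also have "\<dots> = contour_integral \<gamma> (\<lambda>z. L (\<Psi> z \<odot> scal J (G z))) - contour_integral \<gamma> (\<lambda>z. L (H z \<odot> scal J (F z * G z)))"
      by (intro contour_integral_diff contour_integrable_holomorphic_simple [OF _ op(1) curves(3,4) [OF \<gamma>]]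
          op_holo_slice_functional [OF _ op(1) L] \<Psi>G HF)
    finally show ?thesis .
  qed
  ultimately have "(\<Sum>\<gamma>\<in>\<Gamma>. contour_integral \<gamma> (\<lambda>z. L (\<Psi> z \<odot> scal J (G z)))) =
      (\<Sum>\<gamma>\<in>\<Gamma>. contour_integral \<gamma> (\<lambda>z. L (H z \<odot> scal J (F z * G z))))"
    by (simp add: sum_subtractf)
  then have "L (path_int J \<Gamma> (\<lambda>z. \<Psi> z \<odot> scal J (G z))) = L (path_int J \<Gamma> (\<lambda>z. H z \<odot> scal J (F z * G z)))"
    by (simp only: Lint [OF \<Psi>G] Lint [OF HF])
  moreover have "path_int J \<Gamma> (\<lambda>z. \<Psi> z \<odot> scal J (G z)) =
    (\<Sum>i\<in>I. path_int J \<Gamma> (\<lambda>z. A i z \<odot> scal J (F z)) \<odot> path_int J \<Gamma> (\<lambda>z. B i z \<odot> scal J (G z)))"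
  proof -
    have PB: "continuous_on_paths \<Gamma> (\<lambda>z. P i \<odot> (B i z \<odot> scal J (G z)))" if "i \<in> I" for i
      by (intro cont op_holo_compose J op op_holo_const P B op_holo_scal GR that)
    have "path_int J \<Gamma> (\<lambda>z. \<Psi> z \<odot> scal J (G z)) = path_int J \<Gamma> (\<lambda>z. \<Sum>i\<in>I. P i \<odot> (B i z \<odot> scal J (G z)))"
      by (simp add: \<Psi>_def op_sum_left op_assoc)
    also have "\<dots> = (\<Sum>i\<in>I. path_int J \<Gamma> (\<lambda>z. P i \<odot> (B i z \<odot> scal J (G z))))"
      by (rule path_int_sum) (use curves(2) I PB in auto)
    also have "\<dots> = (\<Sum>i\<in>I. P i \<odot> path_int J \<Gamma> (\<lambda>z. B i z \<odot> scal J (G z)))"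
      by (intro sum.cong refl path_int_left curves(2) cont BG)
    finally show ?thesis by (simp add: P_def)
  qed
  ultimately show "L (\<Sum>i\<in>I. path_int J \<Gamma> (\<lambda>z. A i z \<odot> scal J (F z)) \<odot> path_int J \<Gamma> (\<lambda>z. B i z \<odot> scal J (G z))) =
    L (path_int J \<Gamma> (\<lambda>z. H z \<odot> scal J (F z * G z)))" by simp
qed

end

section \<open>Operators with commuting components\<close>

lemma real_op_compose: "real_op (a o\<^sub>L b) = real_op a \<odot> real_op b"
  by (rule blinfun_eqI) (auto simp: real_op.rep_eq)

lemma real_op_commute_lop: "op_commute (lop q) (real_op a)"
  unfolding op_commute_def
  by (rule blinfun_eqI)
    (auto simp: real_op.rep_eq lop.rep_eq lmult_def blinfun.add_right blinfun.diff_right blinfun.scaleR_right)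

lemma real_op_commute: "a o\<^sub>L b = b o\<^sub>L a \<Longrightarrow> op_commute (real_op a) (real_op b)"
  by (simp add: op_commute_def flip: real_op_compose)

lemma lop_units:
  "lop e1 \<odot> lop e1 = - id_blinfun" "lop e2 \<odot> lop e2 = - id_blinfun" "lop e3 \<odot> lop e3 = - id_blinfun"
  "lop e1 \<odot> lop e2 = lop e3" "lop e2 \<odot> lop e3 = lop e1" "lop e3 \<odot> lop e1 = lop e2"
  "lop e2 \<odot> lop e1 = - lop e3" "lop e3 \<odot> lop e2 = - lop e1" "lop e1 \<odot> lop e3 = - lop e2"
proof -
  have "e2 * e1 = - e3" "e3 * e2 = - e1" "e1 * e3 = - e2"
    by (simp_all add: e1_def e2_def e3_def quat_eq_iff)
  then show
    "lop e1 \<odot> lop e1 = - id_blinfun" "lop e2 \<odot> lop e2 = - id_blinfun" "lop e3 \<odot> lop e3 = - id_blinfun"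
    "lop e1 \<odot> lop e2 = lop e3" "lop e2 \<odot> lop e3 = lop e1" "lop e3 \<odot> lop e1 = lop e2"
    "lop e2 \<odot> lop e1 = - lop e3" "lop e3 \<odot> lop e2 = - lop e1" "lop e1 \<odot> lop e3 = - lop e2"
    by (simp_all add: quat_units lop_minus flip: lop_mult)
qed

lemma op_left: "a \<odot> b = c \<Longrightarrow> a \<odot> (b \<odot> x) = c \<odot> x"
  by (simp flip: op_assoc)

text \<open>Since right linearity passes to inverses, these may be sought among all bounded
  operators.\<close>

lemma BX_inverse:
  assumes "A \<in> BX" "A \<odot> B = id_blinfun" "B \<odot> A = id_blinfun"
  shows "B \<in> BX"
  unfolding BX_def
proof (intro CollectI allI)
  fix x q
  have AB: "A (B x) = x" "B (A x) = x" for x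
    using assms(2,3) by (metis blinfun_apply_blinfun_compose blinfun_apply_id_blinfun)+
  have "A (rmult (B x) q) = rmult (A (B x)) q" using assms(1) unfolding BX_def by blast
  also have "A (B x) = x" by (rule AB)
  finally have "B (A (rmult (B x) q)) = B (rmult x q)" by (rule arg_cong)
  then show "B (rmult x q) = rmult (B x) q" by (simp only: AB(2))
qed

lemma op_inverse_unique:
  assumes "A \<odot> B = id_blinfun" "C \<odot> A = id_blinfun"
  shows "C = B"
proof -
  have "C = C \<odot> (A \<odot> B)" using assms(1) by simp
  also have "\<dots> = B" using assms(2) by (simp flip: op_assoc)
  finally show ?thesis .
qed

lemma op_inv_eq: "inverse_in_BX A B \<Longrightarrow> op_inv A = B"
  unfolding op_inv_def by (rule the_equality) (auto simp: inverse_in_BX_def intro: op_inverse_unique)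

text \<open>On \<open>\<B>(X)\<close> this is the quaternionic conjugation of the components. It reverses the order of
  products with the units, whatever the second factor.\<close>

definition conj_map :: "'a::real_normed_vector quat_op \<Rightarrow> 'a quat_op" where
  "conj_map S = (- 1 / 2) *\<^sub>R (S + lop e1 \<odot> S \<odot> lop e1 + lop e2 \<odot> S \<odot> lop e2 + lop e3 \<odot> S \<odot> lop e3)"

lemma conj_map_id [simp]: "conj_map id_blinfun = id_blinfun"
proof -
  have "conj_map (id_blinfun :: 'a quat_op) = (- 1 / 2) *\<^sub>R ((- 2) *\<^sub>R id_blinfun)"
    unfolding conj_map_def by (simp add: lop_units scaleR_2)
  then show ?thesis by simp
qed

lemma conj_map_add: "conj_map (S + S') = conj_map S + conj_map S'"
  unfolding conj_map_def by (simp add: op_distrib scaleR_add_right)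

lemma conj_map_unit_left:
  "conj_map (lop e1 \<odot> S) = - (conj_map S \<odot> lop e1)"
  "conj_map (lop e2 \<odot> S) = - (conj_map S \<odot> lop e2)"
  "conj_map (lop e3 \<odot> S) = - (conj_map S \<odot> lop e3)"
  unfolding conj_map_def
  by (simp_all add: op_distrib op_assoc lop_units lop_units [THEN op_left] scaleR_add_right scaleR_diff_right)

lemma conj_map_unit_right:
  "conj_map (S \<odot> lop e1) = - (lop e1 \<odot> conj_map S)"
  "conj_map (S \<odot> lop e2) = - (lop e2 \<odot> conj_map S)"
  "conj_map (S \<odot> lop e3) = - (lop e3 \<odot> conj_map S)"
  unfolding conj_map_def
  by (simp_all add: op_distrib op_assoc lop_units lop_units [THEN op_left] scaleR_add_right scaleR_diff_right)

lemma conj_map_real_left: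
  assumes "\<And>q. op_commute (lop q) b"
  shows "conj_map (b \<odot> S) = b \<odot> conj_map S"
proof -
  have b: "lop q \<odot> (b \<odot> x) = b \<odot> (lop q \<odot> x)" for q and x :: "'a quat_op"
    using assms [of q] by (simp add: op_commute_def flip: op_assoc)
  show ?thesis unfolding conj_map_def by (simp add: op_distrib op_assoc b)
qed

lemma op_commute_conj_map:
  assumes "\<And>q. op_commute (lop q) b" "op_commute b S"
  shows "op_commute b (conj_map S)"
  unfolding conj_map_def
  by (intro op_commute_intros op_commute_sym [OF assms(1)] assms(2))

text \<open>Conjugation reverses products with the units, so it takes \<open>M \<odot> B\<close> to
  \<open>conj_map B \<odot> N\<close> and \<open>B \<odot> M\<close> to
  \<open>N \<odot> conj_map B\<close>. The coefficients of \<open>M\<close> can be moved into place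
  because they commute with \<open>B\<close>.\<close>

lemma conj_inverse:
  assumes real: "\<And>q. op_commute (lop q) b0" "\<And>q. op_commute (lop q) b1" "\<And>q. op_commute (lop q) b2" "\<And>q. op_commute (lop q) b3"
    and comm: "op_commute b0 B" "op_commute b1 B" "op_commute b2 B" "op_commute b3 B"
    and M: "M = b0 + b1 \<odot> lop e1 + b2 \<odot> lop e2 + b3 \<odot> lop e3"
    and N: "N = b0 - b1 \<odot> lop e1 - b2 \<odot> lop e2 - b3 \<odot> lop e3"
    and inv: "M \<odot> B = id_blinfun" "B \<odot> M = id_blinfun"
  shows "N \<odot> conj_map B = id_blinfun" "conj_map B \<odot> N = id_blinfun"
proof -
  note c = op_commute_conj_map [OF real(1) comm(1)] op_commute_conj_map [OF real(2) comm(2)]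
    op_commute_conj_map [OF real(3) comm(3)] op_commute_conj_map [OF real(4) comm(4)]
  have cB: "conj_map B \<odot> b0 = b0 \<odot> conj_map B" "conj_map B \<odot> (b1 \<odot> x) = b1 \<odot> (conj_map B \<odot> x)"
    "conj_map B \<odot> (b2 \<odot> x) = b2 \<odot> (conj_map B \<odot> x)" "conj_map B \<odot> (b3 \<odot> x) = b3 \<odot> (conj_map B \<odot> x)" for x
    using c by (simp_all add: op_commute_def flip: op_assoc)
  have Bb: "B \<odot> b0 = b0 \<odot> B" "B \<odot> (b1 \<odot> x) = b1 \<odot> (B \<odot> x)"
    "B \<odot> (b2 \<odot> x) = b2 \<odot> (B \<odot> x)" "B \<odot> (b3 \<odot> x) = b3 \<odot> (B \<odot> x)" for x
    using comm by (simp_all add: op_commute_def flip: op_assoc)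
  have "conj_map (M \<odot> B) = conj_map B \<odot> N"
    unfolding M N by (simp add: op_distrib op_assoc conj_map_add conj_map_unit_left cB
        conj_map_real_left [OF real(1)] conj_map_real_left [OF real(2)] conj_map_real_left [OF real(3)] conj_map_real_left [OF real(4)])
  then show "conj_map B \<odot> N = id_blinfun" by (simp add: inv)
  have "conj_map (B \<odot> M) = N \<odot> conj_map B"
    unfolding M N by (simp add: op_distrib op_assoc conj_map_add conj_map_unit_right Bb
        conj_map_real_left [OF real(1)] conj_map_real_left [OF real(2)] conj_map_real_left [OF real(3)] conj_map_real_left [OF real(4)])
  then show "N \<odot> conj_map B = id_blinfun" by (simp add: inv)
qed

section \<open>Invertibility of \<open>Q_c\<close> and openness of the S-resolvent set\<close>

locale commuting_op =
  fixes T :: "'a::banach quat_op"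
  assumes T_BCX: "T \<in> BCX"
begin

abbreviation A where "A \<equiv> real_part T"
abbreviation Y where "Y \<equiv> vec_part T"
definition W where "W = - (Y \<odot> Y)"

abbreviation Y1 where "Y1 \<equiv> real_op (comp1 T)"
abbreviation Y2 where "Y2 \<equiv> real_op (comp2 T)"
abbreviation Y3 where "Y3 \<equiv> real_op (comp3 T)"

lemma T_eq: "T = A + Y" "conj_op T = A - Y"
proof -
  obtain T0 T1 T2 T3 where "T = quat_op T0 T1 T2 T3" using T_BCX unfolding BCX_def by blast
  then show "T = A + Y"
    by (simp add: real_part_def vec_part_def comp_quat_op) (simp add: quat_op_def)
qed (simp add: conj_op_def)

lemma real_commute [simp]:
  "op_commute (lop q) A" "op_commute (lop q) Y1" "op_commute (lop q) Y2" "op_commute (lop q) Y3"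
  unfolding real_part_def by (rule real_op_commute_lop)+

lemma components_commute [simp]:
  "op_commute A Y1" "op_commute A Y2" "op_commute A Y3"
  "op_commute Y1 Y2" "op_commute Y1 Y3" "op_commute Y2 Y3"
  using T_BCX unfolding BCX_def real_part_def
  by (auto simp: comp_quat_op intro: real_op_commute)

lemma A_Y_commute: "op_commute A Y"
  unfolding vec_part_def by (intro op_commute_intros components_commute op_commute_sym [OF real_commute(1)])

text \<open>The mixed terms of \<open>Y \<odot> Y\<close> cancel: the units anticommute while the
  components commute.\<close>

lemma W_eq: "W = Y1 \<odot> Y1 + Y2 \<odot> Y2 + Y3 \<odot> Y3"
proof -
  have e: "lop q \<odot> Y1 = Y1 \<odot> lop q" "lop q \<odot> Y2 = Y2 \<odot> lop q" "lop q \<odot> Y3 = Y3 \<odot> lop q" for q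
    using real_commute by (simp_all add: op_commute_def)
  have y: "Y2 \<odot> Y1 = Y1 \<odot> Y2" "Y3 \<odot> Y1 = Y1 \<odot> Y3" "Y3 \<odot> Y2 = Y2 \<odot> Y3"
    using components_commute by (simp_all add: op_commute_def)
  show ?thesis
    unfolding W_def vec_part_def
    by (simp add: op_distrib op_assoc lop_units e [THEN op_left] e y y [THEN op_left])
qed

lemma W_real [simp]: "op_commute (lop q) W"
  unfolding W_eq by (intro op_commute_intros real_commute)

lemma A_W_commute: "op_commute A W"
  unfolding W_def by (intro op_commute_intros A_Y_commute)

abbreviation Z where "Z s \<equiv> lop s - A"

text \<open>Completing the square: \<open>T + conj_op T\<close> is twice \<open>A\<close>, and
  \<open>T \<odot> conj_op T\<close> is \<open>A \<odot> A + W\<close>.\<close>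

lemma Q_c_eq: "Q_c s T = Z s \<odot> Z s + W"
proof -
  have "A \<odot> lop s = lop s \<odot> A" "Y \<odot> A = A \<odot> Y" using real_commute(1) A_Y_commute by (simp_all add: op_commute_def)
  moreover have "T + conj_op T = (A + Y) + (A - Y)" "T \<odot> conj_op T = (A + Y) \<odot> (A - Y)"
    by (simp_all only: T_eq(2) flip: T_eq(1))
  ultimately show ?thesis
    unfolding Q_c_def by (simp add: W_def lop_mult op_distrib)
qed

lemma A_BX: "A \<in> BX" and Y_BX: "Y \<in> BX"
  unfolding real_part_def vec_part_def by (intro BX_add BX_compose real_op_in_BX lop_in_BX)+

lemma BX_scaleR: "(S :: 'a quat_op) \<in> BX \<Longrightarrow> r *\<^sub>R S \<in> BX"
proof -
  assume "S \<in> BX"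
  have r: "rmult (r *\<^sub>R x) q = r *\<^sub>R rmult x q" for x :: "'a quat_module" and q
    by (cases x) (simp add: rmult_def algebra_simps)
  from \<open>S \<in> BX\<close> show ?thesis
    unfolding BX_def by (simp only: mem_Collect_eq blinfun.scaleR_left r simp_thms)
qed

lemma Q_c_BX: "Q_c s T \<in> BX"
proof -
  have "Z s \<in> BX" using BX_add [OF lop_in_BX BX_scaleR [OF A_BX, of "-1"]] by simp
  moreover have "W \<in> BX" using BX_scaleR [OF BX_compose [OF Y_BX Y_BX], of "-1"] by (simp add: W_def)
  ultimately show ?thesis unfolding Q_c_eq by (intro BX_add BX_compose)
qed

text \<open>The operator whose inverse defines the S-resolvent set; \<open>M_conj\<close> is the
  same real polynomial in the conjugate of \<open>T\<close>. Below, \<open>coeff0\<close> and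
  \<open>coeff1\<close> collect the parts of even and odd degree in \<open>Y\<close>, using
  \<open>Y \<odot> Y = - W\<close>.\<close>

definition M where "M s = T \<odot> T - (2 * q0 s) *\<^sub>R T + (norm s)\<^sup>2 *\<^sub>R id_blinfun"
definition M_conj where "M_conj s = (A - Y) \<odot> (A - Y) - (2 * q0 s) *\<^sub>R (A - Y) + (norm s)\<^sup>2 *\<^sub>R id_blinfun"

definition coeff0 where "coeff0 s = A \<odot> A - W - (2 * q0 s) *\<^sub>R A + (norm s)\<^sup>2 *\<^sub>R id_blinfun"
definition coeff1 where "coeff1 s = 2 *\<^sub>R A - (2 * q0 s) *\<^sub>R id_blinfun"

lemma M_eq: "M s = coeff0 s + coeff1 s \<odot> Y" "M_conj s = coeff0 s - coeff1 s \<odot> Y"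
proof -
  have YA: "Y \<odot> A = A \<odot> Y" using A_Y_commute by (simp add: op_commute_def)
  show "M s = coeff0 s + coeff1 s \<odot> Y"
    unfolding M_def coeff0_def coeff1_def by (subst (1 2 3) T_eq(1)) (simp add: W_def op_distrib YA algebra_simps scaleR_2)
  show "M_conj s = coeff0 s - coeff1 s \<odot> Y"
    unfolding M_conj_def coeff0_def coeff1_def by (simp add: W_def op_distrib YA algebra_simps scaleR_2)
qed

text \<open>\<open>M s\<close> has real scalars only, so the components of \<open>T\<close> commute
  with it and therefore with its inverse \<open>B\<close>. This is the hypothesis of
  \<open>conj_inverse\<close>.\<close>

lemma M_conj_invertible:
  assumes B: "M s \<odot> B = id_blinfun" "B \<odot> M s = id_blinfun"
  shows "M_conj s \<odot> conj_map B = id_blinfun" "conj_map B \<odot> M_conj s = id_blinfun"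
proof -
  have nY: "coeff1 s \<odot> Y = (coeff1 s \<odot> Y1) \<odot> lop e1 + (coeff1 s \<odot> Y2) \<odot> lop e2 + (coeff1 s \<odot> Y3) \<odot> lop e3"
    by (simp add: vec_part_def op_distrib op_assoc)
  have real: "op_commute (lop q) (coeff0 s)" "op_commute (lop q) (coeff1 s \<odot> Y1)" "op_commute (lop q) (coeff1 s \<odot> Y2)" "op_commute (lop q) (coeff1 s \<odot> Y3)" for q
    unfolding coeff0_def coeff1_def by (intro op_commute_intros real_commute W_real op_commute_simps)+
  have commB: "op_commute S B" if "op_commute S (M s)" for S
    using op_inverse_commute [OF B _ B, of S] that by (simp add: op_commute_def)
  have A_M: "op_commute A (M s)"
    unfolding M_def by (subst (1 2 3) T_eq(1)) (intro op_commute_intros A_Y_commute op_commute_simps)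
  have Y_M: "op_commute Y1 (M s)" "op_commute Y2 (M s)" "op_commute Y3 (M s)"
    unfolding M_def vec_part_def
    by (subst (1 2 3) T_eq(1), unfold vec_part_def, intro op_commute_intros op_commute_simps components_commute
        op_commute_sym [OF components_commute(1)] op_commute_sym [OF components_commute(2)]
        op_commute_sym [OF components_commute(3)] op_commute_sym [OF components_commute(4)]
        op_commute_sym [OF components_commute(5)] op_commute_sym [OF components_commute(6)]
        op_commute_sym [OF real_commute(2)] op_commute_sym [OF real_commute(3)] op_commute_sym [OF real_commute(4)])+
  have AB: "op_commute B A" "op_commute B Y1" "op_commute B Y2" "op_commute B Y3"
    using commB A_M Y_M op_commute_sym by blast+
  have "op_commute B (coeff0 s)" "op_commute B (coeff1 s \<odot> Y1)" "op_commute B (coeff1 s \<odot> Y2)" "op_commute B (coeff1 s \<odot> Y3)"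
    unfolding coeff0_def coeff1_def W_eq by (intro op_commute_intros AB op_commute_simps)+
  then have comm: "op_commute (coeff0 s) B" "op_commute (coeff1 s \<odot> Y1) B" "op_commute (coeff1 s \<odot> Y2) B" "op_commute (coeff1 s \<odot> Y3) B"
    using op_commute_sym by blast+
  show "M_conj s \<odot> conj_map B = id_blinfun" "conj_map B \<odot> M_conj s = id_blinfun"
    by (rule conj_inverse [OF real comm _ _ B]; simp add: M_eq nY algebra_simps)+
qed

text \<open>All products below equal \<open>coeff0\<^sup>2 + coeff1\<^sup>2 W\<close>.\<close>

lemma Q_c_Q_c_conj:
  fixes s :: quat
  defines "s' \<equiv> of_real (2 * q0 s) - s"
  shows "Q_c s T \<odot> Q_c s' T = M s \<odot> M_conj s" "Q_c s' T \<odot> Q_c s T = M s \<odot> M_conj s"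
proof -
  define z where "z = Z s"
  have A: "lop q \<odot> A = A \<odot> lop q" and W: "W \<odot> A = A \<odot> W" "Y \<odot> A = A \<odot> Y" and WY: "W \<odot> Y = Y \<odot> W" for q
    using real_commute(1) A_W_commute A_Y_commute by (simp_all add: op_commute_def W_def op_distrib op_assoc)
  have Wl: "lop q \<odot> W = W \<odot> lop q" for q using W_real by (simp add: op_commute_def)
  have comm: "z \<odot> coeff1 s = coeff1 s \<odot> z" "z \<odot> coeff0 s = coeff0 s \<odot> z" "coeff0 s \<odot> coeff1 s = coeff1 s \<odot> coeff0 s" "z \<odot> W = W \<odot> z"
    "W \<odot> coeff1 s = coeff1 s \<odot> W" "Y \<odot> coeff1 s = coeff1 s \<odot> Y" "Y \<odot> coeff0 s = coeff0 s \<odot> Y"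
    unfolding z_def coeff1_def coeff0_def
    by (simp_all add: op_distrib op_assoc A A [THEN op_left] W W [THEN op_left] WY Wl algebra_simps)
  \<comment> \<open>The real quadratic equation of \<open>s\<close>, whose second root is the
    conjugate \<open>s'\<close>. It lowers the degree of \<open>Q_c\<close> in \<open>z\<close> to
    one.\<close>
  have ss: "s * s = (2 * q0 s) *\<^sub>R s - (norm s)\<^sup>2 *\<^sub>R 1"
    by (simp add: quat_eq_iff norm_quat_def inner_quat_def)
  have "lop s \<odot> lop s = (2 * q0 s) *\<^sub>R lop s - (norm s)\<^sup>2 *\<^sub>R (id_blinfun :: 'a quat_op)"
    using arg_cong [OF ss, of lop] by (simp add: lop_mult lop_diff lop_scaleR)
  then have zz: "z \<odot> z = - (coeff1 s \<odot> z) - (coeff0 s + W)"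
    unfolding z_def coeff1_def coeff0_def by (simp add: op_distrib A algebra_simps scaleR_2)
  have "lop s' = (2 * q0 s) *\<^sub>R id_blinfun - lop s"
    unfolding s'_def of_real_def by (simp only: lop_diff lop_scaleR lop_one)
  then have z': "Z s' = - coeff1 s - z" unfolding z_def coeff1_def by (simp add: scaleR_2)
  have Q: "Q_c s T = - (coeff1 s \<odot> z) - coeff0 s"
    unfolding Q_c_eq z_def [symmetric] zz by simp
  have Q': "Q_c s' T = coeff1 s \<odot> coeff1 s + coeff1 s \<odot> z - coeff0 s"
    unfolding Q_c_eq z' by (simp add: op_distrib comm zz)
  have MM: "M s \<odot> M_conj s = coeff0 s \<odot> coeff0 s + coeff1 s \<odot> (coeff1 s \<odot> W)"
    unfolding M_eq by (simp add: op_distrib op_assoc comm comm [THEN op_left] W_def)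
  show "Q_c s T \<odot> Q_c s' T = M s \<odot> M_conj s" "Q_c s' T \<odot> Q_c s T = M s \<odot> M_conj s"
    unfolding MM Q Q' by (simp_all add: op_distrib op_assoc comm comm [THEN op_left] zz zz [THEN op_left])
qed

text \<open>Links the definition of the resolvent set to the kernels. The invertible
  \<open>M s \<odot> M_conj s\<close> has \<open>Q_c s T\<close> as a factor on either side, which
  gives a right and a left inverse; these must coincide.\<close>

lemma Q_c_invertible:
  assumes "s \<in> S_resolvent_set T"
  shows "inverse_in_BX (Q_c s T) (op_inv (Q_c s T))"
proof -
  obtain B where B: "M s \<odot> B = id_blinfun" "B \<odot> M s = id_blinfun"
    using assms unfolding S_resolvent_set_def inverse_in_BX_def M_def by blast
  note C = M_conj_invertible [OF B]
  let ?Q' = "Q_c (of_real (2 * q0 s) - s) T"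
  define P where "P = conj_map B \<odot> B"
  have P: "M s \<odot> M_conj s \<odot> P = id_blinfun" "P \<odot> (M s \<odot> M_conj s) = id_blinfun"
    unfolding P_def using B C by (simp_all add: op_assoc C [THEN op_left] B [THEN op_left])
  have 1: "Q_c s T \<odot> (?Q' \<odot> P) = id_blinfun"
    using P(1) by (simp only: Q_c_Q_c_conj(1) flip: op_assoc)
  have 2: "P \<odot> ?Q' \<odot> Q_c s T = id_blinfun"
    using P(2) by (simp only: Q_c_Q_c_conj(2) op_assoc)
  have "P \<odot> ?Q' = ?Q' \<odot> P" by (rule op_inverse_unique [OF 1 2])
  then have "inverse_in_BX (Q_c s T) (?Q' \<odot> P)"
    using 1 2 BX_inverse [OF Q_c_BX 1] by (simp add: inverse_in_BX_def)
  then show ?thesis by (simp add: op_inv_eq)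
qed

lemma open_S_resolvent_set: "open (S_resolvent_set T)"
  unfolding open_subopen [of "S_resolvent_set T"]
proof (intro ballI)
  fix s assume "s \<in> S_resolvent_set T"
  then obtain B where B: "M s \<odot> B = id_blinfun" "B \<odot> M s = id_blinfun"
    unfolding S_resolvent_set_def inverse_in_BX_def M_def by blast
  \<comment> \<open>Puts the real part into a form for which continuity is known.\<close>
  have q0: "q0 x = inner x 1" for x :: quat by (simp add: inner_quat_def)
  have T_BX: "T \<in> BX" using BX_add [OF A_BX Y_BX] by (simp flip: T_eq(1))
  have "continuous_on UNIV (\<lambda>x. norm (M s - M x) * norm B)"
    unfolding M_def q0 by (intro continuous_intros)
  then have "open {x. norm (M s - M x) * norm B < 1}"
    by (rule open_Collect_less) (intro continuous_intros)
  moreover have "{x. norm (M s - M x) * norm B < 1} \<subseteq> S_resolvent_set T"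
  proof
    fix x assume "x \<in> {x. norm (M s - M x) * norm B < 1}"
    then obtain B' where B': "M x \<odot> B' = id_blinfun" "B' \<odot> M x = id_blinfun"
      using op_invertible_perturb [OF B, of "M x"] by auto
    have "M x \<in> BX"
    proof -
      have "id_blinfun \<in> BX" using lop_in_BX [of 1] by simp
      then have "T \<odot> T + (- (2 * q0 x)) *\<^sub>R T + (norm x)\<^sup>2 *\<^sub>R id_blinfun \<in> BX"
        by (intro BX_add BX_compose T_BX BX_scaleR)
      then show ?thesis by (simp add: M_def)
    qed
    then have "inverse_in_BX (M x) B'" using B' BX_inverse [OF _ B'] by (simp add: inverse_in_BX_def)
    then show "x \<in> S_resolvent_set T" unfolding S_resolvent_set_def M_def by blast
  qed
  ultimately show "\<exists>N. open N \<and> s \<in> N \<and> N \<subseteq> S_resolvent_set T"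
    by (intro exI [of _ "{x. norm (M s - M x) * norm B < 1}"]) simp
qed

end

section \<open>Axial symmetry of the S-spectrum\<close>

lemma imag_unit_components:
  assumes "J \<in> \<S>"
  shows "q0 J = 0" "norm J = 1"
proof -
  have J: "J * J = - 1" using assms by (simp add: imag_units_def)
  have eq: "q0 J * q0 J - q1 J * q1 J - q2 J * q2 J - q3 J * q3 J = - 1"
    "q0 J * q1 J = 0" "q0 J * q2 J = 0" "q0 J * q3 J = 0"
    using J by (auto simp: quat_eq_iff)
  show "q0 J = 0"
  proof (rule ccontr)
    assume "q0 J \<noteq> 0"
    then have "q0 J * q0 J = - 1" using eq by auto
    then show False using zero_le_square [of "q0 J"] by linarith
  qed
  have "(norm J)\<^sup>2 = norm (J * J)" by (simp add: norm_mult power2_eq_square)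
  also have "\<dots> = 1\<^sup>2" by (simp add: J)
  finally show "norm J = 1" by (rule power2_eq_imp_eq) auto
qed

text \<open>The defining operator depends on \<open>s\<close> only through its real part and its
  norm, which are the same for all units.\<close>

lemma axially_symmetric_S_spectrum: "axially_symmetric (S_spectrum T)"
proof -
  have *: "q0 (of_real u + J * of_real v) = u" "(norm (of_real u + J * of_real v))\<^sup>2 = u\<^sup>2 + v\<^sup>2" if "J \<in> \<S>" for J u v
  proof -
    note J = imag_unit_components [OF that]
    have JJ: "q1 J * q1 J + q2 J * q2 J + q3 J * q3 J = 1"
      using J by (simp add: norm_quat_def inner_quat_def)
    have c: "q0 (of_real u + J * of_real v) = u" "q1 (of_real u + J * of_real v) = v * q1 J"
       "q2 (of_real u + J * of_real v) = v * q2 J" "q3 (of_real u + J * of_real v) = v * q3 J"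
      using J by (simp_all add: of_real_def)
    show "q0 (of_real u + J * of_real v) = u" by fact
    have "(norm (of_real u + J * of_real v))\<^sup>2 = u\<^sup>2 + v\<^sup>2 * (q1 J * q1 J + q2 J * q2 J + q3 J * q3 J)"
      unfolding power2_norm_eq_inner inner_quat_def c by (simp add: algebra_simps power2_eq_square)
    then show "(norm (of_real u + J * of_real v))\<^sup>2 = u\<^sup>2 + v\<^sup>2" by (simp add: JJ)
  qed
  show ?thesis
    unfolding axially_symmetric_def S_spectrum_def S_resolvent_set_def
    by (simp add: * del: quat_vector_sel quat_algebra_sel)
qed

section \<open>Intrinsic functions\<close>

text \<open>Intrinsic functions are parametrised by functions on the plane that commute with complex
  conjugation. Such a function is real on the real axis, so the junk value \<open>0\<close> of the imaginary
  direction of a real number is harmless.\<close>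

definition lift :: "(complex \<Rightarrow> complex) \<Rightarrow> quat \<Rightarrow> quat" where
  "lift F s = (let v = s - of_real (q0 s); z = Complex (q0 s) (norm v) in
     of_real (Re (F z)) + (v /\<^sub>R norm v) * of_real (Im (F z)))"

text \<open>\<open>lift\<close> evaluates \<open>F\<close> in the closed upper half plane only.
  Below the real axis the direction is \<open>- J\<close> and the argument is conjugated, and the
  symmetry of \<open>F\<close> makes the two changes cancel.\<close>

lemma lift_slice_pt:
  assumes J: "J \<in> \<S>" and F: "F (cnj z) = cnj (F z)"
  shows "lift F (slice_pt J z) = slice_pt J (F z)"
proof -
  have q: "q0 (slice_pt J z) = Re z"
    using imag_unit_components(1) [OF J] by (simp add: slice_pt_eq)
  have v: "slice_pt J z - of_real (Re z) = Im z *\<^sub>R J"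
    by (simp add: slice_pt_eq of_real_def)
  have nv: "norm (Im z *\<^sub>R J) = \<bar>Im z\<bar>"
    using imag_unit_components(2) [OF J] by simp
  have l: "lift F (slice_pt J z) = of_real (Re (F (Complex (Re z) \<bar>Im z\<bar>))) +
     (Im z *\<^sub>R J /\<^sub>R \<bar>Im z\<bar>) * of_real (Im (F (Complex (Re z) \<bar>Im z\<bar>)))"
    unfolding lift_def Let_def q v nv ..
  consider "Im z > 0" | "Im z < 0" | "Im z = 0" by linarith
  then show ?thesis
  proof cases
    case 1
    then have "Complex (Re z) \<bar>Im z\<bar> = z" by (simp add: complex_eq_iff)
    then show ?thesis unfolding l using 1 by (simp add: slice_pt_eq of_real_def)
  next
    case 2
    then have "Complex (Re z) \<bar>Im z\<bar> = cnj z" by (simp add: complex_eq_iff)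
    then show ?thesis unfolding l using 2 by (simp add: slice_pt_eq of_real_def F)
  next
    case 3
    then have z: "cnj z = z" "Complex (Re z) \<bar>Im z\<bar> = z" by (simp_all add: complex_eq_iff)
    then have "F z = cnj (F z)" using F by simp
    then have "Im (F z) = 0" by (simp add: complex_eq_iff)
    then show ?thesis unfolding l using 3 z by (simp add: slice_pt_eq of_real_def)
  qed
qed

definition intrinsic_on :: "quat set \<Rightarrow> (complex \<Rightarrow> complex) \<Rightarrow> bool" where
  "intrinsic_on D F \<longleftrightarrow> (\<forall>J\<in>\<S>. F holomorphic_on slice D J \<and> (\<forall>z\<in>slice D J. F (cnj z) = cnj (F z)))"

lemma intrinsic_on_lift: "intrinsic_on D F \<Longrightarrow> J \<in> \<S> \<Longrightarrow> slice_pt J z \<in> D \<Longrightarrow> lift F (slice_pt J z) = slice_pt J (F z)"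
  by (rule lift_slice_pt) (simp_all add: intrinsic_on_def slice_def)

lemma intrinsic_on_subset: "intrinsic_on D F \<Longrightarrow> D' \<subseteq> D \<Longrightarrow> intrinsic_on D' F"
  unfolding intrinsic_on_def by (meson holomorphic_on_subset slice_iff subset_iff)

lemma slice_regular_op_lift:
  assumes D: "open D" "axially_symmetric D" and F: "intrinsic_on D F"
  shows "slice_regular_op D (\<lambda>s. lop (lift F s) :: 'a::real_normed_vector quat_op)"
proof (rule slice_regular_opI)
  fix J assume J: "J \<in> \<S>"
  have "op_holo J (slice D J) (\<lambda>z. scal J (F z) :: 'a quat_op)"
    using F J by (intro op_holo_scal open_slice D) (simp_all add: intrinsic_on_def)
  then show "op_holo J (slice D J) (\<lambda>z. lop (lift F (slice_pt J z)) :: 'a quat_op)"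
    by (rule op_holo_cong [THEN iffD1, rotated]) (simp add: scal_def intrinsic_on_lift [OF F J] slice_iff)
next
  fix q J J' :: quat and z assume *: "J \<in> \<S>" "J' \<in> \<S>" "q * J = J' * q" "slice_pt J z \<in> D"
  then have "slice_pt J' z \<in> D" using slice_axially_symmetric [OF D(2), of J J'] slice_iff by blast
  then show "lop q \<odot> lop (lift F (slice_pt J z)) = (lop (lift F (slice_pt J' z)) \<odot> lop q :: 'a quat_op)"
    using * slice_pt_intertwine [OF *(3), of "F z"] by (simp add: intrinsic_on_lift [OF F] flip: lop_mult)
qed

lemma bounded_linear_quat_sel: "bounded_linear q0" "bounded_linear q1" "bounded_linear q2" "bounded_linear q3"
  unfolding linear_conv_bounded_linear [symmetric] by (rule linearI; simp)+

text \<open>The Cauchy-Riemann equations and the parities are real linear in the pair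
  \<open>\<alpha>\<close>, \<open>\<beta>\<close>, so they survive any real-linear \<open>p\<close>.
  Parity becomes compatibility with conjugation.\<close>

lemma slice_components_intrinsic:
  assumes comp: "slice_components D h \<alpha> \<beta>" and p: "bounded_linear p"
  shows "intrinsic_on D (\<lambda>z. Complex (p (\<alpha> (Re z, Im z))) (p (\<beta> (Re z, Im z))))"
  unfolding intrinsic_on_def
proof (intro ballI conjI)
  fix J assume J: "J \<in> \<S>"
  interpret p: bounded_linear p by fact
  let ?F = "\<lambda>z. Complex (p (\<alpha> (Re z, Im z))) (p (\<beta> (Re z, Im z)))"
  have c: "\<alpha> (Re z, - Im z) = \<alpha> (Re z, Im z)" "\<beta> (Re z, - Im z) = - \<beta> (Re z, Im z)"
    "\<alpha> differentiable (at (Re z, Im z))" "\<beta> differentiable (at (Re z, Im z))"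
    "frechet_derivative \<alpha> (at (Re z, Im z)) (1, 0) = frechet_derivative \<beta> (at (Re z, Im z)) (0, 1)"
    "frechet_derivative \<alpha> (at (Re z, Im z)) (0, 1) = - frechet_derivative \<beta> (at (Re z, Im z)) (1, 0)"
    if "z \<in> slice D J" for z
    using comp J that unfolding slice_components_def slice_def slice_pt_def by blast+
  show "?F (cnj z) = cnj (?F z)" if "z \<in> slice D J" for z
    using c(1,2) [OF that] by (simp add: complex_eq_iff p.neg)
  show "?F holomorphic_on slice D J"
  proof (rule holomorphic_onI)
    fix z assume z: "z \<in> slice D J"
    define a where "a = frechet_derivative \<alpha> (at (Re z, Im z))"
    define b where "b = frechet_derivative \<beta> (at (Re z, Im z))"
    have a: "(\<alpha> has_derivative a) (at (Re z, Im z))" and b: "(\<beta> has_derivative b) (at (Re z, Im z))"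
      unfolding a_def b_def using c(3,4) [OF z] by (simp_all add: frechet_derivative_works)
    have ab: "a (1, 0) = b (0, 1)" "a (0, 1) = - b (1, 0)"
      unfolding a_def b_def by (fact c(5,6) [OF z])+
    have lin: "a (x, y) = x *\<^sub>R a (1, 0) + y *\<^sub>R a (0, 1)" "b (x, y) = x *\<^sub>R b (1, 0) + y *\<^sub>R b (0, 1)" for x y
    proof -
      interpret a: linear a by (rule has_derivative_linear [OF a])
      interpret b: linear b by (rule has_derivative_linear [OF b])
      have xy: "(x, y) = x *\<^sub>R (1, 0) + y *\<^sub>R (0, 1)" by simp
      show "a (x, y) = x *\<^sub>R a (1, 0) + y *\<^sub>R a (0, 1)" by (subst xy) (simp only: a.add a.scaleR)
      show "b (x, y) = x *\<^sub>R b (1, 0) + y *\<^sub>R b (0, 1)" by (subst xy) (simp only: b.add b.scaleR)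
    qed
    have pair: "((\<lambda>z. (Re z, Im z)) has_derivative (\<lambda>h. (Re h, Im h))) (at z)"
      by (intro has_derivative_Pair bounded_linear.has_derivative [OF bounded_linear_Re]
          bounded_linear.has_derivative [OF bounded_linear_Im] has_derivative_ident)
    have "((\<lambda>z. p (\<alpha> (Re z, Im z))) has_derivative (\<lambda>h. p (a (Re h, Im h)))) (at z)"
      by (rule p.has_derivative, rule has_derivative_compose [OF pair]) (rule a)
    moreover have "((\<lambda>z. p (\<beta> (Re z, Im z))) has_derivative (\<lambda>h. p (b (Re h, Im h)))) (at z)"
      by (rule p.has_derivative, rule has_derivative_compose [OF pair]) (rule b)
    ultimately have "((\<lambda>z. of_real (p (\<alpha> (Re z, Im z))) + \<i> * of_real (p (\<beta> (Re z, Im z)))) has_derivative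
        (\<lambda>h. of_real (p (a (Re h, Im h))) + \<i> * of_real (p (b (Re h, Im h))))) (at z)"
      by (intro has_derivative_add has_derivative_mult_right bounded_linear.has_derivative [OF bounded_linear_of_real])
    moreover have "(\<lambda>z. of_real (p (\<alpha> (Re z, Im z))) + \<i> * of_real (p (\<beta> (Re z, Im z)))) = ?F"
      by (simp add: fun_eq_iff complex_eq_iff)
    \<comment> \<open>By the equations \<open>ab\<close> the real derivative is multiplication by a
      complex number.\<close>
    moreover have "(\<lambda>h. of_real (p (a (Re h, Im h))) + \<i> * of_real (p (b (Re h, Im h)))) = (*) (Complex (p (a (1, 0))) (p (b (1, 0))))"
      by (rule ext) (subst lin, subst lin(2), simp add: complex_eq_iff ab p.add p.scaleR p.neg p.diff)
    ultimately have "(?F has_field_derivative Complex (p (a (1, 0))) (p (b (1, 0)))) (at z)"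
      unfolding has_field_derivative_def by simp
    then show "?F field_differentiable at z within slice D J"
      using field_differentiable_at_within field_differentiable_def by blast
  qed
qed

definition quat_basis :: "nat \<Rightarrow> quat" where
  "quat_basis i = [1, e1, e2, e3] ! i"

text \<open>The coordinates are taken of \<open>\<alpha>\<close> and \<open>\<beta>\<close>, not of
  the values of \<open>g\<close>: the units stay on the right, where the left factor
  \<open>J\<close> does not mix them.\<close>

lemma left_slice_hyperholomorphic_split:
  assumes "left_slice_hyperholomorphic D g"
  obtains G where "\<And>i. i < 4 \<Longrightarrow> intrinsic_on D (G i)"
    "\<And>s J z. J \<in> \<S> \<Longrightarrow> slice_pt J z \<in> D \<Longrightarrow> g (slice_pt J z) = (\<Sum>i<4. slice_pt J (G i z) * quat_basis i)"
proof -
  obtain \<alpha> \<beta> where comp: "slice_components D g \<alpha> \<beta>"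
    using assms unfolding left_slice_hyperholomorphic_def by blast
  define p where "p i = [q0, q1, q2, q3] ! i" for i :: nat
  define G where "G i z = Complex (p i (\<alpha> (Re z, Im z))) (p i (\<beta> (Re z, Im z)))" for i z
  have "intrinsic_on D (G i)" if "i < 4" for i
    unfolding G_def
  proof (rule slice_components_intrinsic [OF comp])
    have "i = 0 \<or> i = 1 \<or> i = 2 \<or> i = 3" using that by linarith
    then show "bounded_linear (p i)" using bounded_linear_quat_sel by (auto simp: p_def)
  qed
  moreover have "g (slice_pt J z) = (\<Sum>i<4. slice_pt J (G i z) * quat_basis i)"
    if "J \<in> \<S>" "slice_pt J z \<in> D" for J z
  proof -
    have "g (slice_pt J z) = \<alpha> (Re z, Im z) + J * \<beta> (Re z, Im z)"
      using comp that unfolding slice_components_def slice_pt_def by blast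
    also have "\<dots> = (\<Sum>i<4. slice_pt J (G i z) * quat_basis i)"
      by (simp add: eval_nat_numeral G_def p_def quat_basis_def slice_pt_eq quat_eq_iff e1_def e2_def e3_def)
    finally show ?thesis .
  qed
  ultimately show thesis using that by blast
qed

lemma intrinsic_slice_hyperholomorphic_lift:
  assumes "intrinsic_slice_hyperholomorphic D f"
  obtains F where "intrinsic_on D F"
    "\<And>J z. J \<in> \<S> \<Longrightarrow> slice_pt J z \<in> D \<Longrightarrow> f (slice_pt J z) = slice_pt J (F z)"
proof -
  obtain \<alpha> \<beta> where comp: "slice_components D f \<alpha> \<beta>"
    and real: "\<And>u v J. J \<in> \<S> \<Longrightarrow> of_real u + J * of_real v \<in> D \<Longrightarrow> \<alpha> (u, v) \<in> \<real> \<and> \<beta> (u, v) \<in> \<real>"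
    using assms unfolding intrinsic_slice_hyperholomorphic_def by blast
  define F where "F z = Complex (q0 (\<alpha> (Re z, Im z))) (q0 (\<beta> (Re z, Im z)))" for z
  have "f (slice_pt J z) = slice_pt J (F z)" if *: "J \<in> \<S>" "slice_pt J z \<in> D" for J z
  proof -
    have "f (slice_pt J z) = \<alpha> (Re z, Im z) + J * \<beta> (Re z, Im z)"
      using comp * unfolding slice_components_def slice_pt_def by blast
    moreover have "\<alpha> (Re z, Im z) = of_real (q0 (\<alpha> (Re z, Im z)))" "\<beta> (Re z, Im z) = of_real (q0 (\<beta> (Re z, Im z)))"
      using real [OF *(1), of "Re z" "Im z"] *(2) by (auto simp: slice_pt_def of_real_def elim!: Reals_cases)
    ultimately show ?thesis by (simp add: slice_pt_def F_def)
  qed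
  moreover have "intrinsic_on D F"
    unfolding F_def by (rule slice_components_intrinsic [OF comp bounded_linear_quat_sel(1)])
  ultimately show thesis using that by blast
qed

section \<open>Functional calculi of intrinsic functions\<close>

text \<open>The slice-valued factors of \<open>g\<close> commute with the line element and move in
  front of it. The constants \<open>c i\<close> do not, but they already stand at the right end and
  leave the integral there.\<close>

lemma calculus_split:
  fixes \<K> :: "quat \<Rightarrow> 'a::banach quat_op"
  assumes J: "J \<in> \<S>" and \<Gamma>: "\<And>\<gamma>. \<gamma> \<in> \<Gamma> \<Longrightarrow> piecewise_C1 \<gamma>" and I: "finite I"
    and cont: "\<And>i. i \<in> I \<Longrightarrow> continuous_on_paths \<Gamma> (\<lambda>z. \<K> (slice_pt J z) \<odot> scal J (G i z))"
    and g: "\<And>\<gamma> z. \<gamma> \<in> \<Gamma> \<Longrightarrow> z \<in> path_image \<gamma> \<Longrightarrow> g (slice_pt J z) = (\<Sum>i\<in>I. slice_pt J (G i z) * c i)"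
  shows "calculus \<K> (U, J, \<Gamma>) g = (\<Sum>i\<in>I. path_int J \<Gamma> (\<lambda>z. \<K> (slice_pt J z) \<odot> scal J (G i z)) \<odot> lop (c i))"
proof -
  let ?k = "\<lambda>i z. \<K> (slice_pt J z) \<odot> scal J (G i z)"
  have bl: "bounded_linear (\<lambda>b :: 'a quat_op. b \<odot> lop q)" for q
    by (rule bounded_linear_op_left)
  have "integral {0..1} (\<lambda>t. \<K> (slice_pt J (\<gamma> t)) \<odot>
      lop (slice_pt J (vector_derivative \<gamma> (at t within {0..1})) * (- J)) \<odot> lop (g (slice_pt J (\<gamma> t)))) =
    (\<Sum>i\<in>I. integral {0..1} (\<lambda>t. ?k i (\<gamma> t) \<odot> line_element J \<gamma> t) \<odot> lop (c i))" if \<gamma>: "\<gamma> \<in> \<Gamma>" for \<gamma>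
  proof -
    have int: "(\<lambda>t. ?k i (\<gamma> t) \<odot> line_element J \<gamma> t) integrable_on {0..1}" if "i \<in> I" for i
      using path_int_integrable [OF \<Gamma> [OF \<gamma>], of "?k i"] cont [OF that] \<gamma> by (simp add: continuous_on_paths_def)
    have int': "(\<lambda>t. (?k i (\<gamma> t) \<odot> line_element J \<gamma> t) \<odot> lop (c i)) integrable_on {0..1}" if "i \<in> I" for i
      using integrable_linear [OF int [OF that] bl] by (simp add: o_def)
    have "integral {0..1} (\<lambda>t. \<K> (slice_pt J (\<gamma> t)) \<odot>
      lop (slice_pt J (vector_derivative \<gamma> (at t within {0..1})) * (- J)) \<odot> lop (g (slice_pt J (\<gamma> t)))) =
      integral {0..1} (\<lambda>t. \<Sum>i\<in>I. (?k i (\<gamma> t) \<odot> line_element J \<gamma> t) \<odot> lop (c i))"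
    proof (rule integral_cong)
      fix t :: real assume "t \<in> {0..1}"
      then have "\<gamma> t \<in> path_image \<gamma>" by (simp add: path_image_def)
      then have "lop (g (slice_pt J (\<gamma> t))) = (\<Sum>i\<in>I. scal J (G i (\<gamma> t)) \<odot> (lop (c i) :: 'a quat_op))"
        using g [OF \<gamma>] by (simp add: linear_sum [OF bounded_linear.linear [OF bounded_linear_lop]] lop_mult scal_def)
      moreover have "line_element J \<gamma> t \<odot> (scal J w \<odot> x) = scal J w \<odot> (line_element J \<gamma> t \<odot> x)" for w and x :: "'a quat_op"
        using scal_commute [OF J, where 'a = 'a] by (simp add: line_element_eq [OF J] op_commute_def flip: op_assoc)
      ultimately show "\<K> (slice_pt J (\<gamma> t)) \<odot>
        lop (slice_pt J (vector_derivative \<gamma> (at t within {0..1})) * (- J)) \<odot> lop (g (slice_pt J (\<gamma> t))) =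
        (\<Sum>i\<in>I. (?k i (\<gamma> t) \<odot> line_element J \<gamma> t) \<odot> lop (c i))"
        unfolding line_element_def [symmetric]
        by (simp add: op_sum_right op_assoc)
    qed
    also have "\<dots> = (\<Sum>i\<in>I. integral {0..1} (\<lambda>t. (?k i (\<gamma> t) \<odot> line_element J \<gamma> t) \<odot> lop (c i)))"
      by (rule integral_sum [OF I int'])
    also have "\<dots> = (\<Sum>i\<in>I. integral {0..1} (\<lambda>t. ?k i (\<gamma> t) \<odot> line_element J \<gamma> t) \<odot> lop (c i))"
      using integral_linear [OF int bl] by (intro sum.cong refl) (simp add: o_def)
    finally show ?thesis .
  qed
  then have "calculus \<K> (U, J, \<Gamma>) g = (1 / (2 * pi)) *\<^sub>R
      (\<Sum>\<gamma>\<in>\<Gamma>. \<Sum>i\<in>I. integral {0..1} (\<lambda>t. ?k i (\<gamma> t) \<odot> line_element J \<gamma> t) \<odot> lop (c i))"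
    unfolding calculus_def by simp
  also have "\<dots> = (\<Sum>i\<in>I. path_int J \<Gamma> (?k i) \<odot> lop (c i))"
    unfolding path_int_def op_sum_left
      op_scaleR_left scaleR_right.sum
    by (rule sum.swap)
  finally show ?thesis .
qed

text \<open>The planar \<open>F\<close> is lifted to the quaternions so that independence of the
  unit, a statement about functions on all slices, applies.\<close>

definition kernel_int :: "quat \<Rightarrow> (real \<Rightarrow> complex) set \<Rightarrow> (quat \<Rightarrow> 'a::banach quat_op) \<Rightarrow> (complex \<Rightarrow> complex) \<Rightarrow> 'a quat_op" where
  "kernel_int J \<Gamma> k F = slice_int J \<Gamma> (\<lambda>s. k s \<odot> lop (lift F s))"

section \<open>Integrals of intrinsic functions against slice regular kernels\<close>

context spectral_domain
begin

lemma lift_regular: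
  assumes k: "slice_regular_op (- K) k" and F: "intrinsic_on D F"
  shows "slice_regular_op (D - K) k" "slice_regular_op (D - K) (\<lambda>s. k s \<odot> lop (lift F s))"
proof -
  show k': "slice_regular_op (D - K) k" by (rule slice_regular_op_subset [OF k]) auto
  have "slice_regular_op D (\<lambda>s. lop (lift F s) :: 'a quat_op)"
    by (rule slice_regular_op_lift [OF open_D axial_D F])
  then have "slice_regular_op (D - K) (\<lambda>s. lop (lift F s) :: 'a quat_op)"
    by (rule slice_regular_op_subset) auto
  then show "slice_regular_op (D - K) (\<lambda>s. k s \<odot> lop (lift F s))"
    by (rule slice_regular_op_compose [OF open_DK k'])
qed

lemma kernel_int_eq_path_int:
  assumes \<Gamma>: "surrounds J \<Gamma>" and F: "intrinsic_on D F"
  shows "kernel_int J \<Gamma> k F = path_int J \<Gamma> (\<lambda>z. k (slice_pt J z) \<odot> scal J (F z))"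
  unfolding kernel_int_def slice_int_def
proof (rule path_int_cong)
  fix \<gamma> z assume "\<gamma> \<in> \<Gamma>" "z \<in> path_image \<gamma>"
  then have "slice_pt J z \<in> D" using surrounds_curves(4) [OF \<Gamma>] slice_iff by blast
  then show "k (slice_pt J z) \<odot> lop (lift F (slice_pt J z)) = k (slice_pt J z) \<odot> scal J (F z)"
    by (simp add: intrinsic_on_lift [OF F surrounds_unit [OF \<Gamma>]] scal_def)
qed

lemma kernel_op_holo:
  assumes J: "J \<in> \<S>" and k: "slice_regular_op (- K) k" and F: "intrinsic_on D F"
  shows "op_holo J (slice (D - K) J) (\<lambda>z. k (slice_pt J z))"
    "op_holo J (slice (D - K) J) (\<lambda>z. k (slice_pt J z) \<odot> scal J (F z))"
proof -
  show *: "op_holo J (slice (D - K) J) (\<lambda>z. k (slice_pt J z))"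
    by (rule slice_regular_opD(2) [OF lift_regular(1) [OF k F] J])
  have "slice (D - K) J \<subseteq> slice D J" by (auto simp: slice_def)
  then have "F holomorphic_on slice (D - K) J"
    using F J unfolding intrinsic_on_def by (meson holomorphic_on_subset)
  then show "op_holo J (slice (D - K) J) (\<lambda>z. k (slice_pt J z) \<odot> scal J (F z))"
    by (intro op_holo_compose J open_slice_DK * op_holo_scal)
qed

lemma kernel_int_real:
  "surrounds J \<Gamma> \<Longrightarrow> slice_regular_op (- K) k \<Longrightarrow> intrinsic_on D F \<Longrightarrow> op_commute (lop q) (kernel_int J \<Gamma> k F)"
  unfolding kernel_int_def by (intro slice_int_real lift_regular)

lemma kernel_int_indep:
  "surrounds J \<Gamma> \<Longrightarrow> surrounds J' \<Gamma>' \<Longrightarrow> slice_regular_op (- K) k \<Longrightarrow> intrinsic_on D F \<Longrightarrow>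
    kernel_int J \<Gamma> k F = kernel_int J' \<Gamma>' k F"
  unfolding kernel_int_def by (intro slice_int_indep lift_regular)

lemma kernel_int_left:
  assumes \<Gamma>: "surrounds J \<Gamma>" and k: "slice_regular_op (- K) k" and F: "intrinsic_on D F"
    and h: "\<And>s. s \<in> - K \<Longrightarrow> h s = a \<odot> k s"
  shows "kernel_int J \<Gamma> h F = a \<odot> kernel_int J \<Gamma> k F"
proof -
  have J: "J \<in> \<S>" by (rule surrounds_unit [OF \<Gamma>])
  have "kernel_int J \<Gamma> h F = path_int J \<Gamma> (\<lambda>z. a \<odot> (k (slice_pt J z) \<odot> scal J (F z)))"
    unfolding kernel_int_eq_path_int [OF \<Gamma> F]
  proof (rule path_int_cong)
    fix \<gamma> z assume "\<gamma> \<in> \<Gamma>" "z \<in> path_image \<gamma>"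
    then have "slice_pt J z \<in> - K" using surrounds_curves(4) [OF \<Gamma>] slice_iff by blast
    then show "h (slice_pt J z) \<odot> scal J (F z) = a \<odot> (k (slice_pt J z) \<odot> scal J (F z))"
      by (simp add: h op_assoc)
  qed
  also have "\<dots> = a \<odot> kernel_int J \<Gamma> k F"
    unfolding kernel_int_eq_path_int [OF \<Gamma> F]
    by (rule path_int_left [OF surrounds_curves(2) [OF \<Gamma>] surrounds_op_holo_continuous [OF \<Gamma> kernel_op_holo(2) [OF J k F]]])
  finally show ?thesis .
qed

lemma kernel_int_add:
  assumes \<Gamma>: "surrounds J \<Gamma>" and k: "slice_regular_op (- K) k" "slice_regular_op (- K) k'" and F: "intrinsic_on D F"
    and h: "\<And>s. s \<in> - K \<Longrightarrow> h s = k s + k' s"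
  shows "kernel_int J \<Gamma> h F = kernel_int J \<Gamma> k F + kernel_int J \<Gamma> k' F"
proof -
  have J: "J \<in> \<S>" by (rule surrounds_unit [OF \<Gamma>])
  have "kernel_int J \<Gamma> h F = path_int J \<Gamma> (\<lambda>z. k (slice_pt J z) \<odot> scal J (F z) + k' (slice_pt J z) \<odot> scal J (F z))"
    unfolding kernel_int_eq_path_int [OF \<Gamma> F]
  proof (rule path_int_cong)
    fix \<gamma> z assume "\<gamma> \<in> \<Gamma>" "z \<in> path_image \<gamma>"
    then have "slice_pt J z \<in> - K" using surrounds_curves(4) [OF \<Gamma>] slice_iff by blast
    then show "h (slice_pt J z) \<odot> scal J (F z) = k (slice_pt J z) \<odot> scal J (F z) + k' (slice_pt J z) \<odot> scal J (F z)"
      by (simp add: h op_distrib)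
  qed
  also have "\<dots> = kernel_int J \<Gamma> k F + kernel_int J \<Gamma> k' F"
    unfolding kernel_int_eq_path_int [OF \<Gamma> F]
    by (intro path_int_add surrounds_curves(2) [OF \<Gamma>] surrounds_op_holo_continuous [OF \<Gamma>] kernel_op_holo [OF J _ F] k)
  finally show ?thesis .
qed

lemma kernel_int_commute:
  assumes \<Gamma>: "surrounds J \<Gamma>" and k: "slice_regular_op (- K) k" and F: "intrinsic_on D F"
    and a: "\<And>q. op_commute (lop q) a" "\<And>s. s \<in> - K \<Longrightarrow> op_commute a (k s)"
  shows "op_commute a (kernel_int J \<Gamma> k F)"
proof -
  have J: "J \<in> \<S>" by (rule surrounds_unit [OF \<Gamma>])
  note c = surrounds_curves(2) [OF \<Gamma>] surrounds_op_holo_continuous [OF \<Gamma> kernel_op_holo(2) [OF J k F]]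
  have "a \<odot> kernel_int J \<Gamma> k F = path_int J \<Gamma> (\<lambda>z. a \<odot> (k (slice_pt J z) \<odot> scal J (F z)))"
    unfolding kernel_int_eq_path_int [OF \<Gamma> F] by (rule path_int_left [OF c, symmetric])
  also have "\<dots> = path_int J \<Gamma> (\<lambda>z. (k (slice_pt J z) \<odot> scal J (F z)) \<odot> a)"
  proof (rule path_int_cong)
    fix \<gamma> z assume "\<gamma> \<in> \<Gamma>" "z \<in> path_image \<gamma>"
    then have "slice_pt J z \<in> - K" using surrounds_curves(4) [OF \<Gamma>] slice_iff by blast
    then have "op_commute a (k (slice_pt J z) \<odot> scal J (F z))"
      unfolding scal_def by (intro op_commute_compose a(2) op_commute_sym [OF a(1)])
    then show "a \<odot> (k (slice_pt J z) \<odot> scal J (F z)) = (k (slice_pt J z) \<odot> scal J (F z)) \<odot> a"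
      by (simp add: op_commute_def)
  qed
  also have "\<dots> = kernel_int J \<Gamma> k F \<odot> a"
    unfolding kernel_int_eq_path_int [OF \<Gamma> F] by (rule path_int_right [OF c op_commute_sym [OF a(1)]])
  finally show ?thesis by (simp add: op_commute_def)
qed

text \<open>The kernel identity is asked for commuting \<open>s\<close> and \<open>p\<close> only,
  because both integrations run over the same slice.\<close>

lemma kernel_int_product:
  fixes A B :: "nat \<Rightarrow> quat \<Rightarrow> 'a::banach quat_op"
  assumes \<Gamma>: "surrounds J \<Gamma>" and F: "intrinsic_on D F" and G: "intrinsic_on D G"
    and reg: "\<And>i. i < m \<Longrightarrow> slice_regular_op (- K) (A i)" "\<And>i. i < m \<Longrightarrow> slice_regular_op (- K) (B i)" "slice_regular_op (- K) H"
    and kernel: "\<And>s p. s \<in> - K \<Longrightarrow> p \<in> - K \<Longrightarrow> s * p = p * s \<Longrightarrow>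
      (\<Sum>i<m. A i s \<odot> B i p) \<odot> lop (p - s) = H s - H p"
  shows "kernel_int J \<Gamma> H (\<lambda>z. F z * G z) = (\<Sum>i<m. kernel_int J \<Gamma> (A i) F \<odot> kernel_int J \<Gamma> (B i) G)"
proof -
  have J: "J \<in> \<S>" by (rule surrounds_unit [OF \<Gamma>])
  have FG: "intrinsic_on D (\<lambda>z. F z * G z)"
    using F G unfolding intrinsic_on_def by (auto intro: holomorphic_intros)
  have "(\<Sum>i<m. path_int J \<Gamma> (\<lambda>z. A i (slice_pt J z) \<odot> scal J (F z)) \<odot> path_int J \<Gamma> (\<lambda>z. B i (slice_pt J z) \<odot> scal J (G z))) =
    path_int J \<Gamma> (\<lambda>z. H (slice_pt J z) \<odot> scal J (F z * G z))"
  proof (rule path_int_product [OF \<Gamma>, where A = "\<lambda>i z. A i (slice_pt J z)" and B = "\<lambda>i z. B i (slice_pt J z)" and H = "\<lambda>z. H (slice_pt J z)"])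
    fix \<zeta> \<eta> assume "\<zeta> \<in> slice (D - K) J" "\<eta> \<in> slice (D - K) J"
    moreover have "slice_pt J \<zeta> * slice_pt J \<eta> = slice_pt J \<eta> * slice_pt J \<zeta>"
      by (simp add: mult.commute flip: slice_pt_mult [OF J])
    ultimately show "(\<Sum>i<m. A i (slice_pt J \<zeta>) \<odot> B i (slice_pt J \<eta>)) \<odot> scal J (\<eta> - \<zeta>) =
      H (slice_pt J \<zeta>) - H (slice_pt J \<eta>)"
      using kernel [of "slice_pt J \<zeta>" "slice_pt J \<eta>"] by (simp add: slice_iff scal_def slice_pt_diff)
  qed (use F G J reg in \<open>auto simp: intrinsic_on_def intro!: kernel_op_holo(1) [OF J _ F]\<close>)
  then show ?thesis by (simp add: kernel_int_eq_path_int [OF \<Gamma>] F G FG)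
qed

end

lemma admissible_surrounds:
  fixes T :: "'a::banach quat_op"
  assumes D: "open D" "axially_symmetric D" and adm: "admissible T D (U, J, \<Gamma>)" and T: "T \<in> BCX"
  shows "spectral_domain D (S_spectrum T)" "spectral_domain.surrounds D (S_spectrum T) J \<Gamma>"
proof -
  interpret commuting_op T by standard (fact T)
  show sd: "spectral_domain D (S_spectrum T)"
  proof
    have "D - S_spectrum T = D \<inter> S_resolvent_set T" by (auto simp: S_spectrum_def)
    then show "open (D - S_spectrum T)" using D(1) open_S_resolvent_set by auto
  qed (use D axially_symmetric_S_spectrum in auto)
  show "spectral_domain.surrounds D (S_spectrum T) J \<Gamma>"
    unfolding spectral_domain.surrounds_def [OF sd]
    using admissible_encloses [OF adm] by blast
qed

lemma admissible_mono: "admissible T D C \<Longrightarrow> D \<subseteq> D' \<Longrightarrow> admissible T D' C"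
  unfolding admissible_def by (cases C) auto

section \<open>The product rule\<close>

lemma sum_less_4: "(\<Sum>i<4. f i) = f 0 + f 1 + f 2 + f (3 :: nat)"
  and sum_less_5: "(\<Sum>i<5. f i) = f 0 + f 1 + f 2 + f 3 + f (4 :: nat)"
  by (simp_all add: eval_nat_numeral)

text \<open>Since \<open>r = 1/(c\<^sup>2 + w)\<close> and \<open>t = 1/(d\<^sup>2 + w)\<close>, the first sum is \<open>(c + d) r t (r + t) (d - c)\<close> and
  \<open>r - t = (d\<^sup>2 - c\<^sup>2) r t\<close>; in the second one uses \<open>(d - c) (c d - w) r t = c r - d t\<close>.\<close>

lemma kernel_algebra:
  fixes w c d r t :: "'a::real_normed_vector quat_op"
  assumes comm: "r \<odot> c = c \<odot> r" "d \<odot> c = c \<odot> d" "d \<odot> r = r \<odot> d" "t \<odot> d = d \<odot> t"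
    "t \<odot> c = c \<odot> t" "t \<odot> r = r \<odot> t" "c \<odot> w = w \<odot> c" "d \<odot> w = w \<odot> d" "r \<odot> w = w \<odot> r" "t \<odot> w = w \<odot> t"
    and inv: "c \<odot> (c \<odot> r) = id_blinfun - w \<odot> r" "d \<odot> (d \<odot> t) = id_blinfun - w \<odot> t"
  shows "(r \<odot> r \<odot> (d \<odot> t) + c \<odot> (r \<odot> r) \<odot> t + c \<odot> r \<odot> (t \<odot> t) + r \<odot> (d \<odot> (t \<odot> t))) \<odot> (d - c) =
      r \<odot> r - t \<odot> t"
    "(c \<odot> (r \<odot> r) \<odot> (d \<odot> t) + - w \<odot> (r \<odot> r) \<odot> t + c \<odot> r \<odot> (d \<odot> (t \<odot> t)) + - w \<odot> r \<odot> (t \<odot> t) + r \<odot> t) \<odot> (d - c) =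
      c \<odot> (r \<odot> r) - d \<odot> (t \<odot> t)"
proof -
  have inv': "c \<odot> (c \<odot> (r \<odot> x)) = x - w \<odot> (r \<odot> x)" "d \<odot> (d \<odot> (t \<odot> x)) = x - w \<odot> (t \<odot> x)" for x
    using arg_cong [OF inv(1), of "\<lambda>y. y \<odot> x"] arg_cong [OF inv(2), of "\<lambda>y. y \<odot> x"]
    unfolding op_diff_left op_assoc op_id .
  note rules = op_distrib op_assoc comm comm [THEN op_left] inv inv'
  show "(r \<odot> r \<odot> (d \<odot> t) + c \<odot> (r \<odot> r) \<odot> t + c \<odot> r \<odot> (t \<odot> t) + r \<odot> (d \<odot> (t \<odot> t))) \<odot> (d - c) =
      r \<odot> r - t \<odot> t"
    by (simp add: rules)
  show "(c \<odot> (r \<odot> r) \<odot> (d \<odot> t) + - w \<odot> (r \<odot> r) \<odot> t + c \<odot> r \<odot> (d \<odot> (t \<odot> t)) + - w \<odot> r \<odot> (t \<odot> t) + r \<odot> t) \<odot> (d - c) =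
      c \<odot> (r \<odot> r) - d \<odot> (t \<odot> t)"
    by (simp add: rules)
qed

section \<open>The resolvent kernels and their commutation relations\<close>

context commuting_op
begin

definition R where "R s = op_inv (Q_c s T)"

abbreviation K where "K \<equiv> S_spectrum T"

lemma R_inverse:
  assumes "s \<in> - K"
  shows "Q_c s T \<odot> R s = id_blinfun" "R s \<odot> Q_c s T = id_blinfun"
  using Q_c_invertible [of s] assms by (simp_all add: R_def S_spectrum_def inverse_in_BX_def)

lemma open_res: "open (- K)" and axial_res: "axially_symmetric (- K)"
proof -
  show "open (- K)" using open_S_resolvent_set by (simp add: S_spectrum_def)
  show "axially_symmetric (- K)"
    using axially_symmetric_S_spectrum [of T] unfolding axially_symmetric_def by blast
qed

lemma regular_Z: "slice_regular_op (- K) Z"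
proof -
  have "slice_regular_op (- K) (\<lambda>s. lop s + - A)"
    by (intro slice_regular_op_add slice_regular_op_ident slice_regular_op_const open_res op_commute_right real_commute)
  then show ?thesis by simp
qed

lemma regular_R: "slice_regular_op (- K) R"
proof (rule slice_regular_op_inverse [OF open_res axial_res _ R_inverse])
  show "slice_regular_op (- K) (\<lambda>s. Q_c s T)"
    unfolding Q_c_eq
    by (intro slice_regular_op_add slice_regular_op_compose slice_regular_op_const open_res regular_Z W_real)
qed

definition RR where "RR s = R s \<odot> R s"
definition ZR where "ZR s = Z s \<odot> R s"
definition ZRR where "ZRR s = Z s \<odot> (R s \<odot> R s)"
definition ZZRR where "ZZRR s = Z s \<odot> (Z s \<odot> (R s \<odot> R s))"

lemma regular_kernels [simp]:
  "slice_regular_op (- K) R" "slice_regular_op (- K) RR" "slice_regular_op (- K) ZR"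
  "slice_regular_op (- K) ZRR" "slice_regular_op (- K) ZZRR"
  unfolding RR_def [abs_def] ZR_def [abs_def] ZRR_def [abs_def] ZZRR_def [abs_def]
  by (intro slice_regular_op_compose open_res regular_Z regular_R)+

lemma commute_R:
  assumes "s \<in> - K" "op_commute a (Z s)" "op_commute a W"
  shows "op_commute a (R s)"
proof -
  have "op_commute a (Q_c s T)"
    unfolding Q_c_eq by (rule op_commute_right(1) [OF op_commute_compose]) (fact assms)+
  then show ?thesis
    using op_inverse_commute [OF R_inverse [OF assms(1)] _ R_inverse [OF assms(1)], of a]
    by (simp add: op_commute_def)
qed

lemma commute_kernels:
  assumes s: "s \<in> - K" and a: "\<And>q. op_commute a (lop q)" "op_commute a A" "op_commute a W"
  shows "op_commute a (R s)" "op_commute a (RR s)" "op_commute a (ZR s)" "op_commute a (ZRR s)" "op_commute a (ZZRR s)"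
proof -
  have Z: "op_commute a (Z s)" by (intro op_commute_intros a)
  then show R: "op_commute a (R s)"
    by (rule commute_R [OF s]) (rule a)
  show "op_commute a (RR s)" "op_commute a (ZR s)" "op_commute a (ZRR s)" "op_commute a (ZZRR s)"
    unfolding RR_def ZR_def ZRR_def ZZRR_def by (intro op_commute_compose Z R)+
qed

lemma Z_commute:
  assumes "s * p = p * s"
  shows "op_commute (Z s) (Z p)"
proof -
  have "op_commute (lop s) (lop p :: 'a quat_op)" using assms by (simp add: op_commute_def flip: lop_mult)
  then have "op_commute (Z p) (lop s)" "op_commute (Z p) A"
    by (meson op_commute_intros op_commute_simps op_commute_sym real_commute)+
  then show ?thesis by (rule op_commute_sym [OF op_commute_right(2)])
qed

lemma W_Z_commute: "op_commute W (Z s)"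
  by (intro op_commute_intros op_commute_sym [OF W_real] op_commute_sym [OF A_W_commute])

lemma Z_R_commute:
  assumes "s \<in> - K" "s * p = p * s"
  shows "op_commute (Z p) (R s)"
  by (intro commute_R assms(1) Z_commute assms(2) [symmetric] op_commute_sym [OF W_Z_commute])

lemma W_R_commute: "s \<in> - K \<Longrightarrow> op_commute W (R s)"
  by (rule commute_kernels(1)) (auto intro: op_commute_sym A_W_commute W_real)

lemma R_R_commute:
  assumes "s \<in> - K" "p \<in> - K" "s * p = p * s"
  shows "op_commute (R p) (R s)"
proof -
  have "op_commute (R p) (Z s)" using Z_R_commute [OF assms(2), of s] assms(3) by (metis op_commute_sym)
  moreover have "op_commute (R p) W" using W_R_commute [OF assms(2)] by (rule op_commute_sym)
  ultimately show ?thesis by (intro commute_R assms(1))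
qed

text \<open>The entries at \<open>s\<close>, paired with those of \<open>product_right\<close> at
  \<open>p\<close>, are the four terms of \<open>(Z s + Z p) R s R p (R s + R p)\<close>, sorted
  into functions of one variable each.\<close>

definition product_left where "product_left i = [RR, ZRR, ZR, R] ! i"
definition product_right where "product_right i = [ZR, R, RR, ZRR] ! i"
text \<open>The first four pairs expand \<open>(Z s Z p - W) R s R p (R s + R p)\<close>. Multiplied
  by \<open>Z p - Z s\<close> they leave the cross term \<open>(Z s - Z p) R s R p\<close>, which
  the fifth pair removes; this pair is the source of the extra product of two \<open>R\<close>
  integrals.\<close>

definition product_left' where "product_left' i = [ZRR, \<lambda>s. - W \<odot> RR s, ZR, \<lambda>s. - W \<odot> R s, R] ! i"
definition product_right' where "product_right' i = [ZR, R, ZRR, RR, R] ! i"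

lemma product_sel:
  "product_left 0 = RR" "product_left 1 = ZRR" "product_left 2 = ZR" "product_left 3 = R"
  "product_right 0 = ZR" "product_right 1 = R" "product_right 2 = RR" "product_right 3 = ZRR"
  "product_left' 0 = ZRR" "product_left' 1 = (\<lambda>s. - W \<odot> RR s)" "product_left' 2 = ZR"
  "product_left' 3 = (\<lambda>s. - W \<odot> R s)" "product_left' 4 = R"
  "product_right' 0 = ZR" "product_right' 1 = R" "product_right' 2 = ZRR" "product_right' 3 = RR" "product_right' 4 = R"
  by (simp_all add: product_left_def product_right_def product_left'_def product_right'_def fun_eq_iff)

context
  fixes s p assumes s: "s \<in> - K" and p: "p \<in> - K" and sp: "s * p = p * s"
begin

lemma word_rules:
  "R s \<odot> Z s = Z s \<odot> R s" "Z p \<odot> Z s = Z s \<odot> Z p" "Z p \<odot> R s = R s \<odot> Z p" "R p \<odot> Z p = Z p \<odot> R p"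
  "R p \<odot> Z s = Z s \<odot> R p" "R p \<odot> R s = R s \<odot> R p"
  "Z s \<odot> W = W \<odot> Z s" "Z p \<odot> W = W \<odot> Z p" "R s \<odot> W = W \<odot> R s" "R p \<odot> W = W \<odot> R p"
  using Z_R_commute [OF s, of s] Z_R_commute [OF s sp] Z_R_commute [OF p, of p] Z_R_commute [OF p sp [symmetric]]
    Z_commute [OF sp] R_R_commute [OF s p sp] W_Z_commute [of s] W_Z_commute [of p] W_R_commute [OF s] W_R_commute [OF p]
  by (simp_all add: op_commute_def)

lemma Z_Z_R:
  "Z s \<odot> (Z s \<odot> R s) = id_blinfun - W \<odot> R s" "Z p \<odot> (Z p \<odot> R p) = id_blinfun - W \<odot> R p"
proof -
  have "Z s \<odot> (Z s \<odot> R s) + W \<odot> R s = id_blinfun" "Z p \<odot> (Z p \<odot> R p) + W \<odot> R p = id_blinfun"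
    using R_inverse(1) [OF s] R_inverse(1) [OF p]
    unfolding Q_c_eq op_add_left op_assoc .
  then show "Z s \<odot> (Z s \<odot> R s) = id_blinfun - W \<odot> R s" "Z p \<odot> (Z p \<odot> R p) = id_blinfun - W \<odot> R p"
    by (simp_all only: eq_diff_eq)
qed

lemma kernel_identity:
  "(\<Sum>i<4. product_left i s \<odot> product_right i p) \<odot> lop (p - s) = RR s - RR p"
  "(\<Sum>i<5. product_left' i s \<odot> product_right' i p) \<odot> lop (p - s) = ZRR s - ZRR p"
proof -
  have "lop (p - s) = Z p - Z s" by (simp add: lop_diff)
  then show "(\<Sum>i<4. product_left i s \<odot> product_right i p) \<odot> lop (p - s) = RR s - RR p"
    "(\<Sum>i<5. product_left' i s \<odot> product_right' i p) \<odot> lop (p - s) = ZRR s - ZRR p"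
    unfolding sum_less_4 sum_less_5 product_sel RR_def ZR_def ZRR_def
    using kernel_algebra [OF word_rules Z_Z_R] by (simp_all only:)
qed

end

lemma regular_minus_W:
  assumes "slice_regular_op (- K) k"
  shows "slice_regular_op (- K) (\<lambda>s. - W \<odot> k s)"
  by (intro slice_regular_op_compose slice_regular_op_const open_res assms op_commute_right W_real)

lemma regular_products:
  "i < 4 \<Longrightarrow> slice_regular_op (- K) (product_left i)" "i < 4 \<Longrightarrow> slice_regular_op (- K) (product_right i)"
  "i < 5 \<Longrightarrow> slice_regular_op (- K) (product_left' i)" "i < 5 \<Longrightarrow> slice_regular_op (- K) (product_right' i)"
proof -
  have c4: "i = 0 \<or> i = 1 \<or> i = 2 \<or> i = 3" if "i < 4" using that by linarith
  have c5: "i = 0 \<or> i = 1 \<or> i = 2 \<or> i = 3 \<or> i = 4" if "i < 5" using that by linarith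
  show "i < 4 \<Longrightarrow> slice_regular_op (- K) (product_left i)" "i < 4 \<Longrightarrow> slice_regular_op (- K) (product_right i)"
    using c4 product_sel regular_kernels by auto
  show "i < 5 \<Longrightarrow> slice_regular_op (- K) (product_left' i)" "i < 5 \<Longrightarrow> slice_regular_op (- K) (product_right' i)"
    using c5 product_sel regular_kernels regular_minus_W by auto
qed

section \<open>Product formulas, and the three calculi in terms of the kernel integrals\<close>

context
  fixes D :: "quat set" and J :: quat and \<Gamma>
  assumes sd: "spectral_domain D K" and \<Gamma>: "spectral_domain.surrounds D K J \<Gamma>"
begin

interpretation spectral_domain D K by (fact sd)

lemma kernel_int_products:
  assumes F: "intrinsic_on D F" and G: "intrinsic_on D G"
  shows "kernel_int J \<Gamma> RR (\<lambda>z. F z * G z) =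
      kernel_int J \<Gamma> RR F \<odot> kernel_int J \<Gamma> ZR G + kernel_int J \<Gamma> ZRR F \<odot> kernel_int J \<Gamma> R G + kernel_int J \<Gamma> ZR F \<odot> kernel_int J \<Gamma> RR G + kernel_int J \<Gamma> R F \<odot> kernel_int J \<Gamma> ZRR G"
    "kernel_int J \<Gamma> ZRR (\<lambda>z. F z * G z) =
      kernel_int J \<Gamma> ZRR F \<odot> kernel_int J \<Gamma> ZR G - W \<odot> kernel_int J \<Gamma> RR F \<odot> kernel_int J \<Gamma> R G + kernel_int J \<Gamma> ZR F \<odot> kernel_int J \<Gamma> ZRR G
      - W \<odot> kernel_int J \<Gamma> R F \<odot> kernel_int J \<Gamma> RR G + kernel_int J \<Gamma> R F \<odot> kernel_int J \<Gamma> R G"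
proof -
  have "kernel_int J \<Gamma> RR (\<lambda>z. F z * G z) = (\<Sum>i<4. kernel_int J \<Gamma> (product_left i) F \<odot> kernel_int J \<Gamma> (product_right i) G)"
    by (rule kernel_int_product [OF \<Gamma> F G]) (use regular_products kernel_identity(1) in auto)
  then show "kernel_int J \<Gamma> RR (\<lambda>z. F z * G z) =
      kernel_int J \<Gamma> RR F \<odot> kernel_int J \<Gamma> ZR G + kernel_int J \<Gamma> ZRR F \<odot> kernel_int J \<Gamma> R G + kernel_int J \<Gamma> ZR F \<odot> kernel_int J \<Gamma> RR G + kernel_int J \<Gamma> R F \<odot> kernel_int J \<Gamma> ZRR G"
    unfolding sum_less_4 product_sel .
  have "kernel_int J \<Gamma> ZRR (\<lambda>z. F z * G z) = (\<Sum>i<5. kernel_int J \<Gamma> (product_left' i) F \<odot> kernel_int J \<Gamma> (product_right' i) G)"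
    by (rule kernel_int_product [OF \<Gamma> F G]) (use regular_products kernel_identity(2) in auto)
  moreover have "kernel_int J \<Gamma> (\<lambda>s. - W \<odot> k s) F = - W \<odot> kernel_int J \<Gamma> k F" if "slice_regular_op (- K) k" for k
    by (rule kernel_int_left [OF \<Gamma> that F]) simp
  ultimately show "kernel_int J \<Gamma> ZRR (\<lambda>z. F z * G z) =
      kernel_int J \<Gamma> ZRR F \<odot> kernel_int J \<Gamma> ZR G - W \<odot> kernel_int J \<Gamma> RR F \<odot> kernel_int J \<Gamma> R G + kernel_int J \<Gamma> ZR F \<odot> kernel_int J \<Gamma> ZRR G
      - W \<odot> kernel_int J \<Gamma> R F \<odot> kernel_int J \<Gamma> RR G + kernel_int J \<Gamma> R F \<odot> kernel_int J \<Gamma> R G"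
    unfolding sum_less_5 product_sel by (simp add: op_distrib)
qed

text \<open>\<open>R\<close> equals \<open>Q_c\<close> times \<open>RR\<close>, that is
  \<open>ZZRR\<close> plus \<open>W\<close> times \<open>RR\<close>. This connects the kernel
  \<open>ZZRR\<close> of the \<open>D_calculus\<close> with the integrals in the product
  formulas.\<close>

lemma kernel_int_R_eq:
  assumes F: "intrinsic_on D F"
  shows "kernel_int J \<Gamma> R F = kernel_int J \<Gamma> ZZRR F + W \<odot> kernel_int J \<Gamma> RR F"
proof -
  have WRR: "slice_regular_op (- K) (\<lambda>s. W \<odot> RR s)"
    by (intro slice_regular_op_compose slice_regular_op_const open_res regular_kernels W_real)
  have "R s = ZZRR s + W \<odot> RR s" if "s \<in> - K" for s
    using R_inverse(1) [OF that, THEN op_left, of "R s"]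
    by (simp add: ZZRR_def RR_def Q_c_eq op_add_left op_assoc)
  then have "kernel_int J \<Gamma> R F = kernel_int J \<Gamma> ZZRR F + kernel_int J \<Gamma> (\<lambda>s. W \<odot> RR s) F"
    by (intro kernel_int_add [OF \<Gamma> _ _ F] WRR regular_kernels)
  also have "kernel_int J \<Gamma> (\<lambda>s. W \<odot> RR s) F = W \<odot> kernel_int J \<Gamma> RR F"
    by (rule kernel_int_left [OF \<Gamma> _ F]) simp_all
  finally show ?thesis .
qed

text \<open>\<open>Y\<close> does not commute with the kernels themselves. Its components do, and
  the integrals commute with the units as well; only the two facts together reach
  \<open>Y\<close>.\<close>

lemma kernel_int_Y_commute:
  assumes F: "intrinsic_on D F" and k: "k \<in> {R, RR, ZR, ZRR, ZZRR}"
  shows "op_commute Y (kernel_int J \<Gamma> k F)" "op_commute W (kernel_int J \<Gamma> k F)"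
proof -
  have reg: "slice_regular_op (- K) k" using k regular_kernels by blast
  have *: "op_commute a (kernel_int J \<Gamma> k F)"
    if a: "\<And>q. op_commute (lop q) a" "op_commute a A" "op_commute a W" for a
    by (rule kernel_int_commute [OF \<Gamma> reg F a(1)])
      (use k commute_kernels [of _ a] a op_commute_sym [OF a(1)] in blast)
  have YW: "op_commute Y1 W" "op_commute Y2 W" "op_commute Y3 W"
    unfolding W_eq
    by (intro op_commute_intros components_commute op_commute_simps
        op_commute_sym [OF components_commute(4)] op_commute_sym [OF components_commute(5)]
        op_commute_sym [OF components_commute(6)])+
  have "op_commute Y1 (kernel_int J \<Gamma> k F)" "op_commute Y2 (kernel_int J \<Gamma> k F)" "op_commute Y3 (kernel_int J \<Gamma> k F)"
    by (intro * YW real_commute op_commute_sym [OF components_commute(1)]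
        op_commute_sym [OF components_commute(2)] op_commute_sym [OF components_commute(3)])+
  moreover have "op_commute (lop q) (kernel_int J \<Gamma> k F)" for q by (rule kernel_int_real [OF \<Gamma> reg F])
  ultimately have "op_commute (kernel_int J \<Gamma> k F) Y"
    unfolding vec_part_def by (intro op_commute_intros op_commute_sym [of _ "kernel_int J \<Gamma> k F"])
  then show "op_commute Y (kernel_int J \<Gamma> k F)" by (rule op_commute_sym)
  show "op_commute W (kernel_int J \<Gamma> k F)" by (rule * [OF W_real op_commute_sym [OF A_W_commute]]) simp
qed

text \<open>The common form of all three calculi. \<open>Y\<close> leaves the integral on the left,
  and the integrals that remain are slice regular, so they may be rewritten over the fixed contour
  \<open>\<Gamma>\<close>.\<close>

lemma kernel_calculus:
  fixes \<K> :: "quat \<Rightarrow> 'a quat_op" and J' :: quat and m :: nat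
  assumes \<Gamma>': "surrounds J' \<Gamma>'" and k: "slice_regular_op (- K) k1" "slice_regular_op (- K) k2"
    and \<K>: "\<And>s. s \<in> - K \<Longrightarrow> \<K> s = x *\<^sub>R (k1 s + Y \<odot> k2 s)"
    and G: "\<And>i. i < m \<Longrightarrow> intrinsic_on D (G i)"
    and g: "\<And>z. slice_pt J' z \<in> D \<Longrightarrow> g (slice_pt J' z) = (\<Sum>i<m. slice_pt J' (G i z) * c i)"
  shows "calculus \<K> (U, J', \<Gamma>') g = (\<Sum>i<m. (x *\<^sub>R (kernel_int J \<Gamma> k1 (G i) + Y \<odot> kernel_int J \<Gamma> k2 (G i))) \<odot> lop (c i))"
proof -
  have J': "J' \<in> \<S>" by (rule surrounds_unit [OF \<Gamma>'])
  let ?k = "\<lambda>G z. k1 (slice_pt J' z) \<odot> scal J' (G z)" and ?k' = "\<lambda>G z. k2 (slice_pt J' z) \<odot> scal J' (G z)"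
  \<comment> \<open>The real factor is written as an operator so that it leaves the integral by
    \<open>path_int_left\<close>.\<close>
  let ?h = "\<lambda>G z. (x *\<^sub>R id_blinfun) \<odot> (?k G z + Y \<odot> ?k' G z)"
  have on: "\<K> (slice_pt J' z) \<odot> scal J' (G z) = ?h G z" if "\<gamma> \<in> \<Gamma>'" "z \<in> path_image \<gamma>" for \<gamma> z G
  proof -
    have "slice_pt J' z \<in> - K" using that surrounds_curves(4) [OF \<Gamma>'] slice_iff by blast
    then show ?thesis by (simp add: \<K> op_distrib op_assoc scaleR_add_right)
  qed
  have cont: "continuous_on_paths \<Gamma>' (?k (G i))" "continuous_on_paths \<Gamma>' (?k' (G i))" if "i < m" for i
    by (intro surrounds_op_holo_continuous [OF \<Gamma>'] kernel_op_holo [OF J' _ G [OF that]] k)+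
  have contY: "continuous_on_paths \<Gamma>' (\<lambda>z. Y \<odot> ?k' (G i) z)" if "i < m" for i
    using cont(2) [OF that] unfolding continuous_on_paths_def
    by (auto intro: continuous_on_op [OF continuous_on_const])
  have cont_h: "continuous_on_paths \<Gamma>' (\<lambda>z. ?k (G i) z + Y \<odot> ?k' (G i) z)" if "i < m" for i
    using cont(1) [OF that] contY [OF that] unfolding continuous_on_paths_def
    by (auto intro: continuous_on_add)
  have contK: "continuous_on_paths \<Gamma>' (\<lambda>z. \<K> (slice_pt J' z) \<odot> scal J' (G i z))" if "i < m" for i
  proof -
    have "continuous_on_paths \<Gamma>' (?h (G i))"
      using cont_h [OF that] unfolding continuous_on_paths_def
      by (auto intro!: continuous_on_op [OF continuous_on_const])
    then show ?thesis
      unfolding continuous_on_paths_def using on by (auto cong: continuous_on_cong)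
  qed
  have "calculus \<K> (U, J', \<Gamma>') g = (\<Sum>i<m. path_int J' \<Gamma>' (\<lambda>z. \<K> (slice_pt J' z) \<odot> scal J' (G i z)) \<odot> lop (c i))"
  proof (rule calculus_split [OF J' surrounds_curves(2) [OF \<Gamma>']])
    fix \<gamma> z assume "\<gamma> \<in> \<Gamma>'" "z \<in> path_image \<gamma>"
    then have "slice_pt J' z \<in> D" using surrounds_curves(4) [OF \<Gamma>'] slice_iff by blast
    then show "g (slice_pt J' z) = (\<Sum>i<m. slice_pt J' (G i z) * c i)" by (rule g)
  qed (use contK in auto)
  also have "\<dots> = (\<Sum>i<m. (x *\<^sub>R (kernel_int J \<Gamma> k1 (G i) + Y \<odot> kernel_int J \<Gamma> k2 (G i))) \<odot> lop (c i))"
  proof (rule sum.cong [OF refl])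
    fix i assume "i \<in> {..<m}"
    then have i: "i < m" by simp
    have "path_int J' \<Gamma>' (\<lambda>z. \<K> (slice_pt J' z) \<odot> scal J' (G i z)) = path_int J' \<Gamma>' (?h (G i))"
      by (rule path_int_cong) (rule on)
    also have "\<dots> = (x *\<^sub>R id_blinfun) \<odot> path_int J' \<Gamma>' (\<lambda>z. ?k (G i) z + Y \<odot> ?k' (G i) z)"
      by (rule path_int_left [OF surrounds_curves(2) [OF \<Gamma>'] cont_h [OF i]])
    also have "path_int J' \<Gamma>' (\<lambda>z. ?k (G i) z + Y \<odot> ?k' (G i) z) = path_int J' \<Gamma>' (?k (G i)) + path_int J' \<Gamma>' (\<lambda>z. Y \<odot> ?k' (G i) z)"
      by (rule path_int_add [OF surrounds_curves(2) [OF \<Gamma>'] cont(1) [OF i] contY [OF i]])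
    also have "path_int J' \<Gamma>' (\<lambda>z. Y \<odot> ?k' (G i) z) = Y \<odot> path_int J' \<Gamma>' (?k' (G i))"
      by (rule path_int_left [OF surrounds_curves(2) [OF \<Gamma>'] cont(2) [OF i]])
    finally show "path_int J' \<Gamma>' (\<lambda>z. \<K> (slice_pt J' z) \<odot> scal J' (G i z)) \<odot> lop (c i) =
       (x *\<^sub>R (kernel_int J \<Gamma> k1 (G i) + Y \<odot> kernel_int J \<Gamma> k2 (G i))) \<odot> lop (c i)"
      by (simp add: op_distrib scaleR_add_right kernel_int_indep [OF \<Gamma> \<Gamma>' k(1) G [OF i]] kernel_int_indep [OF \<Gamma> \<Gamma>' k(2) G [OF i]] kernel_int_eq_path_int [OF \<Gamma>' G [OF i]])
  qed
  finally show ?thesis .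
qed

end

text \<open>Since \<open>A\<close> commutes with \<open>F_kernel s T\<close>, the kernel
  \<open>P2_kernel s T\<close> is \<open>- (F_kernel s T \<odot> Z s)\<close>, and
  \<open>Z s\<close> moves past \<open>RR s\<close>.\<close>

lemma kernel_eqs:
  assumes s: "s \<in> - K"
  shows "S_kernel s T = 1 *\<^sub>R (ZR s + Y \<odot> R s)" "F_kernel s T = (- 4) *\<^sub>R (ZRR s + Y \<odot> RR s)"
    "P2_kernel s T = 4 *\<^sub>R (ZZRR s + Y \<odot> ZRR s)"
proof -
  have ZY: "lop s - conj_op T = Z s + Y" by (simp add: T_eq(2))
  show "S_kernel s T = 1 *\<^sub>R (ZR s + Y \<odot> R s)"
    unfolding S_kernel_def ZY ZR_def R_def [symmetric] by (simp add: op_add_left)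
  have F: "F_kernel s T = (- 4) *\<^sub>R ((Z s + Y) \<odot> RR s)"
    unfolding F_kernel_def ZY RR_def R_def [symmetric] by (simp add: op_assoc)
  then show "F_kernel s T = (- 4) *\<^sub>R (ZRR s + Y \<odot> RR s)"
    unfolding ZRR_def by (simp add: op_add_left RR_def)
  have AR: "op_commute A (RR s)"
    by (rule commute_kernels [OF s]) (simp_all add: A_W_commute op_commute_sym [OF real_commute(1)])
  have "op_commute A (Z s + Y)"
    by (intro op_commute_intros A_Y_commute op_commute_simps op_commute_sym [OF real_commute(1)])
  then have A: "A \<odot> ((Z s + Y) \<odot> RR s) = ((Z s + Y) \<odot> RR s) \<odot> A"
    using op_commute_compose [OF _ AR] by (simp add: op_commute_def)
  have "op_commute (Z s) (RR s)"
    unfolding RR_def by (intro op_commute_compose Z_R_commute s refl)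
  then have ZRR: "RR s \<odot> Z s = Z s \<odot> RR s" by (simp add: op_commute_def)
  have "P2_kernel s T = 4 *\<^sub>R (((Z s + Y) \<odot> RR s) \<odot> Z s)"
    unfolding P2_kernel_def F
    by (simp only: op_scaleR_left
        op_scaleR_right A
        op_diff_right) (simp add: algebra_simps)
  also have "((Z s + Y) \<odot> RR s) \<odot> Z s = (Z s + Y) \<odot> (Z s \<odot> RR s)" by (simp only: op_assoc ZRR)
  also have "\<dots> = ZZRR s + Y \<odot> ZRR s"
    by (simp only: op_add_left ZZRR_def ZRR_def RR_def)
  finally show "P2_kernel s T = 4 *\<^sub>R (ZZRR s + Y \<odot> ZRR s)" .
qed

end

text \<open>The last four terms combine to \<open>- 1/4 (d + l y) (d' + y l') = - 4 a0 a0'\<close>.\<close>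

lemma product_rule_algebra:
  fixes y w a0 a1 p q r :: "'a::real_normed_vector quat_op"
  assumes y: "w = - (y \<odot> y)" "r = a0 - w \<odot> q" "r' = a0' - w \<odot> q'"
    and comm: "op_commute y a0" "op_commute y a1" "op_commute y p" "op_commute y q"
    and P: "P = p \<odot> a1' - w \<odot> q \<odot> a0' + a1 \<odot> p' - w \<odot> a0 \<odot> q' + a0 \<odot> a0'"
    and Q: "Q = q \<odot> a1' + p \<odot> a0' + a1 \<odot> q' + a0 \<odot> p'"
    and left: "h = 1 *\<^sub>R (a1 + y \<odot> a0)" "d = 4 *\<^sub>R (r + y \<odot> p)" "l = (- 4) *\<^sub>R (p + y \<odot> q)"
    and right: "h' = 1 *\<^sub>R (a1' + y \<odot> a0')" "d' = 4 *\<^sub>R (r' + y \<odot> p')" "l' = (- 4) *\<^sub>R (p' + y \<odot> q')"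
  shows "(- 4) *\<^sub>R (P + y \<odot> Q) = l \<odot> h' + h \<odot> l' - (1/4) *\<^sub>R (d \<odot> d') - (1/4) *\<^sub>R (d \<odot> y \<odot> l')
      - (1/4) *\<^sub>R (l \<odot> y \<odot> d') - (1/4) *\<^sub>R (l \<odot> (y \<odot> y) \<odot> l')"
proof -
  have c: "a0 \<odot> y = y \<odot> a0" "a1 \<odot> y = y \<odot> a1" "p \<odot> y = y \<odot> p" "q \<odot> y = y \<odot> q"
    using comm by (simp_all add: op_commute_def)
  \<comment> \<open>\<open>y\<close> passes to the left, the terms with \<open>p\<close> cancel, and
    \<open>r + w \<odot> q\<close> is \<open>a0\<close>.\<close>
  have D: "d + l \<odot> y = 4 *\<^sub>R a0"
    by (simp add: left y op_distrib op_assoc c c [THEN op_left] algebra_simps)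
  have D': "d' + y \<odot> l' = 4 *\<^sub>R a0'"
    by (simp add: right y op_distrib op_assoc algebra_simps)
  have "(d + l \<odot> y) \<odot> (d' + y \<odot> l') = d \<odot> d' + d \<odot> y \<odot> l' + l \<odot> y \<odot> d' + l \<odot> (y \<odot> y) \<odot> l'"
    by (simp add: op_distrib op_assoc)
  then have four: "d \<odot> d' + d \<odot> y \<odot> l' + l \<odot> y \<odot> d' + l \<odot> (y \<odot> y) \<odot> l' = 16 *\<^sub>R (a0 \<odot> a0')"
    unfolding D D' by (simp add: op_distrib)
  \<comment> \<open>With \<open>w = - (y \<odot> y)\<close> the terms of \<open>P\<close> and
    \<open>y \<odot> Q\<close> factor, except for \<open>a0 \<odot> a0'\<close>, which the terms in
    \<open>four\<close> account for.\<close>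
  have "P + y \<odot> Q = (p + y \<odot> q) \<odot> (a1' + y \<odot> a0') + (a1 + y \<odot> a0) \<odot> (p' + y \<odot> q') + a0 \<odot> a0'"
    by (simp add: P Q y op_distrib op_assoc c c [THEN op_left] algebra_simps)
  then have "(- 4) *\<^sub>R (P + y \<odot> Q) = l \<odot> h' + h \<odot> l' - (1/4) *\<^sub>R (16 *\<^sub>R (a0 \<odot> a0'))"
    unfolding left right by (simp add: op_distrib scaleR_add_right scaleR_diff_right)
  then show ?thesis unfolding four [symmetric] by (simp only: scaleR_add_right diff_diff_eq add.assoc)
qed

theorem theorem4p7:
  fixes T :: "'a::banach quat_op"
    and f g :: "quat \<Rightarrow> quat" and Df Dg :: "quat set"
    and C C1 C2 C3 C4 C5 C6 :: contour
  assumes "T \<in> BCX"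
    and "(Df, f) \<in> SH_N (S_spectrum T)"
    and "(Dg, g) \<in> SH_L (S_spectrum T)"
    and "admissible T (Df \<inter> Dg) C"
    and "admissible T Df C1" and "admissible T Df C2" and "admissible T Df C3"
    and "admissible T Dg C4" and "admissible T Dg C5" and "admissible T Dg C6"
  shows "Laplace_calculus T C (\<lambda>s. f s * g s) =
      Laplace_calculus T C3 f \<odot> S_calculus T C4 g
      + S_calculus T C1 f \<odot> Laplace_calculus T C6 g
      - (1/4) *\<^sub>R (D_calculus T C2 f \<odot> D_calculus T C5 g)
      - (1/4) *\<^sub>R (D_calculus T C2 f \<odot> vec_part T \<odot> Laplace_calculus T C6 g)
      - (1/4) *\<^sub>R (Laplace_calculus T C3 f \<odot> vec_part T \<odot> D_calculus T C5 g)
      - (1/4) *\<^sub>R (Laplace_calculus T C3 f \<odot> (vec_part T \<odot> vec_part T) \<odot> Laplace_calculus T C6 g)"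
proof -
  interpret commuting_op T by standard (fact assms(1))
  have f: "intrinsic_slice_hyperholomorphic Df f" and g: "left_slice_hyperholomorphic Dg g"
    using assms(2,3) by (auto simp: SH_N_def SH_L_def)
  have Df: "open Df" "axially_symmetric Df" and Dg: "open Dg" "axially_symmetric Dg"
    using f g by (auto simp: intrinsic_slice_hyperholomorphic_def left_slice_hyperholomorphic_def)
  have Dfg: "open (Df \<inter> Dg)" "axially_symmetric (Df \<inter> Dg)"
    using Df Dg unfolding axially_symmetric_def by blast+
  obtain F where F: "intrinsic_on Df F"
    and fF: "\<And>J z. J \<in> \<S> \<Longrightarrow> slice_pt J z \<in> Df \<Longrightarrow> f (slice_pt J z) = slice_pt J (F z)"
    using intrinsic_slice_hyperholomorphic_lift [OF f] by blast
  obtain G where G: "\<And>i. i < 4 \<Longrightarrow> intrinsic_on Dg (G i)"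
    and gG: "\<And>J z. J \<in> \<S> \<Longrightarrow> slice_pt J z \<in> Dg \<Longrightarrow> g (slice_pt J z) = (\<Sum>i<4. slice_pt J (G i z) * quat_basis i)"
    using left_slice_hyperholomorphic_split [OF g] by metis
  obtain U J \<Gamma> where C: "C = (U, J, \<Gamma>)" by (cases C)
  have J: "J \<in> \<S>" using assms(4) unfolding C by (rule admissible_encloses)
  note sd = admissible_surrounds [OF _ _ _ assms(1)]
  note admC = assms(4) [unfolded C]
  \<comment> \<open>The contour of the product lies in both domains, so it serves as the common
    reference for all seven calculi.\<close>
  note fg = sd [OF Dfg admC] and f' = sd [OF Df admissible_mono [OF admC Int_lower1]]
    and g' = sd [OF Dg admissible_mono [OF admC Int_lower2]]
  have F': "intrinsic_on (Df \<inter> Dg) F" and G': "\<And>i. i < 4 \<Longrightarrow> intrinsic_on (Df \<inter> Dg) (G i)"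
    using F G intrinsic_on_subset by blast+
  \<comment> \<open>An intrinsic function is the case of a single summand with coefficient
    1.\<close>
  have calc_f: "calculus \<K> C' f = x *\<^sub>R (kernel_int J \<Gamma> k1 F + Y \<odot> kernel_int J \<Gamma> k2 F)"
    if "admissible T Df C'" "slice_regular_op (- K) k1" "slice_regular_op (- K) k2"
      "\<And>s. s \<in> - K \<Longrightarrow> \<K> s = x *\<^sub>R (k1 s + Y \<odot> k2 s)" for \<K> C' k1 k2 x
  proof -
    obtain U' J' \<Gamma>' where C': "C' = (U', J', \<Gamma>')" by (cases C')
    have adm: "admissible T Df (U', J', \<Gamma>')" using that(1) C' by simp
    show ?thesis
      using kernel_calculus [OF f' sd(2) [OF Df adm] that(2-4), of 1 "\<lambda>_. F" f "\<lambda>_. 1" U'] F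
        fF [OF admissible_encloses(2) [OF adm]] by (simp add: C')
  qed
  have calc_g: "calculus \<K> C' g = (\<Sum>i<4. (x *\<^sub>R (kernel_int J \<Gamma> k1 (G i) + Y \<odot> kernel_int J \<Gamma> k2 (G i))) \<odot> lop (quat_basis i))"
    if "admissible T Dg C'" "slice_regular_op (- K) k1" "slice_regular_op (- K) k2"
      "\<And>s. s \<in> - K \<Longrightarrow> \<K> s = x *\<^sub>R (k1 s + Y \<odot> k2 s)" for \<K> C' k1 k2 x
  proof -
    obtain U' J' \<Gamma>' where C': "C' = (U', J', \<Gamma>')" by (cases C')
    have adm: "admissible T Dg (U', J', \<Gamma>')" using that(1) C' by simp
    show ?thesis
      unfolding C' by (rule kernel_calculus [OF g' sd(2) [OF Dg adm] that(2-4) G gG [OF admissible_encloses(2) [OF adm]]])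
  qed
  define p q a0 a1 r where fE: "p = kernel_int J \<Gamma> ZRR F" "q = kernel_int J \<Gamma> RR F" "a0 = kernel_int J \<Gamma> R F" "a1 = kernel_int J \<Gamma> ZR F" "r = kernel_int J \<Gamma> ZZRR F"
  define p' q' a0' a1' r' where gE: "p' i = kernel_int J \<Gamma> ZRR (G i)" "q' i = kernel_int J \<Gamma> RR (G i)" "a0' i = kernel_int J \<Gamma> R (G i)"
    "a1' i = kernel_int J \<Gamma> ZR (G i)" "r' i = kernel_int J \<Gamma> ZZRR (G i)" for i
  define P Q where PQ: "P i = kernel_int J \<Gamma> ZRR (\<lambda>z. F z * G i z)" "Q i = kernel_int J \<Gamma> RR (\<lambda>z. F z * G i z)" for i
  have f_calc: "S_calculus T C1 f = 1 *\<^sub>R (a1 + Y \<odot> a0)" "D_calculus T C2 f = 4 *\<^sub>R (r + Y \<odot> p)"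
    "Laplace_calculus T C3 f = (- 4) *\<^sub>R (p + Y \<odot> q)"
    unfolding fE S_calculus_def D_calculus_def Laplace_calculus_def
    by (rule calc_f, fact, simp, simp, erule kernel_eqs)+
  have g_calc: "S_calculus T C4 g = (\<Sum>i<4. (1 *\<^sub>R (a1' i + Y \<odot> a0' i)) \<odot> lop (quat_basis i))"
    "D_calculus T C5 g = (\<Sum>i<4. (4 *\<^sub>R (r' i + Y \<odot> p' i)) \<odot> lop (quat_basis i))"
    "Laplace_calculus T C6 g = (\<Sum>i<4. ((- 4) *\<^sub>R (p' i + Y \<odot> q' i)) \<odot> lop (quat_basis i))"
    unfolding gE S_calculus_def D_calculus_def Laplace_calculus_def
    by (rule calc_g, fact, simp, simp, erule kernel_eqs)+
  have fg_calc: "Laplace_calculus T C (\<lambda>s. f s * g s) = (\<Sum>i<4. ((- 4) *\<^sub>R (P i + Y \<odot> Q i)) \<odot> lop (quat_basis i))"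
    unfolding PQ Laplace_calculus_def C
  proof (rule kernel_calculus [OF fg fg(2)])
    show "intrinsic_on (Df \<inter> Dg) (\<lambda>z. F z * G i z)" if "i < 4" for i
      using F' G' [OF that] unfolding intrinsic_on_def by (auto intro: holomorphic_intros)
    \<comment> \<open>Here it matters that f is intrinsic: its values lie in the slice, and multiply
      with the slice factor of each summand of g as complex numbers.\<close>
    show "f (slice_pt J z) * g (slice_pt J z) = (\<Sum>i<4. slice_pt J (F z * G i z) * quat_basis i)"
      if "slice_pt J z \<in> Df \<inter> Dg" for z
      using that by (simp add: fF J gG slice_pt_mult sum_distrib_left mult.assoc)
  qed (simp_all add: kernel_eqs(2))
  define h d l where fS: "h = 1 *\<^sub>R (a1 + Y \<odot> a0)" "d = 4 *\<^sub>R (r + Y \<odot> p)" "l = (- 4) *\<^sub>R (p + Y \<odot> q)"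
  define h' d' l' where gS: "h' i = 1 *\<^sub>R (a1' i + Y \<odot> a0' i)" "d' i = 4 *\<^sub>R (r' i + Y \<odot> p' i)"
    "l' i = (- 4) *\<^sub>R (p' i + Y \<odot> q' i)" for i
  \<comment> \<open>The rule for f and one intrinsic component of g; f stands on the left, so the
    constant \<open>quat_basis i\<close> can be multiplied on from the right afterwards.\<close>
  have main: "(- 4) *\<^sub>R (P i + Y \<odot> Q i) = l \<odot> h' i + h \<odot> l' i - (1/4) *\<^sub>R (d \<odot> d' i) - (1/4) *\<^sub>R (d \<odot> Y \<odot> l' i)
      - (1/4) *\<^sub>R (l \<odot> Y \<odot> d' i) - (1/4) *\<^sub>R (l \<odot> (Y \<odot> Y) \<odot> l' i)" if i: "i < 4" for i
  proof (rule product_rule_algebra [OF W_def _ _ _ _ _ _ _ _ fS gS])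
    show "r = a0 - W \<odot> q" "r' i = a0' i - W \<odot> q' i"
      unfolding fE gE kernel_int_R_eq [OF fg F'] kernel_int_R_eq [OF fg G' [OF i]] by simp_all
    show "P i = p \<odot> a1' i - W \<odot> q \<odot> a0' i + a1 \<odot> p' i - W \<odot> a0 \<odot> q' i + a0 \<odot> a0' i"
      "Q i = q \<odot> a1' i + p \<odot> a0' i + a1 \<odot> q' i + a0 \<odot> p' i"
      unfolding fE gE PQ by (fact kernel_int_products [OF fg F' G' [OF i]])+
  qed (simp_all add: fE kernel_int_Y_commute [OF fg F'])
  show ?thesis
    unfolding f_calc g_calc fg_calc fS [symmetric] gS [symmetric] op_sum_right scaleR_right.sum
      sum.distrib [symmetric] sum_subtractf [symmetric]
  proof (rule sum.cong [OF refl])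
    fix i :: nat assume "i \<in> {..<4}"
    then have "i < 4" by simp
    show "((- 4) *\<^sub>R (P i + Y \<odot> Q i)) \<odot> lop (quat_basis i) =
      l \<odot> (h' i \<odot> lop (quat_basis i)) + h \<odot> (l' i \<odot> lop (quat_basis i))
      - (1/4) *\<^sub>R (d \<odot> (d' i \<odot> lop (quat_basis i))) - (1/4) *\<^sub>R (d \<odot> Y \<odot> (l' i \<odot> lop (quat_basis i)))
      - (1/4) *\<^sub>R (l \<odot> Y \<odot> (d' i \<odot> lop (quat_basis i)))
      - (1/4) *\<^sub>R (l \<odot> (Y \<odot> Y) \<odot> (l' i \<odot> lop (quat_basis i)))"
      unfolding main [OF \<open>i < 4\<close>] op_distrib op_assoc ..
  qed
qed

end
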